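(* Let $f,g:\mathbb{R}^n\to\mathbb{R}^n$ be smooth ($C^\infty$) vector fields with $f(0)=0$, and consider the single-input system $\dot x=f(x)+u\,g(x)$, $(x,u)\in\mathbb{R}^n\times\mathbb{R}$. Assume that there exists a smooth function $V:\mathbb{R}^n\to\mathbb{R}^+$, positive definite and proper, such that for every $x\ne0$, either $(gV)(x)\neq0$, or one of the following two properties (A), (B) holds: (A) $(gV)(x)=0\Rightarrow (fV)(x)<0$; (B) there exists an integer $N=N(x)\ge1$ such that $$(gV)(x)=0,\qquad (f^iV)(x)=0,\quad i=1,2,\dots,N,$$ and $$(\Delta_1\Delta_2\cdots\Delta_kV)(x)=0\quad \text{for all } \Delta_1,\Delta_2,\dots,\Delta_k\in Lie\{f,g\}\setminus\{g\}\ \text{ with } \sum_{p=1}^k order_{\{f,g\}}\Delta_p\le N,$$ and such that one of the following properties holds: (P1) $(f^{N+1}V)(x)<0$; (P2) $N$ is odd and $\big([[\dots[[f,g],g],\dots,g],g]V\big)(x)\ne0$, where $g$ appears $N$ times; (P3) $N$ is even and $\big([[\dots[[f,g],g],\dots,g],g]V\big)(x)<0$, where $g$ appears $N$ times; (P4) $N$ is an arbitrary positive integer with $(f^{N+1}V)(x)=0$ and $\big([[\dots[[g,f],f],\dots,f],f]V\big)(x)\neq0$, where $f$ appears $N$ times. Then the system $\dot x=f(x)+u\,g(x)$ satisfies Assumption 1 (stated in the context), hence is SDF-SGAS, and therefore SDF-WGAS.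
   Context: Notation: $\mathbb{R}^+=[0,\infty)$; $|x|$ is the Euclidean norm. A function $V:\mathbb{R}^n\to\mathbb{R}^+$ is positive definite if $V(0)=0$ and $V(x)>0$ for $x\neq0$, and proper if its sublevel sets are compact. For a vector field $X:\mathbb{R}^n\to\mathbb{R}^n$ and a $C^1$ map $Y:\mathbb{R}^n\to\mathbb{R}^\ell$, $XY:=(DY)X$, where $DY$ is the derivative of $Y$; in particular $XV$ is the derivative of the function $V$ along $X$, and $\Delta_1\Delta_2\cdots\Delta_kV=\Delta_1(\Delta_2(\cdots(\Delta_kV)))$. The Lie bracket is $[X,Y]=XY-YX$. Also $(f^1V)(x):=(fV)(x)$ and $(f^iV)(x):=f(f^{i-1}V)(x)$ for $i=2,3,\dots$. $Lie\{f,g\}$ is the Lie algebra generated by $\{f,g\}$. Let $L_1:=span\{f,g\}$ and $L_{i+1}:=span\{[X,Y]: X\in L_i, Y\in L_1\}$, $i=1,2,\dots$. For nonzero $\Delta\in Lie\{f,g\}$: $order_{\{f,g\}}\Delta:=1$ if $\Delta\in L_1\setminus\{0\}$; $order_{\{f,g\}}\Delta:=k>1$ if $\Delta=\Delta_1+\Delta_2$ with $\Delta_1\in L_k\setminus\{0\}$ and $\Delta_2\in span\{\bigcup_{i=1}^{k-1}L_i\}$. The following is formulated for a general system $\dot x=F(x,u)$, $(x,u)\in\mathbb{R}^n\times\mathbb{R}^m$, $F(0,0)=0$; here $m=1$ and $F(x,u)=f(x)+u\,g(x)$. $x(\cdot,s,x_0,u)$ denotes the trajectory with $x(s,s,x_0,u)=x_0$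 corresponding to a measurable and locally essentially bounded control $u$. The class $K$ consists of the functions $a:\mathbb{R}^+\to\mathbb{R}^+$ that are continuous and strictly increasing with $a(0)=0$. Assumption 1. There exist a continuous, positive definite and proper function $V:\mathbb{R}^n\to\mathbb{R}^+$ and a function $a\in K$ such that for every $\xi>0$ and $x_0\neq0$ there exist a constant $\varepsilon=\varepsilon(x_0)\in(0,\xi]$ and a measurable and locally essentially bounded control $u(\cdot,x_0):[0,\varepsilon]\to\mathbb{R}^m$ satisfying $V(x(\varepsilon,0,x_0,u(\cdot,x_0)))<V(x_0)$ and $V(x(s,0,x_0,u(\cdot,x_0)))\le a(V(x_0))$ for all $s\in[0,\varepsilon]$. Definition (SDF-SGAS, Semi-Global Asymptotic Stabilizability by Sampled-Data Feedback). For every $R>0$ and for any given partition of times $T_1:=0<T_2<T_3<\dots$ with $T_\nu\to\infty$, there exist a neighborhood $\Pi$ of zero with $B[0,R]:=\{x\in\mathbb{R}^n:|x|\le R\}\subset\Pi$ and a map $k:\mathbb{R}^+\times\Pi\to\mathbb{R}^m$ such that for any $x\in\Pi$ the map $k(\cdot,x)$ is measurable and locally essentially bounded, and the trajectory $x(\cdot)$ of $\dot x=F(x,k(t,x(T_i)))$, $t\in[T_i,T_{i+1})$, $i=1,2,\dots$, $x(0)\in\Pi$, satisfies: (Stability) for every $\varepsilon>0$ there exists $\delta=\delta(\varepsilon)>0$ such that $x(0)\in\Pi$, $|x(0)|\le\delta$ implies $|x(t)|\le\varepsilon$ for all $t\ge0$; (Attractivity) $\lim_{t\to\infty}x(t)=0$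 for all $x(0)\in\Pi$. Definition (SDF-WGAS, Weak Global Asymptotic Stabilizability by Sampled-Data Feedback). For every constant $\tau>0$ there exist a mapping $T:\mathbb{R}^n\setminus\{0\}\to\mathbb{R}^+\setminus\{0\}$ with $T(x)\le\tau$ for all $x\in\mathbb{R}^n\setminus\{0\}$ and a mapping $k(t,x;x_0):\mathbb{R}^+\times\mathbb{R}^n\times\mathbb{R}^n\to\mathbb{R}^m$ such that for any fixed $(x,x_0)\in\mathbb{R}^n\times\mathbb{R}^n$ the map $k(\cdot,x;x_0):\mathbb{R}^+\to\mathbb{R}^m$ is measurable and locally essentially bounded, and such that for every $x_0\ne0$ there exists a sequence of times $t_1:=0<t_2<t_3<\dots$ with $t_\nu\to\infty$ in such a way that the trajectory $x(\cdot)$ of the sampled-data closed-loop system $\dot x=F(x,k(t,x(t_i);x_0))$, $t\in[t_i,t_{i+1})$, $i=1,2,\dots$, $x(0)=x_0$, satisfies $t_{i+1}-t_i=T(x(t_i))$, $i=1,2,\dots$, together with: (Stability) for every $\varepsilon>0$ there exists $\delta=\delta(\varepsilon)>0$ such that $|x(0)|\le\delta$ implies $|x(t)|\le\varepsilon$ for all $t\ge0$; (Attractivity) $\lim_{t\to\infty}x(t)=0$ for all $x(0)\in\mathbb{R}^n$. *)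

theory Defs
  imports "HOL-Analysis.Analysis"
begin

section \<open>Smooth maps, Lie derivatives and brackets\<close>

text \<open>On finite-dimensional spaces, \<open>C\<^sup>k\<close> amounts to \<open>C\<^sup>k\<^sup>-\<^sup>1\<close> regularity of the derivative in every
  fixed direction.\<close>

primrec C_k :: "nat \<Rightarrow> ('a::euclidean_space \<Rightarrow> 'b::euclidean_space) \<Rightarrow> bool" where
  "C_k 0 h \<longleftrightarrow> continuous_on UNIV h"
| "C_k (Suc k) h \<longleftrightarrow>
    (\<forall>x. h differentiable (at x)) \<and> (\<forall>v. C_k k (\<lambda>x. frechet_derivative h (at x) v))"

definition smooth :: "('a::euclidean_space \<Rightarrow> 'b::euclidean_space) \<Rightarrow> bool" where
  "smooth h \<longleftrightarrow> (\<forall>k. C_k k h)"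

definition lie_deriv ::
  "('a::euclidean_space \<Rightarrow> 'a) \<Rightarrow> ('a \<Rightarrow> 'b::euclidean_space) \<Rightarrow> 'a \<Rightarrow> 'b" where
  "lie_deriv X Y = (\<lambda>x. frechet_derivative Y (at x) (X x))"

definition lie_bracket ::
  "('a::euclidean_space \<Rightarrow> 'a) \<Rightarrow> ('a \<Rightarrow> 'a) \<Rightarrow> 'a \<Rightarrow> 'a" where
  "lie_bracket X Y = (\<lambda>x. lie_deriv X Y x - lie_deriv Y X x)"

inductive_set lie_algebra :: "('a::euclidean_space \<Rightarrow> 'a) \<Rightarrow> ('a \<Rightarrow> 'a) \<Rightarrow> ('a \<Rightarrow> 'a) set"
  for f g where
  left: "f \<in> lie_algebra f g"
| right: "g \<in> lie_algebra f g"
| lincomb: "X \<in> lie_algebra f g \<Longrightarrow> Y \<in> lie_algebra f g \<Longrightarrow>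
    (\<lambda>x. a *\<^sub>R X x + b *\<^sub>R Y x) \<in> lie_algebra f g"
| bracket: "X \<in> lie_algebra f g \<Longrightarrow> Y \<in> lie_algebra f g \<Longrightarrow> lie_bracket X Y \<in> lie_algebra f g"

text \<open>The real linear span in the space of all vector fields; the function type is not an instance
  of \<^class>\<open>real_vector\<close>, so \<^const>\<open>span\<close> does not apply.\<close>

definition field_span :: "('a::euclidean_space \<Rightarrow> 'a) set \<Rightarrow> ('a \<Rightarrow> 'a) set" where
  "field_span S =
    {\<lambda>x. \<Sum>Y\<in>A. c Y *\<^sub>R Y x | (A :: ('a \<Rightarrow> 'a) set) (c :: ('a \<Rightarrow> 'a) \<Rightarrow> real). finite A \<and> A \<subseteq> S}"

text \<open>The layers are indexed from 1; the value at 0 is a dummy.\<close>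

fun lie_layer :: "('a::euclidean_space \<Rightarrow> 'a) \<Rightarrow> ('a \<Rightarrow> 'a) \<Rightarrow> nat \<Rightarrow> ('a \<Rightarrow> 'a) set" where
  "lie_layer f g 0 = {\<lambda>_. 0}"
| "lie_layer f g (Suc 0) = field_span {f, g}"
| "lie_layer f g (Suc (Suc i)) =
    field_span {lie_bracket X Y | X Y. X \<in> lie_layer f g (Suc i) \<and> Y \<in> field_span {f, g}}"

definition has_lie_order ::
  "('a::euclidean_space \<Rightarrow> 'a) \<Rightarrow> ('a \<Rightarrow> 'a) \<Rightarrow> ('a \<Rightarrow> 'a) \<Rightarrow> nat \<Rightarrow> bool" where
  "has_lie_order f g D k \<longleftrightarrow>
    (k = 1 \<and> D \<in> lie_layer f g 1 - {\<lambda>_. 0}) \<or>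
    (k > 1 \<and> (\<exists>D1 \<in> lie_layer f g k - {\<lambda>_. 0}. \<exists>D2 \<in> field_span (\<Union>i\<in>{1..k-1}. lie_layer f g i).
      D = (\<lambda>x. D1 x + D2 x)))"

text \<open>When the layers are linearly dependent, several \<open>k\<close> may be admissible for one field; the order
  is the least of them. It is meaningful only for nonzero members of \<^const>\<open>lie_algebra\<close>.\<close>

definition lie_order ::
  "('a::euclidean_space \<Rightarrow> 'a) \<Rightarrow> ('a \<Rightarrow> 'a) \<Rightarrow> ('a \<Rightarrow> 'a) \<Rightarrow> nat" where
  "lie_order f g D = (LEAST k. has_lie_order f g D k)"


section \<open>Lyapunov-type functions\<close>

definition positive_definite :: "('a::euclidean_space \<Rightarrow> real) \<Rightarrow> bool" where
  "positive_definite V \<longleftrightarrow> V 0 = 0 \<and> (\<forall>x. x \<noteq> 0 \<longrightarrow> V x > 0)"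

definition proper_fun :: "('a::euclidean_space \<Rightarrow> real) \<Rightarrow> bool" where
  "proper_fun V \<longleftrightarrow> (\<forall>c. compact {x. V x \<le> c})"

text \<open>Only the values on \<open>[0, \<infinity>)\<close> matter; nonnegativity there follows from \<open>a 0 = 0\<close>.\<close>

definition class_K :: "(real \<Rightarrow> real) \<Rightarrow> bool" where
  "class_K a \<longleftrightarrow> continuous_on {0..} a \<and> strict_mono_on {0..} a \<and> a 0 = 0"


section \<open>Controls and trajectories\<close>

definition admissible_control :: "real set \<Rightarrow> (real \<Rightarrow> 'b::euclidean_space) \<Rightarrow> bool" where
  "admissible_control I u \<longleftrightarrow>
    u \<in> borel_measurable (lebesgue_on I) \<and>
    (\<forall>K. compact K \<and> K \<subseteq> I \<longrightarrow> (\<exists>M. AE t in lebesgue_on K. norm (u t) \<le> M))"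

text \<open>Caratheodory solutions of \<open>x' = F(x, u(t))\<close> on \<open>[a, b]\<close>, in integral form.\<close>

definition trajectory_on ::
  "('a::euclidean_space \<Rightarrow> 'b::euclidean_space \<Rightarrow> 'a) \<Rightarrow> (real \<Rightarrow> 'b) \<Rightarrow> real \<Rightarrow> real \<Rightarrow>
    (real \<Rightarrow> 'a) \<Rightarrow> bool" where
  "trajectory_on F u a b x \<longleftrightarrow>
    (\<lambda>s. F (x s) (u s)) absolutely_integrable_on {a..b} \<and>
    (\<forall>t\<in>{a..b}. x t = x a + integral {a..t} (\<lambda>s. F (x s) (u s)))"

definition time_partition :: "(nat \<Rightarrow> real) \<Rightarrow> bool" where
  "time_partition T \<longleftrightarrow> T 0 = 0 \<and> strict_mono T \<and> filterlim T at_top sequentially"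

text \<open>Closed-loop trajectories on \<open>[0, \<infinity>)\<close>, for a feedback \<open>k\<close> whose state argument ranges over \<open>P\<close>
  (hence sampled states must lie in \<open>P\<close>).\<close>

definition sampled_trajectory ::
  "('a::euclidean_space \<Rightarrow> 'b::euclidean_space \<Rightarrow> 'a) \<Rightarrow> (real \<Rightarrow> 'a \<Rightarrow> 'b) \<Rightarrow> 'a set \<Rightarrow>
    (nat \<Rightarrow> real) \<Rightarrow> (real \<Rightarrow> 'a) \<Rightarrow> bool" where
  "sampled_trajectory F k P T x \<longleftrightarrow>
    (\<forall>i. x (T i) \<in> P \<and> trajectory_on F (\<lambda>t. k t (x (T i))) (T i) (T (Suc i)) x)"


section \<open>Sampled-data stabilizability\<close>

text \<open>Below, a property of ``the'' trajectory is rendered as existence of a trajectory on the whole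
  time interval together with the property for every such trajectory.\<close>

definition assumption1 :: "('a::euclidean_space \<Rightarrow> 'b::euclidean_space \<Rightarrow> 'a) \<Rightarrow> bool" where
  "assumption1 F \<longleftrightarrow>
    (\<exists>V a. continuous_on UNIV V \<and> positive_definite V \<and> proper_fun V \<and> class_K a \<and>
      (\<forall>\<xi>>0. \<forall>x0. x0 \<noteq> 0 \<longrightarrow>
        (\<exists>\<epsilon> u. 0 < \<epsilon> \<and> \<epsilon> \<le> \<xi> \<and> admissible_control {0..\<epsilon>} u \<and>
          (\<exists>x. trajectory_on F u 0 \<epsilon> x \<and> x 0 = x0) \<and>
          (\<forall>x. trajectory_on F u 0 \<epsilon> x \<and> x 0 = x0 \<longrightarrow>
            V (x \<epsilon>) < V x0 \<and> (\<forall>s\<in>{0..\<epsilon>}. V (x s) \<le> a (V x0))))))"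

definition SDF_SGAS :: "('a::euclidean_space \<Rightarrow> 'b::euclidean_space \<Rightarrow> 'a) \<Rightarrow> bool" where
  "SDF_SGAS F \<longleftrightarrow>
    (\<forall>R>0. \<forall>T. time_partition T \<longrightarrow>
      (\<exists>P k. 0 \<in> interior P \<and> cball 0 R \<subseteq> P \<and>
        (\<forall>x\<in>P. admissible_control {0..} (\<lambda>t. k t x)) \<and>
        (\<forall>x0\<in>P. \<exists>x. sampled_trajectory F k P T x \<and> x 0 = x0) \<and>
        (\<forall>\<epsilon>>0. \<exists>\<delta>>0. \<forall>x. sampled_trajectory F k P T x \<and> norm (x 0) \<le> \<delta> \<longrightarrow>
          (\<forall>t\<ge>0. norm (x t) \<le> \<epsilon>)) \<and>
        (\<forall>x. sampled_trajectory F k P T x \<longrightarrow> (x \<longlongrightarrow> 0) at_top)))"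

text \<open>In the weak notion the sampling times \<open>t x0\<close> and the feedback \<open>k _ _ x0\<close> depend on the initial
  state \<open>x0\<close>, and \<open>\<delta>\<close> is uniform over these. Since \<open>T\<close> is a map on the nonzero states only, sampled
  states are required to be nonzero.\<close>

definition SDF_WGAS :: "('a::euclidean_space \<Rightarrow> 'b::euclidean_space \<Rightarrow> 'a) \<Rightarrow> bool" where
  "SDF_WGAS F \<longleftrightarrow>
    (\<forall>\<tau>>0. \<exists>(T :: 'a \<Rightarrow> real) (k :: real \<Rightarrow> 'a \<Rightarrow> 'a \<Rightarrow> 'b).
      (\<forall>x. x \<noteq> 0 \<longrightarrow> 0 < T x \<and> T x \<le> \<tau>) \<and>
      (\<forall>x x0. admissible_control {0..} (\<lambda>t. k t x x0)) \<and>
      (\<exists>t :: 'a \<Rightarrow> nat \<Rightarrow> real.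
        (\<forall>x0. x0 \<noteq> 0 \<longrightarrow>
          time_partition (t x0) \<and>
          (\<exists>x. sampled_trajectory F (\<lambda>s y. k s y x0) UNIV (t x0) x \<and> x 0 = x0) \<and>
          (\<forall>x. sampled_trajectory F (\<lambda>s y. k s y x0) UNIV (t x0) x \<and> x 0 = x0 \<longrightarrow>
            (\<forall>i. x (t x0 i) \<noteq> 0 \<and> t x0 (Suc i) - t x0 i = T (x (t x0 i))) \<and>
            (x \<longlongrightarrow> 0) at_top)) \<and>
        (\<forall>\<epsilon>>0. \<exists>\<delta>>0. \<forall>x0 x. x0 \<noteq> 0 \<and> norm x0 \<le> \<delta> \<and>
          sampled_trajectory F (\<lambda>s y. k s y x0) UNIV (t x0) x \<and> x 0 = x0 \<longrightarrow>
          (\<forall>s\<ge>0. norm (x s) \<le> \<epsilon>))))"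

end

theory Submission
  imports Defs
begin

text \<open>At a point \<open>x\<close> where all words in \<open>f\<close> and \<open>g\<close> of length at most \<open>N\<close> annihilate \<open>V\<close>, a control on a
  time interval of length \<open>\<epsilon>\<close> changes \<open>V\<close> by \<open>\<epsilon>\<^sup>N\<^sup>+\<^sup>1\<close> times a sum of iterated integrals of the
  rescaled control, up to \<open>O(\<epsilon>\<^sup>N\<^sup>+\<^sup>2)\<close>. Conjugating the series by the flow of one of the two fields turns
  this sum into an explicit integral to first order in the other field. A large control with a primitive
  proportional to \<open>s (1 - s)\<close> makes the bracket with \<open>g\<close> dominate (P2, P3); a small control
  tested against the Bernstein form of the coefficients of the words with one \<open>g\<close> handles P4.

  The resulting local descent is uniform on annuli of \<open>V\<close> by compactness, and yields open-loop plans along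
  which \<open>V\<close> stays positive and below one of a family of decaying envelopes indexed by integers. A plan
  kept forever is the weak feedback; replanning with the least possible index at each sampling time is the
  semi-global one.\<close>

section \<open>Smooth maps and Lie brackets\<close>

text \<open>The conditions at a point give a decrease of V without any rate, and the number N may
  jump from point to point, so nothing is uniform near the origin. Compactness makes descent uniform
  only on annuli bounded away from zero, and both the step length and the decrease may shrink with
  the inner level. Time is therefore organised in stages that halve the level, each with a duration
  that depends on the level alone. To make all states finish a stage together, a state that descends
  early has to be held low. Descent steps alone cannot fill a prescribed time, because they may
  become arbitrarily short; close to the origin the uncontrolled drift takes over. It moves slowly
  there since f vanishes at 0, and it never hits the origin, an equilibrium being unreachable in
  finite time. Frequent sampling would destroy progress if each replanning restarted the clock.
  Envelopes are therefore functions of an integer and of absolute time, so that the remainder of a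
  plan is again a plan with the same integer.\<close>

lemma C_k_SucD: "C_k (Suc k) h \<Longrightarrow> C_k k h"
proof (induction k arbitrary: h)
  case 0
  then show ?case
    by (auto intro!: differentiable_imp_continuous_on simp: differentiable_on_def differentiable_at_withinI)
next
  case (Suc k)
  have "\<forall>x. h differentiable (at x)" "C_k (Suc k) (\<lambda>x. frechet_derivative h (at x) v)" for v
    using Suc.prems C_k.simps(2)[of "Suc k" h] by blast+
  then show ?case using Suc.IH C_k.simps(2)[of k h] by blast
qed

lemma C_k_const: "C_k k (\<lambda>_. c)"
  by (induction k arbitrary: c) auto

lemma C_k_add: "C_k k h1 \<Longrightarrow> C_k k h2 \<Longrightarrow> C_k k (\<lambda>x. h1 x + h2 x)"
proof (induction k arbitrary: h1 h2)
  case 0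
  then show ?case by (auto intro: continuous_intros)
next
  case (Suc k)
  then have d: "h1 differentiable (at x)" "h2 differentiable (at x)" for x by auto
  then have "frechet_derivative (\<lambda>x. h1 x + h2 x) (at x) =
      (\<lambda>v. frechet_derivative h1 (at x) v + frechet_derivative h2 (at x) v)" for x
    by (intro frechet_derivative_at[symmetric] has_derivative_add) (auto simp: frechet_derivative_works)
  with Suc d show ?case by simp
qed

lemma C_k_bounded_linear:
  assumes "bounded_linear L"
  shows "C_k k h \<Longrightarrow> C_k k (\<lambda>x. L (h x))"
proof (induction k arbitrary: h)
  case 0
  then show ?case by (auto intro: bounded_linear.continuous_on[OF assms])
next
  case (Suc k)
  then have d: "h differentiable (at x)" for x by auto
  then have hd: "((\<lambda>x. L (h x)) has_derivative (\<lambda>v. L (frechet_derivative h (at x) v))) (at x)" for x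
    by (intro bounded_linear.has_derivative[OF assms]) (auto simp: frechet_derivative_works)
  then have "frechet_derivative (\<lambda>x. L (h x)) (at x) = (\<lambda>v. L (frechet_derivative h (at x) v))" for x
    by (rule frechet_derivative_at[symmetric])
  with Suc hd show ?case by (auto simp: differentiable_def)
qed

lemma C_k_scaleR:
  fixes a :: "'a::euclidean_space \<Rightarrow> real" and h :: "'a \<Rightarrow> 'b::euclidean_space"
  shows "C_k k a \<Longrightarrow> C_k k h \<Longrightarrow> C_k k (\<lambda>x. a x *\<^sub>R h x)"
proof (induction k arbitrary: a h)
  case 0
  then show ?case by (auto intro: continuous_intros)
next
  case (Suc k)
  then have d: "a differentiable (at x)" "h differentiable (at x)" for x by auto
  have hd: "((\<lambda>x. a x *\<^sub>R h x) has_derivative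
      (\<lambda>v. a x *\<^sub>R frechet_derivative h (at x) v + frechet_derivative a (at x) v *\<^sub>R h x)) (at x)" for x
    by (intro has_derivative_scaleR) (use d in \<open>auto simp: frechet_derivative_works\<close>)
  then have "frechet_derivative (\<lambda>x. a x *\<^sub>R h x) (at x) =
      (\<lambda>v. a x *\<^sub>R frechet_derivative h (at x) v + frechet_derivative a (at x) v *\<^sub>R h x)" for x
    by (rule frechet_derivative_at[symmetric])
  \<comment> \<open>The product rule leaves each factor undifferentiated once, so the factors have
    to be demoted from class \<open>Suc k\<close> to class \<open>k\<close>.\<close>
  moreover have "C_k k a" "C_k k h" using Suc.prems C_k_SucD by blast+
  ultimately have "C_k k (\<lambda>x. frechet_derivative (\<lambda>x. a x *\<^sub>R h x) (at x) v)" for v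
    using Suc by (auto intro!: C_k_add)
  moreover have "(\<lambda>x. a x *\<^sub>R h x) differentiable (at x)" for x
    using hd differentiableI by blast
  ultimately show ?case by simp
qed

lemma C_k_sum: "finite I \<Longrightarrow> (\<And>i. i \<in> I \<Longrightarrow> C_k k (h i)) \<Longrightarrow> C_k k (\<lambda>x. \<Sum>i\<in>I. h i x)"
  by (induction I rule: finite_induct) (auto intro: C_k_add C_k_const)

lemma smooth_const: "smooth (\<lambda>_. c)"
  by (simp add: smooth_def C_k_const)

lemma smooth_differentiable: "smooth h \<Longrightarrow> h differentiable (at x)"
  unfolding smooth_def using C_k.simps(2) by blast

lemma smooth_continuous: "smooth h \<Longrightarrow> continuous_on S h"
  unfolding smooth_def by (metis C_k.simps(1) continuous_on_subset subset_UNIV)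

lemma smooth_has_derivative: "smooth h \<Longrightarrow> (h has_derivative frechet_derivative h (at x)) (at x)"
  using smooth_differentiable frechet_derivative_works by blast

lemma smooth_frechet_derivative: "smooth h \<Longrightarrow> smooth (\<lambda>x. frechet_derivative h (at x) v)"
  unfolding smooth_def using C_k.simps(2) by blast

lemma smooth_bounded_linear: "bounded_linear L \<Longrightarrow> smooth h \<Longrightarrow> smooth (\<lambda>x. L (h x))"
  by (simp add: smooth_def C_k_bounded_linear)

lemma smooth_add: "smooth h1 \<Longrightarrow> smooth h2 \<Longrightarrow> smooth (\<lambda>x. h1 x + h2 x)"
  by (simp add: smooth_def C_k_add)

lemma smooth_diff: "smooth h1 \<Longrightarrow> smooth h2 \<Longrightarrow> smooth (\<lambda>x. h1 x - h2 x)"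
  using smooth_add[of h1 "\<lambda>x. - h2 x"] smooth_bounded_linear[OF bounded_linear_minus[OF bounded_linear_ident], of h2]
  by simp

lemma linear_eq_sum_Basis:
  fixes L :: "'a::euclidean_space \<Rightarrow> 'b::real_vector"
  assumes "linear L"
  shows "L w = (\<Sum>b\<in>Basis. (w \<bullet> b) *\<^sub>R L b)"
proof -
  have "L w = L (\<Sum>b\<in>Basis. (w \<bullet> b) *\<^sub>R b)" by (simp only: euclidean_representation)
  also have "\<dots> = (\<Sum>b\<in>Basis. (w \<bullet> b) *\<^sub>R L b)"
    unfolding linear_sum[OF assms] by (intro sum.cong refl linear_cmul[OF assms])
  finally show ?thesis .
qed

lemma frechet_derivative_eq_sum:
  "smooth h \<Longrightarrow> frechet_derivative h (at x) w = (\<Sum>b\<in>Basis. (w \<bullet> b) *\<^sub>R frechet_derivative h (at x) b)"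
  by (rule linear_eq_sum_Basis) (use smooth_differentiable linear_frechet_derivative in blast)

text \<open>\<open>C_k\<close> controls the derivative in fixed directions, whereas here the
  direction \<open>X x\<close> moves with the point. Expanding it in the basis turns the Lie
  derivative into a finite sum of products of smooth functions.\<close>

lemma smooth_lie_deriv:
  assumes "smooth X" "smooth h" shows "smooth (lie_deriv X h)"
proof -
  have "lie_deriv X h = (\<lambda>x. \<Sum>b\<in>Basis. (X x \<bullet> b) *\<^sub>R frechet_derivative h (at x) b)"
    unfolding lie_deriv_def by (intro ext frechet_derivative_eq_sum assms)
  moreover have "C_k k (\<lambda>x. \<Sum>b\<in>Basis. (X x \<bullet> b) *\<^sub>R frechet_derivative h (at x) b)" for k
    using assms smooth_frechet_derivative[OF assms(2)]
    by (intro C_k_sum C_k_scaleR C_k_bounded_linear[OF bounded_linear_inner_left]) (auto simp: smooth_def)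
  ultimately show ?thesis by (simp add: smooth_def)
qed

lemma smooth_lie_bracket: "smooth X \<Longrightarrow> smooth Y \<Longrightarrow> smooth (lie_bracket X Y)"
  unfolding lie_bracket_def by (intro smooth_diff smooth_lie_deriv)

lemma lie_deriv_diff:
  assumes "smooth \<phi>" "smooth \<psi>"
  shows "lie_deriv X (\<lambda>x. \<phi> x - \<psi> x) = (\<lambda>x. lie_deriv X \<phi> x - lie_deriv X \<psi> x)"
proof -
  have "frechet_derivative (\<lambda>x. \<phi> x - \<psi> x) (at x) =
      (\<lambda>v. frechet_derivative \<phi> (at x) v - frechet_derivative \<psi> (at x) v)" for x
    using assms by (intro frechet_derivative_at[symmetric] has_derivative_diff smooth_has_derivative)
  then show ?thesis by (simp add: lie_deriv_def)
qed

lemma lie_deriv_diff_const: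
  assumes "smooth \<phi>" shows "lie_deriv X (\<lambda>x. \<phi> x - c) = lie_deriv X \<phi>"
  using lie_deriv_diff[OF assms smooth_const, of X c] by (simp add: lie_deriv_def)

section \<open>Symmetry of second derivatives, and the bracket as a commutator\<close>

lemma smooth_directional_DERIV:
  fixes \<phi> :: "'a::euclidean_space \<Rightarrow> real"
  assumes "smooth \<phi>"
  shows "((\<lambda>s. \<phi> (x + s *\<^sub>R a)) has_real_derivative frechet_derivative \<phi> (at (x + s *\<^sub>R a)) a) (at s)"
proof -
  have "((\<lambda>s. \<phi> (x + s *\<^sub>R a)) has_derivative
      (\<lambda>r. frechet_derivative \<phi> (at (x + s *\<^sub>R a)) (r *\<^sub>R a))) (at s)"
    by (rule has_derivative_compose[of "\<lambda>s. x + s *\<^sub>R a" "\<lambda>r. r *\<^sub>R a", OF _ smooth_has_derivative[OF assms]])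
      (auto intro!: derivative_eq_intros)
  moreover have "frechet_derivative \<phi> (at (x + s *\<^sub>R a)) (r *\<^sub>R a) = frechet_derivative \<phi> (at (x + s *\<^sub>R a)) a * r" for r
    using linear_frechet_derivative[OF smooth_differentiable[OF assms]] by (simp add: linear_cmul)
  ultimately show ?thesis by (simp add: has_field_derivative_def)
qed

text \<open>Two mean value theorems: one in direction \<open>a\<close> for the increment of
  \<open>\<phi>\<close> under the shift by \<open>h *\<^sub>R b\<close>, then one in direction
  \<open>b\<close> for the derivative so obtained. The left side is symmetric in \<open>a\<close>
  and \<open>b\<close>.\<close>

lemma second_difference_mvt:
  fixes \<phi> :: "'a::euclidean_space \<Rightarrow> real"
  assumes "smooth \<phi>" "0 < h"
  obtains s t where "0 < s" "s < h" "0 < t" "t < h"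
    "\<phi> (x + h *\<^sub>R a + h *\<^sub>R b) - \<phi> (x + h *\<^sub>R a) - \<phi> (x + h *\<^sub>R b) + \<phi> x =
      h * h * frechet_derivative (\<lambda>y. frechet_derivative \<phi> (at y) a) (at (x + s *\<^sub>R a + t *\<^sub>R b)) b"
proof -
  let ?A = "\<lambda>y. frechet_derivative \<phi> (at y) a"
  have "\<exists>s. 0 < s \<and> s < h \<and>
      (\<phi> (x + h *\<^sub>R b + h *\<^sub>R a) - \<phi> (x + h *\<^sub>R a)) - (\<phi> (x + h *\<^sub>R b + 0 *\<^sub>R a) - \<phi> (x + 0 *\<^sub>R a)) =
      (h - 0) * (?A (x + h *\<^sub>R b + s *\<^sub>R a) - ?A (x + s *\<^sub>R a))"
    by (rule MVT2) (use assms in \<open>auto intro!: DERIV_diff smooth_directional_DERIV\<close>)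
  then obtain s where s: "0 < s" "s < h" and es: "(\<phi> (x + h *\<^sub>R b + h *\<^sub>R a) - \<phi> (x + h *\<^sub>R a)) - (\<phi> (x + h *\<^sub>R b + 0 *\<^sub>R a) - \<phi> (x + 0 *\<^sub>R a)) =
      (h - 0) * (?A (x + h *\<^sub>R b + s *\<^sub>R a) - ?A (x + s *\<^sub>R a))" by blast
  have "\<exists>t. 0 < t \<and> t < h \<and> ?A (x + s *\<^sub>R a + h *\<^sub>R b) - ?A (x + s *\<^sub>R a + 0 *\<^sub>R b) =
      (h - 0) * frechet_derivative ?A (at (x + s *\<^sub>R a + t *\<^sub>R b)) b"
    by (rule MVT2) (use assms in \<open>auto intro!: smooth_directional_DERIV smooth_frechet_derivative\<close>)
  then obtain t where t: "0 < t" "t < h" and et: "?A (x + s *\<^sub>R a + h *\<^sub>R b) - ?A (x + s *\<^sub>R a + 0 *\<^sub>R b) =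
      (h - 0) * frechet_derivative ?A (at (x + s *\<^sub>R a + t *\<^sub>R b)) b" by blast
  show thesis
    by (rule that[OF s t]) (use es et in \<open>simp add: algebra_simps\<close>)
qed

text \<open>Both orders of differentiation are limits of the same symmetric second difference
  divided by \<open>h * h\<close>, taken at intermediate points that shrink to
  \<open>x\<close>.\<close>

lemma frechet_derivative_swap:
  fixes \<phi> :: "'a::euclidean_space \<Rightarrow> real"
  assumes "smooth \<phi>"
  shows "frechet_derivative (\<lambda>y. frechet_derivative \<phi> (at y) a) (at x) b =
    frechet_derivative (\<lambda>y. frechet_derivative \<phi> (at y) b) (at x) a"
proof -
  let ?P = "\<lambda>y. frechet_derivative (\<lambda>y. frechet_derivative \<phi> (at y) a) (at y) b"
  let ?Q = "\<lambda>y. frechet_derivative (\<lambda>y. frechet_derivative \<phi> (at y) b) (at y) a"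
  define h where "h n = inverse (real (Suc n))" for n
  have h: "0 < h n" for n by (simp add: h_def)
  have h0: "h \<longlonglongrightarrow> 0" unfolding h_def by (rule LIMSEQ_inverse_real_of_nat)
  have "\<exists>s t s' t'. 0 < s \<and> s < h n \<and> 0 < t \<and> t < h n \<and> 0 < s' \<and> s' < h n \<and> 0 < t' \<and> t' < h n \<and>
      ?P (x + s *\<^sub>R a + t *\<^sub>R b) = ?Q (x + s' *\<^sub>R b + t' *\<^sub>R a)" for n
  proof -
    obtain s t where 1: "0 < s" "s < h n" "0 < t" "t < h n"
      "\<phi> (x + h n *\<^sub>R a + h n *\<^sub>R b) - \<phi> (x + h n *\<^sub>R a) - \<phi> (x + h n *\<^sub>R b) + \<phi> x = h n * h n * ?P (x + s *\<^sub>R a + t *\<^sub>R b)"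
      using second_difference_mvt[OF assms h] by metis
    obtain s' t' where 2: "0 < s'" "s' < h n" "0 < t'" "t' < h n"
      "\<phi> (x + h n *\<^sub>R b + h n *\<^sub>R a) - \<phi> (x + h n *\<^sub>R b) - \<phi> (x + h n *\<^sub>R a) + \<phi> x = h n * h n * ?Q (x + s' *\<^sub>R b + t' *\<^sub>R a)"
      using second_difference_mvt[OF assms h] by metis
    have "h n * h n * ?P (x + s *\<^sub>R a + t *\<^sub>R b) = h n * h n * ?Q (x + s' *\<^sub>R b + t' *\<^sub>R a)"
      using 1(5) 2(5) by (simp add: algebra_simps)
    then show ?thesis using 1 2 h[of n] by (metis mult_cancel_left mult_eq_0_iff less_irrefl)
  qed
  then obtain s t s' t' where st: "\<And>n. 0 < s n \<and> s n < h n \<and> 0 < t n \<and> t n < h n \<and> 0 < s' n \<and> s' n < h n \<and> 0 < t' n \<and> t' n < h n \<and>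
      ?P (x + s n *\<^sub>R a + t n *\<^sub>R b) = ?Q (x + s' n *\<^sub>R b + t' n *\<^sub>R a)" by metis
  have z: "r \<longlonglongrightarrow> 0" if "\<And>n. 0 < r n \<and> r n < h n" for r :: "nat \<Rightarrow> real"
    by (rule tendsto_sandwich[OF _ _ tendsto_const h0]) (use that less_imp_le in \<open>auto intro!: always_eventually\<close>)
  have "(\<lambda>n. x + s n *\<^sub>R a + t n *\<^sub>R b) \<longlonglongrightarrow> x + 0 *\<^sub>R a + 0 *\<^sub>R b"
    "(\<lambda>n. x + s' n *\<^sub>R b + t' n *\<^sub>R a) \<longlonglongrightarrow> x + 0 *\<^sub>R b + 0 *\<^sub>R a"
    using st by (intro tendsto_intros z; blast)+
  moreover have "isCont ?P x" "isCont ?Q x"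
    using smooth_continuous[OF smooth_frechet_derivative[OF smooth_frechet_derivative[OF assms]], of UNIV]
    by (auto simp: continuous_on_eq_continuous_at)
  ultimately have "(\<lambda>n. ?P (x + s n *\<^sub>R a + t n *\<^sub>R b)) \<longlonglongrightarrow> ?P x" "(\<lambda>n. ?Q (x + s' n *\<^sub>R b + t' n *\<^sub>R a)) \<longlonglongrightarrow> ?Q x"
    using isCont_tendsto_compose[of x ?P] isCont_tendsto_compose[of x ?Q] by auto
  moreover have "(\<lambda>n. ?P (x + s n *\<^sub>R a + t n *\<^sub>R b)) = (\<lambda>n. ?Q (x + s' n *\<^sub>R b + t' n *\<^sub>R a))"
    using st by (intro ext) blast
  ultimately show ?thesis by (metis (no_types) LIMSEQ_unique)
qed

text \<open>Each composition splits into a first-order part, through the derivative of the inner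
  field, and a second-order part that is symmetric in the two fields. The symmetric parts cancel;
  the first-order parts give the bracket with the convention \<open>(DY) X - (DX) Y\<close>.\<close>

lemma lie_deriv_lie_bracket:
  fixes \<phi> :: "'a::euclidean_space \<Rightarrow> real"
  assumes "smooth X" "smooth Y" "smooth \<phi>"
  shows "lie_deriv (lie_bracket X Y) \<phi> x = lie_deriv X (lie_deriv Y \<phi>) x - lie_deriv Y (lie_deriv X \<phi>) x"
proof -
  let ?D = "\<lambda>b y. frechet_derivative \<phi> (at y) b"
  have key: "lie_deriv X (lie_deriv Y \<phi>) x = frechet_derivative \<phi> (at x) (frechet_derivative Y (at x) (X x)) +
      (\<Sum>b\<in>Basis. \<Sum>c\<in>Basis. (Y x \<bullet> b) * (X x \<bullet> c) * frechet_derivative (?D b) (at x) c)"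
    if "smooth X" "smooth Y" for X Y :: "'a \<Rightarrow> 'a"
  proof -
    have eq: "lie_deriv Y \<phi> = (\<lambda>y. \<Sum>b\<in>Basis. (Y y \<bullet> b) * ?D b y)"
      unfolding lie_deriv_def real_scaleR_def[symmetric] by (intro ext frechet_derivative_eq_sum assms)
    have "((\<lambda>y. \<Sum>b\<in>Basis. (Y y \<bullet> b) * ?D b y) has_derivative
        (\<lambda>w. \<Sum>b\<in>Basis. (Y x \<bullet> b) * frechet_derivative (?D b) (at x) w + (frechet_derivative Y (at x) w \<bullet> b) * ?D b x)) (at x)"
      using that assms
      by (intro has_derivative_sum has_derivative_mult has_derivative_inner_left smooth_has_derivative smooth_frechet_derivative)
    then have "frechet_derivative (lie_deriv Y \<phi>) (at x) (X x) =
        (\<Sum>b\<in>Basis. (Y x \<bullet> b) * frechet_derivative (?D b) (at x) (X x) + (frechet_derivative Y (at x) (X x) \<bullet> b) * ?D b x)"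
      unfolding eq by (subst frechet_derivative_at[symmetric], assumption) simp
    moreover have "(\<Sum>b\<in>Basis. (frechet_derivative Y (at x) (X x) \<bullet> b) * ?D b x) =
        frechet_derivative \<phi> (at x) (frechet_derivative Y (at x) (X x))"
      using frechet_derivative_eq_sum[OF assms(3), of x "frechet_derivative Y (at x) (X x)"] by simp
    moreover have "(Y x \<bullet> b) * frechet_derivative (?D b) (at x) (X x) =
        (\<Sum>c\<in>Basis. (Y x \<bullet> b) * (X x \<bullet> c) * frechet_derivative (?D b) (at x) c)" for b
      by (subst frechet_derivative_eq_sum[OF smooth_frechet_derivative[OF assms(3)]])
        (simp add: sum_distrib_left mult.assoc)
    ultimately show ?thesis
      unfolding lie_deriv_def[of X] by (simp add: sum.distrib)
  qed
  have "(\<Sum>b\<in>Basis. \<Sum>c\<in>Basis. (Y x \<bullet> b) * (X x \<bullet> c) * frechet_derivative (?D b) (at x) c) =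
      (\<Sum>b\<in>Basis. \<Sum>c\<in>Basis. (X x \<bullet> b) * (Y x \<bullet> c) * frechet_derivative (?D b) (at x) c)"
    by (subst sum.swap) (intro sum.cong refl, simp add: frechet_derivative_swap[OF assms(3)] mult_ac)
  moreover have "frechet_derivative \<phi> (at x) (u - w) = frechet_derivative \<phi> (at x) u - frechet_derivative \<phi> (at x) w" for u w
    using linear_frechet_derivative[OF smooth_differentiable[OF assms(3)]] by (simp add: linear_diff)
  ultimately show ?thesis
    using key[OF assms(1,2)] key[OF assms(2,1)]
    by (simp add: lie_bracket_def) (simp add: lie_deriv_def)
qed

section \<open>Leading terms of the operator series\<close>

text \<open>The degree \<open>m\<close> part of the Chen-Fliess series of \<open>\<phi>\<close> for
  the time-varying field \<open>a X + b Y\<close> started at \<open>x\<close>. The recursion peels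
  off the operator acting first on \<open>\<phi>\<close>, which belongs to the outermost integral,
  that is, to the latest time.\<close>

primrec leading_term ::
  "('a::euclidean_space \<Rightarrow> 'a) \<Rightarrow> ('a \<Rightarrow> 'a) \<Rightarrow> (real \<Rightarrow> real) \<Rightarrow> (real \<Rightarrow> real) \<Rightarrow> 'a \<Rightarrow> nat \<Rightarrow>
    ('a \<Rightarrow> real) \<Rightarrow> real \<Rightarrow> real" where
  "leading_term X Y a b x 0 \<phi> = (\<lambda>_. \<phi> x)"
| "leading_term X Y a b x (Suc m) \<phi> = (\<lambda>t. integral {0..t} (\<lambda>s.
    a s * leading_term X Y a b x m (lie_deriv X \<phi>) s + b s * leading_term X Y a b x m (lie_deriv Y \<phi>) s))"

lemma leading_term_swap: "leading_term X Y a b x m \<phi> t = leading_term Y X b a x m \<phi> t"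
  by (induction m arbitrary: \<phi> t) (simp_all add: add.commute)

text \<open>Homogeneity of degree \<open>m\<close> in the pair of coefficients. It later trades a
  small coefficient of the drift for a large control.\<close>

lemma leading_term_scale:
  "leading_term X Y (\<lambda>s. \<kappa> * a s) (\<lambda>s. \<kappa> * b s) x m \<phi> t = \<kappa> ^ m * leading_term X Y a b x m \<phi> t"
proof (induction m arbitrary: \<phi> t)
  case (Suc m)
  have "leading_term X Y (\<lambda>s. \<kappa> * a s) (\<lambda>s. \<kappa> * b s) x (Suc m) \<phi> t = integral {0..t} (\<lambda>s. \<kappa> ^ Suc m *
      (a s * leading_term X Y a b x m (lie_deriv X \<phi>) s + b s * leading_term X Y a b x m (lie_deriv Y \<phi>) s))"
    by (simp add: Suc.IH algebra_simps)
  then show ?case by (simp only: integral_mult_right leading_term.simps)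
qed simp

lemma continuous_on_leading_term:
  assumes "continuous_on {0..1} a" "continuous_on {0..1} b"
  shows "continuous_on {0..1} (leading_term X Y a b x m \<phi>)"
proof (induction m arbitrary: \<phi>)
  case (Suc m)
  then show ?case
    using assms by (auto intro!: indefinite_integral_continuous_1 integrable_continuous_real continuous_intros)
qed simp

lemma leading_term_DERIV:
  assumes "continuous_on {0..1} a" "continuous_on {0..1} b" "t \<in> {0..1}"
  shows "(leading_term X Y a b x (Suc m) \<phi> has_real_derivative
    (a t * leading_term X Y a b x m (lie_deriv X \<phi>) t + b t * leading_term X Y a b x m (lie_deriv Y \<phi>) t))
    (at t within {0..1})"
  using assms
  by (auto intro!: integral_has_real_derivative continuous_intros continuous_on_leading_term)

lemma DERIV_power_div_fact:
  fixes U :: "real \<Rightarrow> real"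
  assumes "(U has_real_derivative u) (at t within S)"
  shows "((\<lambda>t. U t ^ Suc j / fact (Suc j)) has_real_derivative u * (U t ^ j / fact j)) (at t within S)"
  by (rule DERIV_cong[OF DERIV_cdivide[OF DERIV_power[OF assms]]]) (simp add: fact_Suc del: of_nat_Suc)

text \<open>Along the flow the operator series for \<open>a X + b Y\<close> is conjugated by the exponential of
  \<open>(W 1 - W t) X\<close>, where \<open>W' = a\<close>; all contributions of \<open>X\<close> alone then telescope.\<close>

lemma leading_term_conjugate:
  fixes X Y a b x \<phi> and N :: nat
  defines "L \<equiv> leading_term X Y a b x"
  assumes a: "continuous_on {0..1} a" and b: "continuous_on {0..1} b"
    and W: "\<And>t. t \<in> {0..1} \<Longrightarrow> (W has_real_derivative a t) (at t within {0..1})" and W0: "W 0 = 0"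
  shows "L (Suc N) \<phi> 1 = W 1 ^ Suc N / fact (Suc N) * (lie_deriv X ^^ Suc N) \<phi> x +
    integral {0..1} (\<lambda>s. b s * (\<Sum>k\<le>N. (W 1 - W s) ^ k / fact k *
      L (N - k) (lie_deriv Y ((lie_deriv X ^^ k) \<phi>)) s))"
proof -
  define \<phi>' where "\<phi>' k = (lie_deriv X ^^ k) \<phi>" for k
  \<comment> \<open>A primitive that joins the two sides of the claim: at \<open>t = 1\<close> the
    factors \<open>W 1 - W t\<close> vanish and only \<open>k = 0\<close> remains; at
    \<open>t = 0\<close> the iterated integrals vanish and only the last summand, in
    \<open>X\<close> alone, remains.\<close>
  define Z where "Z t = (\<Sum>k\<le>N. (W 1 - W t) ^ k / fact k * L (Suc (N - k)) (\<phi>' k) t)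
    + (W 1 - W t) ^ Suc N / fact (Suc N) * \<phi>' (Suc N) x" for t
  define D where "D t = b t * (\<Sum>k\<le>N. (W 1 - W t) ^ k / fact k * L (N - k) (lie_deriv Y (\<phi>' k)) t)" for t
  have "(Z has_real_derivative D t) (at t within {0..1})" if t: "t \<in> {0..1}" for t
  proof -
    define E where "E k = (W 1 - W t) ^ k / fact k * a t * L (N - k) (\<phi>' (Suc k)) t" for k
    have dW: "((\<lambda>t. (W 1 - W t) ^ k / fact k) has_real_derivative
        (if k = 0 then 0 else - (a t * (W 1 - W t) ^ (k - 1) / fact (k - 1)))) (at t within {0..1})" for k
    proof (cases k)
      case (Suc j)
      have "((\<lambda>t. W 1 - W t) has_real_derivative - a t) (at t within {0..1})"
        by (auto intro!: derivative_eq_intros W[OF t])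
      then show ?thesis unfolding Suc using DERIV_power_div_fact[of _ "- a t"] by fastforce
    qed (auto intro!: derivative_eq_intros)
    have L': "(L (Suc (N - k)) (\<phi>' k) has_real_derivative
        a t * L (N - k) (\<phi>' (Suc k)) t + b t * L (N - k) (lie_deriv Y (\<phi>' k)) t) (at t within {0..1})" for k
      using leading_term_DERIV[OF a b t, of X Y x "N - k" "\<phi>' k"] by (simp add: L_def \<phi>'_def)
    have sub: "E j = a t * (W 1 - W t) ^ j / fact j * L (Suc (N - Suc j)) (\<phi>' (Suc j)) t" if "Suc j \<le> N" for j
      using that by (simp add: E_def Suc_diff_Suc)
    have term_d: "((\<lambda>t. (W 1 - W t) ^ k / fact k * L (Suc (N - k)) (\<phi>' k) t) has_real_derivative
        (if k = 0 then 0 else - E (k - 1)) + E k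
        + b t * ((W 1 - W t) ^ k / fact k * L (N - k) (lie_deriv Y (\<phi>' k)) t)) (at t within {0..1})" if "k \<le> N" for k
    proof -
      have "(if k = 0 then 0 else - (a t * (W 1 - W t) ^ (k - 1) / fact (k - 1))) * L (Suc (N - k)) (\<phi>' k) t
          = (if k = 0 then 0 else - E (k - 1))"
        using sub[of "k - 1"] that by (cases k) auto
      then show ?thesis
        by (intro DERIV_cong[OF DERIV_mult[OF dW L']]) (simp add: E_def algebra_simps)
    qed
    \<comment> \<open>The derivative of each weight cancels the \<open>a\<close> part of the
      preceding iterated integral. The leftover \<open>E N\<close> is cancelled in turn by the
      derivative of the last summand of \<open>Z\<close>.\<close>
    have tele: "(\<Sum>k\<le>N. (if k = 0 then 0 else - E (k - 1)) + E k) = E N"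
      by (induction N) auto
    have "(Z has_real_derivative (\<Sum>k\<le>N. (if k = 0 then 0 else - E (k - 1)) + E k
        + b t * ((W 1 - W t) ^ k / fact k * L (N - k) (lie_deriv Y (\<phi>' k)) t))
        + (if Suc N = 0 then 0 else - (a t * (W 1 - W t) ^ (Suc N - 1) / fact (Suc N - 1))) * \<phi>' (Suc N) x)
        (at t within {0..1})"
      unfolding Z_def
      by (intro DERIV_add DERIV_sum DERIV_cmult_right term_d dW) auto
    moreover have "(\<Sum>k\<le>N. (if k = 0 then 0 else - E (k - 1)) + E k
        + b t * ((W 1 - W t) ^ k / fact k * L (N - k) (lie_deriv Y (\<phi>' k)) t)) = E N + D t"
      using tele by (simp only: sum.distrib D_def sum_distrib_left)
    moreover have "E N = a t * (W 1 - W t) ^ N / fact N * \<phi>' (Suc N) x"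
      by (simp add: E_def L_def)
    ultimately show ?thesis by simp
  qed
  then have "(D has_integral (Z 1 - Z 0)) {0..1}"
    by (intro fundamental_theorem_of_calculus) (auto simp: has_real_derivative_iff_has_vector_derivative)
  moreover have "Z 1 = L (Suc N) \<phi> 1"
  proof -
    have "(\<Sum>k\<le>N. (W 1 - W 1) ^ k / fact k * L (Suc (N - k)) (\<phi>' k) 1) =
        (\<Sum>k\<le>N. if k = 0 then L (Suc N) \<phi> 1 else 0)"
      by (intro sum.cong) (auto simp: \<phi>'_def)
    then show ?thesis by (simp add: Z_def)
  qed
  moreover have "Z 0 = W 1 ^ Suc N / fact (Suc N) * \<phi>' (Suc N) x"
    by (simp add: Z_def L_def W0)
  ultimately show ?thesis
    unfolding D_def \<phi>'_def by (auto dest!: integral_unique)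
qed

lemma continuous_on_interval_bdd:
  fixes h :: "real \<Rightarrow> real"
  assumes "continuous_on {a..b} h"
  shows "\<exists>B\<ge>0. \<forall>s\<in>{a..b}. \<bar>h s\<bar> \<le> B"
proof -
  have "bounded (h ` {a..b})" by (intro compact_imp_bounded compact_continuous_image assms) auto
  then obtain B where "\<forall>s\<in>{a..b}. \<bar>h s\<bar> \<le> B" by (auto simp: bounded_iff)
  then show ?thesis by (intro exI[of _ "max 0 B"]) (auto simp: le_max_iff_disj)
qed

text \<open>At \<open>\<delta> = 0\<close> the term is a pure power of \<open>X\<close> with weight
  \<open>W s ^ m / fact m\<close>. By induction on \<open>m\<close> the error is linear in
  \<open>\<delta>\<close>, uniformly in time: the branch in \<open>Y\<close> carries an explicit
  factor \<open>\<delta>\<close>, the branch in \<open>X\<close> inherits its error.\<close>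

lemma leading_term_perturb:
  fixes X Y a q x
  defines "L \<equiv> \<lambda>\<delta>. leading_term X Y a (\<lambda>s. \<delta> * q s) x"
  assumes a: "continuous_on {0..1} a" and q: "continuous_on {0..1} q"
    and W: "\<And>t. t \<in> {0..1} \<Longrightarrow> (W has_real_derivative a t) (at t within {0..1})" and W0: "W 0 = 0"
  obtains C where "\<And>\<delta> s. \<bar>\<delta>\<bar> \<le> 1 \<Longrightarrow> s \<in> {0..1} \<Longrightarrow>
    \<bar>L \<delta> m \<phi> s - W s ^ m / fact m * (lie_deriv X ^^ m) \<phi> x\<bar> \<le> C * \<bar>\<delta>\<bar>"
proof -
  define T where "T m \<phi> s = W s ^ m / fact m * (lie_deriv X ^^ m) \<phi> x" for m \<phi> s
  have cW: "continuous_on {0..1} W" using W DERIV_continuous_on by blast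
  then have cT: "continuous_on {0..1} (T m \<phi>)" for m \<phi>
    unfolding T_def by (intro continuous_intros) auto
  have cL: "continuous_on {0..1} (L \<delta> m \<phi>)" for \<delta> m \<phi>
    unfolding L_def by (intro continuous_on_leading_term continuous_intros a q)
  have "\<exists>C\<ge>0. \<forall>\<delta> s. \<bar>\<delta>\<bar> \<le> 1 \<and> s \<in> {0..1} \<longrightarrow> \<bar>L \<delta> m \<phi> s - T m \<phi> s\<bar> \<le> C * \<bar>\<delta>\<bar>"
  proof (induction m arbitrary: \<phi>)
    case 0
    then show ?case by (intro exI[of _ 0]) (simp add: L_def T_def)
  next
    case (Suc m)
    obtain C1 where C1: "C1 \<ge> 0" "\<And>\<delta> s. \<bar>\<delta>\<bar> \<le> 1 \<Longrightarrow> s \<in> {0..1} \<Longrightarrow>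
        \<bar>L \<delta> m (lie_deriv X \<phi>) s - T m (lie_deriv X \<phi>) s\<bar> \<le> C1 * \<bar>\<delta>\<bar>" using Suc[of "lie_deriv X \<phi>"] by blast
    obtain C2 where C2: "C2 \<ge> 0" "\<And>\<delta> s. \<bar>\<delta>\<bar> \<le> 1 \<Longrightarrow> s \<in> {0..1} \<Longrightarrow>
        \<bar>L \<delta> m (lie_deriv Y \<phi>) s - T m (lie_deriv Y \<phi>) s\<bar> \<le> C2 * \<bar>\<delta>\<bar>" using Suc[of "lie_deriv Y \<phi>"] by blast
    obtain A where A: "A \<ge> 0" "\<And>s. s \<in> {0..1} \<Longrightarrow> \<bar>a s\<bar> \<le> A" using continuous_on_interval_bdd[OF a] by blast
    obtain Q where Q: "Q \<ge> 0" "\<And>s. s \<in> {0..1} \<Longrightarrow> \<bar>q s\<bar> \<le> Q" using continuous_on_interval_bdd[OF q] by blast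
    obtain B where B: "B \<ge> 0" "\<And>s. s \<in> {0..1} \<Longrightarrow> \<bar>T m (lie_deriv Y \<phi>) s\<bar> \<le> B" using continuous_on_interval_bdd[OF cT] by blast
    have "\<bar>L \<delta> (Suc m) \<phi> t - T (Suc m) \<phi> t\<bar> \<le> (A * C1 + Q * (C2 + B)) * \<bar>\<delta>\<bar>" if d: "\<bar>\<delta>\<bar> \<le> 1" and t: "t \<in> {0..1}" for \<delta> t
    proof -
      let ?h = "\<lambda>s. a s * (L \<delta> m (lie_deriv X \<phi>) s - T m (lie_deriv X \<phi>) s) + \<delta> * q s * L \<delta> m (lie_deriv Y \<phi>) s"
      have sub: "{0..t} \<subseteq> {0..1}" using t by auto
      have "((\<lambda>s. a s * T m (lie_deriv X \<phi>) s) has_integral (T (Suc m) \<phi> t - T (Suc m) \<phi> 0)) {0..t}"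
      proof (rule fundamental_theorem_of_calculus)
        fix s assume "s \<in> {0..t}"
        then have "(W has_real_derivative a s) (at s within {0..t})"
          using W[of s] sub by (auto intro: DERIV_subset)
        then have "((\<lambda>s. T (Suc m) \<phi> s) has_real_derivative (a s * T m (lie_deriv X \<phi>) s)) (at s within {0..t})"
          unfolding T_def
          by (intro DERIV_cong[OF DERIV_cmult_right[OF DERIV_power_div_fact]]) (auto simp: funpow_swap1)
        then show "((\<lambda>s. T (Suc m) \<phi> s) has_vector_derivative (a s * T m (lie_deriv X \<phi>) s)) (at s within {0..t})"
          by (simp add: has_real_derivative_iff_has_vector_derivative)
      qed (use t in auto)
      moreover have "T (Suc m) \<phi> 0 = 0" by (simp add: T_def W0)
      moreover have "((\<lambda>s. a s * L \<delta> m (lie_deriv X \<phi>) s + \<delta> * q s * L \<delta> m (lie_deriv Y \<phi>) s) has_integral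
          L \<delta> (Suc m) \<phi> t) {0..t}"
      proof -
        have "(\<lambda>s. a s * L \<delta> m (lie_deriv X \<phi>) s + \<delta> * q s * L \<delta> m (lie_deriv Y \<phi>) s) integrable_on {0..t}"
          by (intro integrable_continuous_real continuous_on_subset[OF _ sub] continuous_intros a q cL)
        then show ?thesis unfolding L_def by (simp add: has_integral_integral)
      qed
      ultimately have "((\<lambda>s. (a s * L \<delta> m (lie_deriv X \<phi>) s + \<delta> * q s * L \<delta> m (lie_deriv Y \<phi>) s)
          - a s * T m (lie_deriv X \<phi>) s) has_integral (L \<delta> (Suc m) \<phi> t - T (Suc m) \<phi> t)) {0..t}"
        by (intro has_integral_diff) simp_all
      moreover have "(a s * L \<delta> m (lie_deriv X \<phi>) s + \<delta> * q s * L \<delta> m (lie_deriv Y \<phi>) s)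
          - a s * T m (lie_deriv X \<phi>) s = ?h s" for s by (simp add: right_diff_distrib)
      ultimately have h: "(?h has_integral (L \<delta> (Suc m) \<phi> t - T (Suc m) \<phi> t)) {0..t}"
        by simp
      have "norm (L \<delta> (Suc m) \<phi> t - T (Suc m) \<phi> t) \<le> (A * C1 + Q * (C2 + B)) * \<bar>\<delta>\<bar> * measure lborel {0..t}"
      proof (rule has_integral_bound_real[where S="{}", OF _ _ h])
        show "0 \<le> (A * C1 + Q * (C2 + B)) * \<bar>\<delta>\<bar>" using A B C1 C2 Q by auto
        fix s assume "s \<in> {0..t} - {}"
        then have s: "s \<in> {0..1}" using sub by auto
        \<comment> \<open>This branch is multiplied by \<open>\<delta>\<close>, so a bound of the
          iterated integral that is uniform in \<open>\<delta>\<close> is enough.\<close>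
        have "\<bar>L \<delta> m (lie_deriv Y \<phi>) s\<bar> \<le> C2 * \<bar>\<delta>\<bar> + B" using C2(2)[OF d s] B(2)[OF s] by linarith
        also have "\<dots> \<le> C2 + B" using C2(1) d by (simp add: mult_left_le)
        finally have 2: "\<bar>q s\<bar> * \<bar>L \<delta> m (lie_deriv Y \<phi>) s\<bar> \<le> Q * (C2 + B)"
          using Q(2)[OF s] Q(1) by (intro mult_mono) auto
        have 1: "\<bar>a s\<bar> * \<bar>L \<delta> m (lie_deriv X \<phi>) s - T m (lie_deriv X \<phi>) s\<bar> \<le> A * (C1 * \<bar>\<delta>\<bar>)"
          using C1(2)[OF d s] A(2)[OF s] A(1) by (intro mult_mono) auto
        have "\<bar>?h s\<bar> \<le> \<bar>a s\<bar> * \<bar>L \<delta> m (lie_deriv X \<phi>) s - T m (lie_deriv X \<phi>) s\<bar> + \<bar>\<delta>\<bar> * (\<bar>q s\<bar> * \<bar>L \<delta> m (lie_deriv Y \<phi>) s\<bar>)"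
          by (rule order_trans[OF abs_triangle_ineq]) (simp add: abs_mult)
        also have "\<dots> \<le> A * (C1 * \<bar>\<delta>\<bar>) + \<bar>\<delta>\<bar> * (Q * (C2 + B))"
          by (intro add_mono 1 mult_left_mono 2) auto
        finally show "norm (?h s) \<le> (A * C1 + Q * (C2 + B)) * \<bar>\<delta>\<bar>" by (simp add: algebra_simps)
      qed auto
      also have "\<dots> \<le> (A * C1 + Q * (C2 + B)) * \<bar>\<delta>\<bar> * 1"
        by (intro mult_left_mono) (use t A B C1 C2 Q in auto)
      finally show ?thesis by simp
    qed
    moreover have "A * C1 + Q * (C2 + B) \<ge> 0" using A B C1 C2 Q by auto
    ultimately show ?case by blast
  qed
  then obtain C where "\<And>\<delta> s. \<bar>\<delta>\<bar> \<le> 1 \<and> s \<in> {0..1} \<Longrightarrow> \<bar>L \<delta> m \<phi> s - T m \<phi> s\<bar> \<le> C * \<bar>\<delta>\<bar>" by meson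
  then show thesis by (intro that[of C]) (simp add: T_def)
qed

section \<open>Steering controls\<close>

text \<open>The abstract form of the expansion of an iterated commutator: \<open>A n i j\<close>
  stands for \<open>i\<close> copies of \<open>X\<close>, the \<open>n\<close>-fold bracket, then
  \<open>j\<close> copies of \<open>X\<close>. The induction step is Pascal's rule.\<close>

lemma alternating_recurrence_binomial:
  fixes A :: "nat \<Rightarrow> nat \<Rightarrow> nat \<Rightarrow> real"
  assumes rec: "\<And>n i j. A (Suc n) i j = A n i (Suc j) - A n (Suc i) j"
  shows "A n i j = (\<Sum>k\<le>n. (-1) ^ (n + k) * real (n choose k) * A 0 (i + (n - k)) (j + k))"
proof (induction n arbitrary: i j)
  case (Suc n)
  define a where "a k = A 0 (i + (Suc n - k)) (j + k)" for k
  have "A n i (Suc j) = (\<Sum>k\<le>n. (-1) ^ (n + k) * real (n choose k) * a (Suc k))"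
    unfolding Suc a_def by (intro sum.cong) auto
  moreover have "A n (Suc i) j = (\<Sum>k\<le>Suc n. (-1) ^ (n + k) * real (n choose k) * a k)"
    unfolding Suc a_def by (auto intro!: sum.cong simp: Suc_diff_le binomial_eq_0)
  moreover have "(\<Sum>k\<le>Suc n. (-1) ^ (n + k) * real (n choose k) * a k) =
      (-1) ^ n * a 0 - (\<Sum>k\<le>n. (-1) ^ (n + k) * real (n choose Suc k) * a (Suc k))"
    by (subst sum.atMost_Suc_shift) (simp add: sum_negf)
  moreover have "(\<Sum>k\<le>Suc n. (-1) ^ (Suc n + k) * real (Suc n choose k) * a k) =
      - ((-1) ^ n * a 0) + (\<Sum>k\<le>n. (-1) ^ (n + k) * real (n choose k) * a (Suc k))
      + (\<Sum>k\<le>n. (-1) ^ (n + k) * real (n choose Suc k) * a (Suc k))"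
    by (subst sum.atMost_Suc_shift) (simp add: sum.distrib algebra_simps)
  ultimately show ?case by (simp add: rec a_def)
qed simp

lemma smooth_funpow_lie_deriv: "smooth X \<Longrightarrow> smooth \<phi> \<Longrightarrow> smooth ((lie_deriv X ^^ k) \<phi>)"
  by (induction k) (auto intro: smooth_lie_deriv)

lemma smooth_funpow_lie_bracket: "smooth X \<Longrightarrow> smooth Y \<Longrightarrow> smooth (((\<lambda>Z. lie_bracket Z X) ^^ k) Y)"
  by (induction k) (auto intro: smooth_lie_bracket)

lemma funpow_lie_deriv_diff:
  assumes "smooth X" "smooth \<phi>" "smooth \<psi>"
  shows "(lie_deriv X ^^ k) (\<lambda>x. \<phi> x - \<psi> x) = (\<lambda>x. (lie_deriv X ^^ k) \<phi> x - (lie_deriv X ^^ k) \<psi> x)"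
  by (induction k) (auto simp: lie_deriv_diff assms smooth_funpow_lie_deriv)

lemma lie_deriv_iterated_bracket:
  fixes \<phi> :: "'a::euclidean_space \<Rightarrow> real"
  assumes "smooth X" "smooth Y" "smooth \<phi>"
  shows "lie_deriv (((\<lambda>Z. lie_bracket Z X) ^^ n) Y) \<phi> x =
    (\<Sum>k\<le>n. (-1) ^ (n + k) * real (n choose k) * (lie_deriv X ^^ (n - k)) (lie_deriv Y ((lie_deriv X ^^ k) \<phi>)) x)"
proof -
  let ?B = "\<lambda>n. ((\<lambda>Z. lie_bracket Z X) ^^ n) Y"
  \<comment> \<open>Powers of \<open>X\<close> on both sides of the bracket make the recurrence
    closed; the claim is the entry \<open>i = j = 0\<close>.\<close>
  define A where "A n i j = (lie_deriv X ^^ i) (lie_deriv (?B n) ((lie_deriv X ^^ j) \<phi>)) x" for n i j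
  have "A (Suc n) i j = A n i (Suc j) - A n (Suc i) j" for n i j
  proof -
    let ?\<psi> = "(lie_deriv X ^^ j) \<phi>"
    have s: "smooth ?\<psi>" "smooth (?B n)"
      using assms by (auto intro: smooth_funpow_lie_deriv smooth_funpow_lie_bracket)
    have "lie_deriv (?B (Suc n)) ?\<psi> = (\<lambda>x. lie_deriv (?B n) (lie_deriv X ?\<psi>) x - lie_deriv X (lie_deriv (?B n) ?\<psi>) x)"
      using lie_deriv_lie_bracket[OF s(2) assms(1) s(1)] by (auto simp: fun_eq_iff)
    then have "A (Suc n) i j = (lie_deriv X ^^ i) (lie_deriv (?B n) (lie_deriv X ?\<psi>)) x
        - (lie_deriv X ^^ i) (lie_deriv X (lie_deriv (?B n) ?\<psi>)) x"
      unfolding A_def using s assms(1) by (simp add: funpow_lie_deriv_diff smooth_lie_deriv)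
    then show ?thesis by (simp add: A_def funpow_swap1)
  qed
  from alternating_recurrence_binomial[of A n 0 0, OF this] show ?thesis by (simp add: A_def)
qed

lemma integral_pos_continuous:
  fixes h :: "real \<Rightarrow> real"
  assumes "continuous_on {0..1} h" "\<And>s. s \<in> {0..1} \<Longrightarrow> 0 \<le> h s" "s0 \<in> {0..1}" "h s0 \<noteq> 0"
  shows "0 < integral {0..1} h"
proof -
  have "0 \<le> integral {0..1} h"
    using assms by (intro integral_nonneg integrable_continuous_real) auto
  moreover have "integral {0..1} h \<noteq> 0"
    using integral_eq_0_iff[of 0 1 h] assms by auto
  ultimately show ?thesis by simp
qed

text \<open>\<open>A\<close> is the value at order zero in \<open>\<delta>\<close>, \<open>I\<close>
  the first variation and \<open>M\<close> bounds the remainder. A negative \<open>A\<close> absorbs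
  the rest for small \<open>\<delta>\<close>; if \<open>A = 0\<close>, the first variation beats the
  quadratic remainder.\<close>

lemma exists_small_negative:
  fixes A I M :: real
  assumes "A < 0 \<or> (A = 0 \<and> I < 0)" "0 \<le> M"
  obtains \<delta> where "0 < \<delta>" "\<delta> \<le> 1" "A + \<delta> * I + M * \<delta>\<^sup>2 < 0"
proof (cases "A < 0")
  case True
  define \<delta> where "\<delta> = min 1 (- A / (\<bar>I\<bar> + M + 1))"
  have d: "0 < \<delta>" "\<delta> \<le> 1" using True assms(2) by (auto simp: \<delta>_def intro!: divide_neg_pos)
  have "\<delta> * (\<bar>I\<bar> + M) < \<delta> * (\<bar>I\<bar> + M + 1)" using d by simp
  also have "\<dots> \<le> - A / (\<bar>I\<bar> + M + 1) * (\<bar>I\<bar> + M + 1)"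
    by (intro mult_right_mono) (use assms(2) in \<open>auto simp: \<delta>_def\<close>)
  also have "\<dots> = - A" using assms(2) by (simp add: add_nonneg_eq_0_iff)
  finally have "\<delta> * (\<bar>I\<bar> + M) < - A" .
  moreover have "\<delta> * I \<le> \<delta> * \<bar>I\<bar>" using d by simp
  moreover have "M * \<delta>\<^sup>2 \<le> \<delta> * M" using d assms(2) by (simp add: power2_eq_square mult_left_le mult_left_mono mult.commute)
  ultimately have "A + \<delta> * I + M * \<delta>\<^sup>2 < 0" by (simp add: algebra_simps)
  then show ?thesis using that d by blast
next
  case False
  then have A: "A = 0" "I < 0" using assms by auto
  define \<delta> where "\<delta> = min 1 (- I / (M + 1))"
  have d: "0 < \<delta>" "\<delta> \<le> 1" using A assms(2) by (auto simp: \<delta>_def intro!: divide_neg_pos)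
  have "M * \<delta> < (M + 1) * \<delta>" using d by simp
  also have "\<dots> \<le> (M + 1) * (- I / (M + 1))"
    by (intro mult_left_mono) (use assms(2) in \<open>auto simp: \<delta>_def\<close>)
  also have "\<dots> = - I" using assms(2) by (simp add: add_nonneg_eq_0_iff)
  finally have "\<delta> * (I + M * \<delta>) < 0" using d by (simp add: mult_pos_neg)
  then have "A + \<delta> * I + M * \<delta>\<^sup>2 < 0" by (simp add: A power2_eq_square algebra_simps)
  then show ?thesis using that d by blast
qed

text \<open>The conjugation formula is exact, but its integrand still contains perturbed iterated
  integrals. Replacing them by their values at \<open>\<delta> = 0\<close> gives the kernel
  \<open>K\<close> and costs another factor \<open>\<delta>\<close>, so the leading term is
  \<open>A\<close> plus \<open>\<delta>\<close> times the integral of \<open>q * K\<close>, up to a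
  quadratic remainder.\<close>

lemma leading_term_negative:
  fixes X Y a q x \<phi> and N :: nat and W :: "real \<Rightarrow> real"
  defines "K \<equiv> \<lambda>s. \<Sum>k\<le>N. (W 1 - W s) ^ k / fact k *
      (W s ^ (N - k) / fact (N - k) * (lie_deriv X ^^ (N - k)) (lie_deriv Y ((lie_deriv X ^^ k) \<phi>)) x)"
  defines "A \<equiv> W 1 ^ Suc N / fact (Suc N) * (lie_deriv X ^^ Suc N) \<phi> x"
  assumes a: "continuous_on {0..1} a" and q: "continuous_on {0..1} q"
    and W: "\<And>t. t \<in> {0..1} \<Longrightarrow> (W has_real_derivative a t) (at t within {0..1})" and W0: "W 0 = 0"
    and neg: "A < 0 \<or> (A = 0 \<and> integral {0..1} (\<lambda>s. q s * K s) < 0)"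
  obtains \<delta> where "0 < \<delta>" "\<delta> \<le> 1" "leading_term X Y a (\<lambda>s. \<delta> * q s) x (Suc N) \<phi> 1 < 0"
proof -
  define L where "L \<delta> = leading_term X Y a (\<lambda>s. \<delta> * q s) x" for \<delta>
  define \<psi> where "\<psi> k = lie_deriv Y ((lie_deriv X ^^ k) \<phi>)" for k
  define T where "T k s = W s ^ (N - k) / fact (N - k) * (lie_deriv X ^^ (N - k)) (\<psi> k) x" for k s
  have cW: "continuous_on {0..1} W" using W DERIV_continuous_on by blast
  have "\<exists>C. \<forall>\<delta> s. \<bar>\<delta>\<bar> \<le> 1 \<and> s \<in> {0..1} \<longrightarrow> \<bar>L \<delta> (N - k) (\<psi> k) s - T k s\<bar> \<le> C * \<bar>\<delta>\<bar>" for k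
    using leading_term_perturb[OF a q W W0, of X Y x "N - k" "\<psi> k"] unfolding L_def T_def by meson
  then obtain C where C: "\<And>k \<delta> s. \<bar>\<delta>\<bar> \<le> 1 \<Longrightarrow> s \<in> {0..1} \<Longrightarrow> \<bar>L \<delta> (N - k) (\<psi> k) s - T k s\<bar> \<le> C k * \<bar>\<delta>\<bar>"
    by metis
  obtain Q where Q: "Q \<ge> 0" "\<And>s. s \<in> {0..1} \<Longrightarrow> \<bar>q s\<bar> \<le> Q" using continuous_on_interval_bdd[OF q] by blast
  have "\<forall>k. \<exists>B\<ge>0. \<forall>s\<in>{0..1}. \<bar>(W 1 - W s) ^ k / fact k\<bar> \<le> B"
  proof
    fix k :: nat
    have "continuous_on {0..1} (\<lambda>s. (W 1 - W s) ^ k / fact k)" by (intro continuous_intros cW) auto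
    then show "\<exists>B\<ge>0. \<forall>s\<in>{0..1}. \<bar>(W 1 - W s) ^ k / fact k\<bar> \<le> B"
      by (rule continuous_on_interval_bdd)
  qed
  from choice[OF this] obtain B where
    B': "\<forall>k. 0 \<le> B k \<and> (\<forall>s\<in>{0..1}. \<bar>(W 1 - W s) ^ k / fact k\<bar> \<le> B k)" ..
  note B = B'[THEN spec, THEN conjunct1] B'[THEN spec, THEN conjunct2, THEN bspec]
  define M where "M = Q * (\<Sum>k\<le>N. B k * \<bar>C k\<bar>)"
  have M: "0 \<le> M" unfolding M_def using Q B by (intro mult_nonneg_nonneg sum_nonneg) auto
  obtain \<delta> where d: "0 < \<delta>" "\<delta> \<le> 1" "A + \<delta> * integral {0..1} (\<lambda>s. q s * K s) + M * \<delta>\<^sup>2 < 0"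
    using exists_small_negative[OF neg M] .
  define G where "G s = (\<Sum>k\<le>N. (W 1 - W s) ^ k / fact k * L \<delta> (N - k) (\<psi> k) s)" for s
  have K: "K s = (\<Sum>k\<le>N. (W 1 - W s) ^ k / fact k * T k s)" for s by (simp add: K_def T_def \<psi>_def)
  have cK: "continuous_on {0..1} K" unfolding K_def by (intro continuous_intros cW) auto
  have cG: "continuous_on {0..1} G" unfolding G_def L_def
    by (intro continuous_intros cW continuous_on_leading_term a q) auto
  have GK: "\<bar>G s - K s\<bar> \<le> (\<Sum>k\<le>N. B k * \<bar>C k\<bar>) * \<delta>" if s: "s \<in> {0..1}" for s
  proof -
    have "G s - K s = (\<Sum>k\<le>N. (W 1 - W s) ^ k / fact k * (L \<delta> (N - k) (\<psi> k) s - T k s))"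
      unfolding G_def K by (simp add: sum_subtractf right_diff_distrib)
    also have "\<bar>\<dots>\<bar> \<le> (\<Sum>k\<le>N. B k * (\<bar>C k\<bar> * \<delta>))"
    proof (rule order_trans[OF sum_abs sum_mono])
      fix k
      have "\<bar>L \<delta> (N - k) (\<psi> k) s - T k s\<bar> \<le> C k * \<delta>" using C[of \<delta> s k] d s by simp
      also have "\<dots> \<le> \<bar>C k\<bar> * \<delta>" using d by (intro mult_right_mono) auto
      finally show "\<bar>(W 1 - W s) ^ k / fact k * (L \<delta> (N - k) (\<psi> k) s - T k s)\<bar> \<le> B k * (\<bar>C k\<bar> * \<delta>)"
        unfolding abs_mult using B[of k] B(2)[OF s, of k] by (intro mult_mono) auto
    qed
    finally show ?thesis by (simp add: sum_distrib_right mult.assoc)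
  qed
  have "L \<delta> (Suc N) \<phi> 1 = A + integral {0..1} (\<lambda>s. \<delta> * q s * G s)"
    unfolding L_def A_def G_def \<psi>_def
    by (rule leading_term_conjugate[OF a _ W W0]) (intro continuous_intros q)
  also have "integral {0..1} (\<lambda>s. \<delta> * q s * G s) =
      \<delta> * integral {0..1} (\<lambda>s. q s * K s) + \<delta> * integral {0..1} (\<lambda>s. q s * (G s - K s))"
  proof -
    have "integral {0..1} (\<lambda>s. q s * (G s - K s)) = integral {0..1} (\<lambda>s. q s * G s) - integral {0..1} (\<lambda>s. q s * K s)"
      unfolding right_diff_distrib by (intro integral_diff integrable_continuous_real continuous_intros q cG cK)
    then show ?thesis
      by (simp add: mult.assoc distrib_left[symmetric])
  qed
  also have "integral {0..1} (\<lambda>s. q s * (G s - K s)) \<le> M * \<delta>"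
  proof -
    have "norm (integral {0..1} (\<lambda>s. q s * (G s - K s))) \<le> M * \<delta> * (1 - 0)"
    proof (rule integral_bound)
      fix s :: real assume s: "s \<in> {0..1}"
      have "\<bar>q s\<bar> * \<bar>G s - K s\<bar> \<le> Q * ((\<Sum>k\<le>N. B k * \<bar>C k\<bar>) * \<delta>)"
        using Q(2)[OF s] GK[OF s] Q(1) by (intro mult_mono) auto
      then show "norm (q s * (G s - K s)) \<le> M * \<delta>" by (simp add: M_def abs_mult mult.assoc)
    qed (auto intro!: continuous_intros q cG cK)
    then show ?thesis by simp
  qed
  finally have "L \<delta> (Suc N) \<phi> 1 \<le> A + (\<delta> * integral {0..1} (\<lambda>s. q s * K s) + \<delta> * (M * \<delta>))"
    using d by simp
  then have "L \<delta> (Suc N) \<phi> 1 < 0" using d(3) by (simp add: power2_eq_square algebra_simps)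
  then show thesis using that d by (simp add: L_def)
qed

text \<open>The coefficient of the drift is fixed at 1 because only the control can be chosen;
  \<open>v\<close> lives on the unit interval, to be rescaled to a short time later. The sign at
  time 1 is that of the lowest-order change of \<open>\<phi>\<close> when the shorter words vanish
  at \<open>x\<close>.\<close>

definition steering_control ::
  "('a::euclidean_space \<Rightarrow> 'a) \<Rightarrow> ('a \<Rightarrow> 'a) \<Rightarrow> 'a \<Rightarrow> nat \<Rightarrow> ('a \<Rightarrow> real) \<Rightarrow> (real \<Rightarrow> real) \<Rightarrow> bool" where
  "steering_control f g x m \<phi> v \<longleftrightarrow>
    continuous_on {0..1} v \<and> leading_term f g (\<lambda>_. 1) v x m \<phi> 1 < 0"

text \<open>Under zero control only the word in \<open>f\<close> alone survives, with the weight
  \<open>1 / fact (Suc N)\<close>.\<close>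

lemma steering_control_drift:
  fixes f g :: "'a::euclidean_space \<Rightarrow> 'a"
  assumes "(lie_deriv f ^^ Suc N) \<phi> x < 0"
  shows "\<exists>v. steering_control f g x (Suc N) \<phi> v"
proof -
  obtain \<delta> where "0 < \<delta>" "leading_term f g (\<lambda>_. 1) (\<lambda>s. \<delta> * 0) x (Suc N) \<phi> 1 < 0"
    by (rule leading_term_negative[of "\<lambda>_. 1" "\<lambda>_. 0" "\<lambda>s. s" N f \<phi> x g])
      (use assms in \<open>auto intro!: derivative_eq_intros divide_neg_pos\<close>)
  then show ?thesis unfolding steering_control_def by (intro exI[of _ "\<lambda>s. \<delta> * 0"]) auto
qed

text \<open>Here \<open>g\<close> has the coefficient \<open>w\<close> and the drift the small
  coefficient \<open>\<delta>\<close>. By homogeneity, dividing both by \<open>\<delta>\<close>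
  restores the drift and produces the large control \<open>w / \<delta>\<close>.\<close>

lemma steering_control_fast:
  fixes f g :: "'a::euclidean_space \<Rightarrow> 'a"
  assumes "continuous_on {0..1} w" "0 < \<delta>" "leading_term g f w (\<lambda>_. \<delta>) x m \<phi> 1 < 0"
  shows "\<exists>v. steering_control f g x m \<phi> v"
proof -
  have "leading_term f g (\<lambda>s. \<delta> * 1) (\<lambda>s. \<delta> * (w s / \<delta>)) x m \<phi> 1 < 0"
    using assms by (subst leading_term_swap) simp
  then have "\<delta> ^ m * leading_term f g (\<lambda>s. 1) (\<lambda>s. w s / \<delta>) x m \<phi> 1 < 0"
    by (simp only: leading_term_scale)
  then have "leading_term f g (\<lambda>s. 1) (\<lambda>s. w s / \<delta>) x m \<phi> 1 < 0"
    using assms(2) by (simp add: mult_less_0_iff)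
  moreover have "continuous_on {0..1} (\<lambda>s. w s / \<delta>)" using assms by (intro continuous_intros) auto
  ultimately show ?thesis unfolding steering_control_def by blast
qed

text \<open>A constant control of the sign opposite to \<open>lie_deriv g \<phi> x\<close>, scaled
  up until it outweighs the drift.\<close>

lemma steering_control_input:
  fixes f g :: "'a::euclidean_space \<Rightarrow> 'a"
  assumes "lie_deriv g \<phi> x \<noteq> 0"
  shows "\<exists>v. steering_control f g x (Suc 0) \<phi> v"
proof -
  define \<sigma> where "\<sigma> = - lie_deriv g \<phi> x"
  have "\<sigma> * lie_deriv g \<phi> x < 0" using assms not_real_square_gt_zero[of "lie_deriv g \<phi> x"] by (simp add: \<sigma>_def del: not_real_square_gt_zero)
  then obtain \<delta> where "0 < \<delta>" "leading_term g f (\<lambda>_. \<sigma>) (\<lambda>s. \<delta> * 1) x (Suc 0) \<phi> 1 < 0"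
    by (rule_tac leading_term_negative[of "\<lambda>_. \<sigma>" "\<lambda>_. 1" "\<lambda>s. \<sigma> * s" 0 g \<phi> x f])
      (auto intro!: derivative_eq_intros)
  then show ?thesis using steering_control_fast[of "\<lambda>_. \<sigma>" \<delta> g f x "Suc 0" \<phi>] by simp
qed

text \<open>A control whose primitive vanishes at both ends suppresses the term in \<open>g\<close> alone; the next one
  carries the iterated bracket of \<open>f\<close> with \<open>g\<close>.\<close>

lemma steering_control_bracket_fg:
  fixes f g :: "'a::euclidean_space \<Rightarrow> 'a" and \<phi> :: "'a \<Rightarrow> real"
  defines "\<beta> \<equiv> \<lambda>N x. lie_deriv (((\<lambda>X. lie_bracket X g) ^^ N) f) \<phi> x"
  assumes smooth: "smooth f" "smooth g" "smooth \<phi>" and "N \<ge> 1"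
    and "(odd N \<and> \<beta> N x \<noteq> 0) \<or> (even N \<and> \<beta> N x < 0)"
  shows "\<exists>v. steering_control f g x (Suc N) \<phi> v"
proof -
  \<comment> \<open>The common coefficient in the kernel: with \<open>W 1 = 0\<close> the product
    \<open>(W 1 - W s) ^ k * W s ^ (N - k)\<close> is \<open>(-1) ^ k * W s ^ N\<close>, so the
    words with one \<open>f\<close> combine to the iterated bracket, up to sign and a
    factorial.\<close>
  define \<kappa> where "\<kappa> = (\<Sum>k\<le>N. (-1) ^ k / (fact k * fact (N - k)) *
    (lie_deriv g ^^ (N - k)) (lie_deriv f ((lie_deriv g ^^ k) \<phi>)) x)"
  have \<kappa>: "\<kappa> = (-1) ^ N * \<beta> N x / fact N"
  proof -
    have "(-1) ^ k / (fact k * fact (N - k)) = (-1) ^ N * ((-1) ^ (N + k) * real (N choose k)) / fact N" if "k \<le> N" for k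
      using that by (simp add: binomial_fact power_add flip: power_mult_distrib)
    then show ?thesis
      unfolding \<beta>_def \<kappa>_def lie_deriv_iterated_bracket[OF smooth(2,1,3)]
      by (simp add: sum_distrib_left sum_divide_distrib mult_ac cong: sum.cong_simp)
  qed
  \<comment> \<open>For odd \<open>N\<close> the sign of the control can be adapted to the bracket.
    For even \<open>N\<close> the power \<open>\<sigma> ^ N\<close> cannot be negative, which is why
    the bracket itself has to be.\<close>
  define \<sigma> :: real where "\<sigma> = (if even N then 1 else sgn (\<beta> N x))"
  have \<sigma>: "\<sigma> ^ N * \<kappa> < 0"
  proof (cases "even N")
    case True
    then show ?thesis using assms(6) by (simp add: \<sigma>_def \<kappa> divide_neg_pos)
  next
    case False
    then have "\<beta> N x \<noteq> 0" using assms(6) by blast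
    then have "\<sigma> ^ N = \<sigma>" "\<sigma> * \<beta> N x > 0"
      using False by (auto simp: \<sigma>_def sgn_if)
    then show ?thesis using False by (simp add: \<kappa>)
  qed
  define W where "W s = \<sigma> * (s * (1 - s))" for s :: real
  define w where "w s = \<sigma> * (1 - 2 * s)" for s :: real
  define K where "K s = (\<Sum>k\<le>N. (W 1 - W s) ^ k / fact k *
      (W s ^ (N - k) / fact (N - k) * (lie_deriv g ^^ (N - k)) (lie_deriv f ((lie_deriv g ^^ k) \<phi>)) x))" for s
  have K: "K s = \<sigma> ^ N * \<kappa> * (s * (1 - s)) ^ N" for s
  proof -
    have "(W 1 - W s) ^ k / fact k * (W s ^ (N - k) / fact (N - k) * E) =
        W s ^ N * ((-1) ^ k / (fact k * fact (N - k)) * E)" if "k \<le> N" for k E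
    proof -
      have "W s ^ N = W s ^ k * W s ^ (N - k)" using that by (simp flip: power_add)
      moreover have "(W 1 - W s) ^ k = (-1) ^ k * W s ^ k" by (simp add: W_def flip: power_mult_distrib)
      ultimately show ?thesis by simp
    qed
    then have "K s = W s ^ N * \<kappa>" unfolding K_def \<kappa>_def sum_distrib_left by (intro sum.cong) auto
    then show ?thesis by (simp add: W_def power_mult_distrib)
  qed
  have "0 < integral {0..1} (\<lambda>s::real. (s * (1 - s)) ^ N)"
    by (rule integral_pos_continuous[where ?s0.0 = "1/2"]) (auto intro!: continuous_intros)
  then have neg: "integral {0..1} (\<lambda>s. 1 * K s) < 0"
    using \<sigma> by (simp add: K mult_neg_pos)
  have w: "continuous_on {0..1} w" unfolding w_def by (intro continuous_intros)
  obtain \<delta> where "0 < \<delta>" "leading_term g f w (\<lambda>s. \<delta> * 1) x (Suc N) \<phi> 1 < 0"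
  proof (rule leading_term_negative[of w "\<lambda>_. 1" W N g \<phi> x f])
    show "(W has_real_derivative w t) (at t within {0..1})" for t
      unfolding W_def w_def by (auto intro!: derivative_eq_intros simp: algebra_simps)
    show "W 1 ^ Suc N / fact (Suc N) * (lie_deriv g ^^ Suc N) \<phi> x < 0 \<or>
      W 1 ^ Suc N / fact (Suc N) * (lie_deriv g ^^ Suc N) \<phi> x = 0 \<and>
      integral {0..1} (\<lambda>s. 1 * (\<Sum>k\<le>N. (W 1 - W s) ^ k / fact k *
        (W s ^ (N - k) / fact (N - k) * (lie_deriv g ^^ (N - k)) (lie_deriv f ((lie_deriv g ^^ k) \<phi>)) x))) < 0"
      using neg unfolding K_def by (auto simp: W_def)
  qed (use w in \<open>auto simp: W_def\<close>)
  then show ?thesis using steering_control_fast[OF w, of \<delta> g f x "Suc N" \<phi>] by simp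
qed

text \<open>Dividing by \<open>s ^ N\<close> and substituting \<open>r = (1 - s) / s\<close> turns
  the Bernstein form into a polynomial in \<open>r\<close> that vanishes for all
  \<open>r > 0\<close>, hence has zero coefficients.\<close>

lemma bernstein_sum_eq_0:
  fixes c :: "nat \<Rightarrow> real"
  assumes "\<And>s. s \<in> {0..1} \<Longrightarrow> (\<Sum>k\<le>N. (1 - s) ^ k / fact k * (s ^ (N - k) / fact (N - k) * c k)) = 0" "k \<le> N"
  shows "c k = 0"
proof -
  define d where "d k = c k / (fact k * fact (N - k))" for k
  have "(\<Sum>k\<le>N. d k * r ^ k) = 0" if "r > 0" for r
  proof -
    define s where "s = 1 / (1 + r)"
    have s: "s \<in> {0..1}" "1 - s = r * s" "s \<noteq> 0" using that by (auto simp: s_def field_simps)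
    have "s ^ N * (\<Sum>k\<le>N. d k * r ^ k) = (\<Sum>k\<le>N. (1 - s) ^ k / fact k * (s ^ (N - k) / fact (N - k) * c k))"
      unfolding sum_distrib_left
    proof (rule sum.cong)
      fix k assume "k \<in> {..N}"
      then have "s ^ N = s ^ k * s ^ (N - k)" by (simp flip: power_add)
      then show "s ^ N * (d k * r ^ k) = (1 - s) ^ k / fact k * (s ^ (N - k) / fact (N - k) * c k)"
        by (simp add: s(2) d_def power_mult_distrib)
    qed simp
    then show ?thesis using assms(1)[OF s(1)] s(3) by simp
  qed
  then have "{0<..} \<subseteq> {r. (\<Sum>k\<le>N. d k * r ^ k) = 0}" by auto
  then have "infinite {r. (\<Sum>k\<le>N. d k * r ^ k) = 0}"
    using infinite_Ioi infinite_super by blast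
  then have "d k = 0" using polyfun_finite_roots[of d N] assms(2) by blast
  then show ?thesis by (simp add: d_def)
qed

text \<open>With the drift as main field, so that \<open>W s = s\<close>, the term in
  \<open>f\<close> alone vanishes and the kernel \<open>K\<close> is in Bernstein form. It is not
  identically zero, because the iterated bracket is a linear combination of its coefficients; the
  choice \<open>q = - K\<close> makes the first variation minus the integral of \<open>K\<close>
  squared.\<close>

lemma steering_control_bracket_gf:
  fixes f g :: "'a::euclidean_space \<Rightarrow> 'a" and \<phi> :: "'a \<Rightarrow> real"
  assumes smooth: "smooth f" "smooth g" "smooth \<phi>"
    and f0: "(lie_deriv f ^^ Suc N) \<phi> x = 0"
    and "lie_deriv (((\<lambda>X. lie_bracket X f) ^^ N) g) \<phi> x \<noteq> 0"
  shows "\<exists>v. steering_control f g x (Suc N) \<phi> v"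
proof -
  define c where "c k = (lie_deriv f ^^ (N - k)) (lie_deriv g ((lie_deriv f ^^ k) \<phi>)) x" for k
  define K where "K s = (\<Sum>k\<le>N. (1 - s) ^ k / fact k * (s ^ (N - k) / fact (N - k) * c k))" for s :: real
  have cK: "continuous_on {0..1} K" unfolding K_def by (intro continuous_intros) auto
  have "\<exists>s0\<in>{0..1}. K s0 \<noteq> 0"
  proof (rule ccontr)
    assume "\<not> ?thesis"
    then have "c k = 0" if "k \<le> N" for k using bernstein_sum_eq_0[where N = N and c = c and k = k] that by (auto simp: K_def)
    then show False using assms(5) unfolding lie_deriv_iterated_bracket[OF smooth]
      by (simp add: c_def)
  qed
  then obtain s0 where "s0 \<in> {0..1}" "K s0 \<noteq> 0" by blast
  then have "0 < integral {0..1} (\<lambda>s. (K s)\<^sup>2)"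
    by (intro integral_pos_continuous[where ?s0.0 = s0] continuous_intros cK) auto
  then have neg: "integral {0..1} (\<lambda>s. - K s * K s) < 0" by (simp add: power2_eq_square)
  obtain \<delta> where "0 < \<delta>" "leading_term f g (\<lambda>_. 1) (\<lambda>s. \<delta> * - K s) x (Suc N) \<phi> 1 < 0"
  proof (rule leading_term_negative[of "\<lambda>_. 1" "\<lambda>s. - K s" "\<lambda>s. s" N f \<phi> x g])
    show "(1::real) ^ Suc N / fact (Suc N) * (lie_deriv f ^^ Suc N) \<phi> x < 0 \<or>
      (1::real) ^ Suc N / fact (Suc N) * (lie_deriv f ^^ Suc N) \<phi> x = 0 \<and>
      integral {0..1} (\<lambda>s. - K s * (\<Sum>k\<le>N. (1 - s) ^ k / fact k *
        (s ^ (N - k) / fact (N - k) * (lie_deriv f ^^ (N - k)) (lie_deriv g ((lie_deriv f ^^ k) \<phi>)) x))) < 0"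
      using neg f0 by (simp add: K_def c_def)
  qed (auto intro!: continuous_intros cK derivative_eq_intros)
  then show ?thesis unfolding steering_control_def
    by (intro exI[of _ "\<lambda>s. \<delta> * - K s"]) (auto intro!: continuous_intros cK)
qed

section \<open>Approximation by the leading term\<close>

text \<open>The empty word is included and the length bound is strict: level \<open>m\<close> covers
  the words of length less than \<open>m\<close>. The operator peeled off is the one acting first on
  \<open>\<phi>\<close>, in step with \<open>leading_term\<close>.\<close>

primrec words_vanish ::
  "('a::euclidean_space \<Rightarrow> 'a) \<Rightarrow> ('a \<Rightarrow> 'a) \<Rightarrow> 'a \<Rightarrow> nat \<Rightarrow> ('a \<Rightarrow> real) \<Rightarrow> bool" where
  "words_vanish X Y x 0 \<phi> \<longleftrightarrow> True"
| "words_vanish X Y x (Suc m) \<phi> \<longleftrightarrow>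
    \<phi> x = 0 \<and> words_vanish X Y x m (lie_deriv X \<phi>) \<and> words_vanish X Y x m (lie_deriv Y \<phi>)"

lemma smooth_along_curve:
  fixes f g :: "'a::euclidean_space \<Rightarrow> 'a" and \<phi> :: "'a \<Rightarrow> real"
  assumes "smooth \<phi>" "(y has_vector_derivative \<epsilon> *\<^sub>R (f (y t) + c *\<^sub>R g (y t))) (at t within S)"
  shows "((\<lambda>t. \<phi> (y t)) has_vector_derivative \<epsilon> * (lie_deriv f \<phi> (y t) + c * lie_deriv g \<phi> (y t))) (at t within S)"
proof -
  let ?D = "frechet_derivative \<phi> (at (y t))"
  have lin: "linear ?D" using linear_frechet_derivative[OF smooth_differentiable[OF assms(1)]] .
  have "(\<phi> \<circ> y has_vector_derivative ?D (\<epsilon> *\<^sub>R (f (y t) + c *\<^sub>R g (y t)))) (at t within S)"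
    by (rule vector_derivative_diff_chain_within[OF assms(2) has_derivative_at_withinI[OF smooth_has_derivative[OF assms(1)]]])
  then show ?thesis
    by (simp add: linear_cmul[OF lin] linear_add[OF lin] lie_deriv_def o_def)
qed

text \<open>Taylor expansion along a trajectory in rescaled time: the bounds for the derivatives
  along \<open>f\<close> and \<open>g\<close> are integrated, which gains a factor
  \<open>\<epsilon>\<close>, and the constant of integration \<open>\<phi> x\<close> is zero. The
  constant \<open>C\<close> is uniform in \<open>\<epsilon>\<close> and in all trajectories that
  stay in \<open>K\<close>.\<close>

lemma leading_term_approx:
  fixes f g :: "'a::euclidean_space \<Rightarrow> 'a" and \<phi> :: "'a \<Rightarrow> real"
  assumes f: "smooth f" and g: "smooth g" and v: "continuous_on {0..1} v" and K: "compact K"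
  shows "smooth \<phi> \<Longrightarrow> words_vanish f g x m \<phi> \<Longrightarrow>
    \<exists>C\<ge>0. \<forall>\<epsilon> y. 0 < \<epsilon> \<and> y 0 = x \<and> (\<forall>t\<in>{0..1}. y t \<in> K \<and>
        (y has_vector_derivative \<epsilon> *\<^sub>R (f (y t) + v t *\<^sub>R g (y t))) (at t within {0..1})) \<longrightarrow>
      (\<forall>t\<in>{0..1}. \<bar>\<phi> (y t) - \<epsilon> ^ m * leading_term f g (\<lambda>_. 1) v x m \<phi> t\<bar> \<le> C * \<epsilon> ^ Suc m)"
proof (induction m arbitrary: \<phi>)
  case 0
  obtain \<Lambda> where \<Lambda>: "\<Lambda> \<ge> 0" "\<And>s. s \<in> {0..1} \<Longrightarrow> \<bar>v s\<bar> \<le> \<Lambda>" using continuous_on_interval_bdd[OF v] by blast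
  have "\<exists>B. \<forall>z\<in>K. \<bar>lie_deriv X \<phi> z\<bar> \<le> B" if "smooth X" for X
    using compact_imp_bounded[OF compact_continuous_image[OF smooth_continuous[OF smooth_lie_deriv[OF that 0(1)]] K]]
    by (auto simp: bounded_iff)
  then obtain B1 B2 where B: "\<And>z. z \<in> K \<Longrightarrow> \<bar>lie_deriv f \<phi> z\<bar> \<le> B1" "\<And>z. z \<in> K \<Longrightarrow> \<bar>lie_deriv g \<phi> z\<bar> \<le> B2"
    using f g by meson
  show ?case
  proof (intro exI[of _ "\<bar>B1\<bar> + \<Lambda> * \<bar>B2\<bar>"] conjI allI impI ballI)
    show "0 \<le> \<bar>B1\<bar> + \<Lambda> * \<bar>B2\<bar>" using \<Lambda> by simp
    fix \<epsilon> y t assume A: "0 < \<epsilon> \<and> y 0 = x \<and> (\<forall>t\<in>{0..1}. y t \<in> K \<and>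
        (y has_vector_derivative \<epsilon> *\<^sub>R (f (y t) + v t *\<^sub>R g (y t))) (at t within {0..1}))" and t: "t \<in> {0..1::real}"
    have "((\<lambda>s. \<epsilon> * (lie_deriv f \<phi> (y s) + v s * lie_deriv g \<phi> (y s))) has_integral \<phi> (y t) - \<phi> (y 0)) {0..t}"
      using A t by (intro fundamental_theorem_of_calculus has_vector_derivative_within_subset[OF smooth_along_curve[OF 0(1)]]) auto
    then have "norm (\<phi> (y t) - \<phi> (y 0)) \<le> \<epsilon> * (\<bar>B1\<bar> + \<Lambda> * \<bar>B2\<bar>) * measure lborel {0..t}"
    proof (rule has_integral_bound_real[where S="{}", rotated 2])
      show "0 \<le> \<epsilon> * (\<bar>B1\<bar> + \<Lambda> * \<bar>B2\<bar>)" using A \<Lambda> by simp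
      fix s assume "s \<in> {0..t} - {}"
      then have s: "s \<in> {0..1}" using t by auto
      have "\<bar>v s * lie_deriv g \<phi> (y s)\<bar> \<le> \<Lambda> * \<bar>B2\<bar>"
        unfolding abs_mult using \<Lambda> s B(2)[of "y s"] A by (intro mult_mono) auto
      then have "\<bar>lie_deriv f \<phi> (y s) + v s * lie_deriv g \<phi> (y s)\<bar> \<le> \<bar>B1\<bar> + \<Lambda> * \<bar>B2\<bar>"
        using B(1)[of "y s"] A s by fastforce
      then show "norm (\<epsilon> * (lie_deriv f \<phi> (y s) + v s * lie_deriv g \<phi> (y s))) \<le> \<epsilon> * (\<bar>B1\<bar> + \<Lambda> * \<bar>B2\<bar>)"
        using A by (simp add: abs_mult)
    qed auto
    also have "\<dots> \<le> \<epsilon> * (\<bar>B1\<bar> + \<Lambda> * \<bar>B2\<bar>) * 1"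
      using A \<Lambda> t by (intro mult_left_mono) auto
    finally show "\<bar>\<phi> (y t) - \<epsilon> ^ 0 * leading_term f g (\<lambda>_. 1) v x 0 \<phi> t\<bar> \<le> (\<bar>B1\<bar> + \<Lambda> * \<bar>B2\<bar>) * \<epsilon> ^ Suc 0"
      using A by (simp add: mult.commute)
  qed
next
  case (Suc m)
  let ?L = "leading_term f g (\<lambda>_. 1) v x"
  obtain \<Lambda> where \<Lambda>: "\<Lambda> \<ge> 0" "\<And>s. s \<in> {0..1} \<Longrightarrow> \<bar>v s\<bar> \<le> \<Lambda>" using continuous_on_interval_bdd[OF v] by blast
  have sm: "smooth (lie_deriv f \<phi>)" "smooth (lie_deriv g \<phi>)" using f g Suc.prems smooth_lie_deriv by auto
  have wv: "words_vanish f g x m (lie_deriv f \<phi>)" "words_vanish f g x m (lie_deriv g \<phi>)" "\<phi> x = 0"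
    using Suc.prems by auto
  obtain C1 where C1: "C1 \<ge> 0" "\<And>\<epsilon> y t. 0 < \<epsilon> \<and> y 0 = x \<and> (\<forall>t\<in>{0..1}. y t \<in> K \<and>
        (y has_vector_derivative \<epsilon> *\<^sub>R (f (y t) + v t *\<^sub>R g (y t))) (at t within {0..1})) \<Longrightarrow> t \<in> {0..1} \<Longrightarrow>
        \<bar>lie_deriv f \<phi> (y t) - \<epsilon> ^ m * ?L m (lie_deriv f \<phi>) t\<bar> \<le> C1 * \<epsilon> ^ Suc m"
    using Suc.IH[OF sm(1) wv(1)] by blast
  obtain C2 where C2: "C2 \<ge> 0" "\<And>\<epsilon> y t. 0 < \<epsilon> \<and> y 0 = x \<and> (\<forall>t\<in>{0..1}. y t \<in> K \<and>
        (y has_vector_derivative \<epsilon> *\<^sub>R (f (y t) + v t *\<^sub>R g (y t))) (at t within {0..1})) \<Longrightarrow> t \<in> {0..1} \<Longrightarrow>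
        \<bar>lie_deriv g \<phi> (y t) - \<epsilon> ^ m * ?L m (lie_deriv g \<phi>) t\<bar> \<le> C2 * \<epsilon> ^ Suc m"
    using Suc.IH[OF sm(2) wv(2)] by blast
  show ?case
  proof (intro exI[of _ "C1 + \<Lambda> * C2"] conjI allI impI ballI)
    show "0 \<le> C1 + \<Lambda> * C2" using \<Lambda> C1 C2 by simp
    fix \<epsilon> y t assume A: "0 < \<epsilon> \<and> y 0 = x \<and> (\<forall>t\<in>{0..1}. y t \<in> K \<and>
        (y has_vector_derivative \<epsilon> *\<^sub>R (f (y t) + v t *\<^sub>R g (y t))) (at t within {0..1}))" and t: "t \<in> {0..1::real}"
    define e1 where "e1 s = lie_deriv f \<phi> (y s) - \<epsilon> ^ m * ?L m (lie_deriv f \<phi>) s" for s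
    define e2 where "e2 s = lie_deriv g \<phi> (y s) - \<epsilon> ^ m * ?L m (lie_deriv g \<phi>) s" for s
    have sub: "{0..t} \<subseteq> {0..1}" using t by auto
    have "((\<lambda>s. \<epsilon> * (lie_deriv f \<phi> (y s) + v s * lie_deriv g \<phi> (y s))) has_integral \<phi> (y t) - \<phi> (y 0)) {0..t}"
      using A t by (intro fundamental_theorem_of_calculus has_vector_derivative_within_subset[OF smooth_along_curve[OF Suc.prems(1)]]) auto
    moreover have "((\<lambda>s. \<epsilon> ^ Suc m * (1 * ?L m (lie_deriv f \<phi>) s + v s * ?L m (lie_deriv g \<phi>) s)) has_integral
        \<epsilon> ^ Suc m * ?L (Suc m) \<phi> t) {0..t}"
    proof (intro has_integral_mult_right)
      have "(\<lambda>s. 1 * ?L m (lie_deriv f \<phi>) s + v s * ?L m (lie_deriv g \<phi>) s) integrable_on {0..t}"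
        by (intro integrable_continuous_real continuous_on_subset[OF _ sub] continuous_intros v continuous_on_leading_term)
      then show "((\<lambda>s. 1 * ?L m (lie_deriv f \<phi>) s + v s * ?L m (lie_deriv g \<phi>) s) has_integral ?L (Suc m) \<phi> t) {0..t}"
        unfolding leading_term.simps by (rule integrable_integral)
    qed
    ultimately have "((\<lambda>s. \<epsilon> * (lie_deriv f \<phi> (y s) + v s * lie_deriv g \<phi> (y s)) -
        \<epsilon> ^ Suc m * (1 * ?L m (lie_deriv f \<phi>) s + v s * ?L m (lie_deriv g \<phi>) s)) has_integral
        (\<phi> (y t) - \<phi> (y 0)) - \<epsilon> ^ Suc m * ?L (Suc m) \<phi> t) {0..t}"
      by (rule has_integral_diff)
    moreover have "\<epsilon> * (lie_deriv f \<phi> (y s) + v s * lie_deriv g \<phi> (y s)) -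
        \<epsilon> ^ Suc m * (1 * ?L m (lie_deriv f \<phi>) s + v s * ?L m (lie_deriv g \<phi>) s) = \<epsilon> * (e1 s + v s * e2 s)" for s
      by (simp add: e1_def e2_def algebra_simps)
    ultimately have "((\<lambda>s. \<epsilon> * (e1 s + v s * e2 s)) has_integral \<phi> (y t) - \<epsilon> ^ Suc m * ?L (Suc m) \<phi> t) {0..t}"
      using A wv(3) by (simp only: diff_zero)
    then have "norm (\<phi> (y t) - \<epsilon> ^ Suc m * ?L (Suc m) \<phi> t) \<le> (C1 + \<Lambda> * C2) * \<epsilon> ^ Suc (Suc m) * measure lborel {0..t}"
    proof (rule has_integral_bound_real[where S="{}", rotated 2])
      show "0 \<le> (C1 + \<Lambda> * C2) * \<epsilon> ^ Suc (Suc m)" using A \<Lambda> C1 C2 by simp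
      fix s assume "s \<in> {0..t} - {}"
      then have s: "s \<in> {0..1}" using t by auto
      have e1: "\<bar>e1 s\<bar> \<le> C1 * \<epsilon> ^ Suc m" and e2: "\<bar>e2 s\<bar> \<le> C2 * \<epsilon> ^ Suc m"
        unfolding e1_def e2_def using C1(2)[OF A s] C2(2)[OF A s] by auto
      have "\<bar>v s\<bar> * \<bar>e2 s\<bar> \<le> \<Lambda> * (C2 * \<epsilon> ^ Suc m)" using \<Lambda> s e2 by (intro mult_mono) auto
      then have "\<bar>e1 s + v s * e2 s\<bar> \<le> C1 * \<epsilon> ^ Suc m + \<Lambda> * (C2 * \<epsilon> ^ Suc m)"
        using e1 abs_triangle_ineq[of "e1 s" "v s * e2 s"] unfolding abs_mult by linarith
      then have "\<epsilon> * \<bar>e1 s + v s * e2 s\<bar> \<le> \<epsilon> * (C1 * \<epsilon> ^ Suc m + \<Lambda> * (C2 * \<epsilon> ^ Suc m))"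
        using A by simp
      then show "norm (\<epsilon> * (e1 s + v s * e2 s)) \<le> (C1 + \<Lambda> * C2) * \<epsilon> ^ Suc (Suc m)"
      proof -
        have "norm (\<epsilon> * (e1 s + v s * e2 s)) = \<epsilon> * \<bar>e1 s + v s * e2 s\<bar>" using A by (simp add: abs_mult)
        moreover have "\<epsilon> * (C1 * \<epsilon> ^ Suc m + \<Lambda> * (C2 * \<epsilon> ^ Suc m)) = (C1 + \<Lambda> * C2) * \<epsilon> ^ Suc (Suc m)"
          by (simp add: algebra_simps)
        ultimately show ?thesis using \<open>\<epsilon> * \<bar>e1 s + v s * e2 s\<bar> \<le> _\<close> by linarith
      qed
    qed auto
    also have "\<dots> \<le> (C1 + \<Lambda> * C2) * \<epsilon> ^ Suc (Suc m) * 1"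
      using A \<Lambda> C1 C2 t by (intro mult_left_mono) auto
    finally show "\<bar>\<phi> (y t) - \<epsilon> ^ Suc m * ?L (Suc m) \<phi> t\<bar> \<le> (C1 + \<Lambda> * C2) * \<epsilon> ^ Suc (Suc m)" by simp
  qed
qed

section \<open>Gronwall's inequality, Lipschitz bounds and Picard iteration\<close>

lemma gronwall:
  fixes \<phi> :: "real \<Rightarrow> real"
  assumes cont: "continuous_on {a..b} \<phi>" and "0 \<le> L"
    and le: "\<And>t. t \<in> {a..b} \<Longrightarrow> \<phi> t \<le> c + L * integral {a..t} \<phi>" and t: "t \<in> {a..b}"
  shows "\<phi> t \<le> c * exp (L * (t - a))"
proof -
  define G where "G t = c + L * integral {a..t} \<phi>" for t
  define h where "h t = exp (- (L * (t - a))) * G t" for t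
  define h' where "h' t = exp (- (L * (t - a))) * (L * \<phi> t - L * G t)" for t
  have dh: "(h has_vector_derivative h' s) (at s within {a..b})" if s: "s \<in> {a..b}" for s
  proof -
    have "((\<lambda>t. exp (- (L * (t - a)))) has_real_derivative exp (- (L * (s - a))) * (- L)) (at s within {a..b})"
      by (auto intro!: derivative_eq_intros)
    moreover have "(G has_real_derivative L * \<phi> s) (at s within {a..b})"
      unfolding G_def by (intro DERIV_cong[OF DERIV_add[OF DERIV_const DERIV_cmult[OF integral_has_real_derivative[OF cont s]]]]) simp
    ultimately have "((\<lambda>t. exp (- (L * (t - a))) * G t) has_real_derivative
        exp (- (L * (s - a))) * (- L) * G s + L * \<phi> s * exp (- (L * (s - a)))) (at s within {a..b})"
      by (rule DERIV_mult)
    moreover have "exp (- (L * (s - a))) * (- L) * G s + L * \<phi> s * exp (- (L * (s - a))) = h' s"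
      by (simp add: h'_def algebra_simps)
    ultimately show ?thesis
      unfolding h_def[abs_def] has_real_derivative_iff_has_vector_derivative[symmetric] by simp
  qed
  have "(h' has_integral h t - h a) {a..t}"
  proof (rule fundamental_theorem_of_calculus)
    fix s assume "s \<in> {a..t}"
    then show "(h has_vector_derivative h' s) (at s within {a..t})"
      using t by (intro has_vector_derivative_within_subset[OF dh]) auto
  qed (use t in auto)
  moreover have "((\<lambda>_. 0) has_integral 0) {a..t}" by simp
  moreover have "h' s \<le> 0" if "s \<in> {a..t}" for s
    using le[of s] that t \<open>0 \<le> L\<close> unfolding h'_def G_def by (auto intro!: mult_nonneg_nonpos mult_left_mono)
  ultimately have "h t - h a \<le> 0" by (rule has_integral_le)
  then have "exp (- (L * (t - a))) * G t \<le> c" by (simp add: h_def G_def)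
  then have "exp (L * (t - a)) * (exp (- (L * (t - a))) * G t) \<le> exp (L * (t - a)) * c"
    by (rule mult_left_mono) simp
  then have "G t \<le> c * exp (L * (t - a))"
    by (simp only: mult.assoc[symmetric] exp_add[symmetric] right_minus exp_zero mult_1 mult.commute[of c])
  then show ?thesis using le[OF t] by (simp add: G_def)
qed

text \<open>Smoothness bounds the derivative on \<open>K\<close> in each basis direction; the sum
  over the basis bounds its operator norm, and convexity gives access to the mean value
  inequality.\<close>

lemma smooth_lipschitz_on_convex_compact:
  fixes h :: "'a::euclidean_space \<Rightarrow> 'b::euclidean_space"
  assumes h: "smooth h" and K: "compact K" "convex K"
  obtains L where "0 \<le> L" "\<And>y z. y \<in> K \<Longrightarrow> z \<in> K \<Longrightarrow> norm (h y - h z) \<le> L * norm (y - z)"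
proof -
  have "\<exists>B. \<forall>z\<in>K. norm (frechet_derivative h (at z) b) \<le> B" for b
    using compact_imp_bounded[OF compact_continuous_image[OF smooth_continuous[OF smooth_frechet_derivative[OF h]] K(1)]]
    by (auto simp: bounded_iff)
  then obtain B where B: "\<And>z b. z \<in> K \<Longrightarrow> norm (frechet_derivative h (at z) b) \<le> B b" by metis
  define L where "L = (\<Sum>b\<in>Basis. \<bar>B b\<bar>)"
  have "norm (frechet_derivative h (at z) w) \<le> L * norm w" if "z \<in> K" for z w
  proof -
    have "norm (frechet_derivative h (at z) w) \<le> (\<Sum>b\<in>Basis. norm ((w \<bullet> b) *\<^sub>R frechet_derivative h (at z) b))"
      by (subst frechet_derivative_eq_sum[OF h]) (rule norm_sum)
    also have "\<dots> \<le> (\<Sum>b\<in>Basis. norm w * \<bar>B b\<bar>)"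
    proof (rule sum_mono)
      fix b :: 'a assume "b \<in> Basis"
      then show "norm ((w \<bullet> b) *\<^sub>R frechet_derivative h (at z) b) \<le> norm w * \<bar>B b\<bar>"
        using B[OF that, of b] by (auto intro!: mult_mono Basis_le_norm)
    qed
    finally show ?thesis by (simp add: L_def sum_distrib_left mult.commute)
  qed
  then have "onorm (frechet_derivative h (at z)) \<le> L" if "z \<in> K" for z
    using that by (intro onorm_le) auto
  then have "norm (h y - h z) \<le> L * norm (y - z)" if "y \<in> K" "z \<in> K" for y z
    using that K by (intro differentiable_bound[of K h "\<lambda>z. frechet_derivative h (at z)"])
      (auto intro: has_derivative_at_withinI smooth_has_derivative[OF h])
  then show thesis by (intro that[of L]) (auto simp: L_def sum_nonneg)
qed

text \<open>Successive iterates differ by at most \<open>M * ((L * t) ^ n / fact n)\<close>, so they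
  converge uniformly on the whole unit interval. Continuity of \<open>G\<close> is asked along
  continuous curves, the form in which the integrands of the iteration use it.\<close>

lemma picard_global:
  fixes G :: "real \<Rightarrow> 'a::euclidean_space \<Rightarrow> 'a"
  assumes lip: "\<And>t y z. t \<in> {0..1} \<Longrightarrow> norm (G t y - G t z) \<le> L * norm (y - z)" and L: "0 \<le> L"
    and cont: "\<And>y. continuous_on {0..1} y \<Longrightarrow> continuous_on {0..1} (\<lambda>t. G t (y t))"
  obtains y where "y 0 = y0" "\<And>t. t \<in> {0..1} \<Longrightarrow> (y has_vector_derivative G t (y t)) (at t within {0..1})"
proof -
  define X where "X n = ((\<lambda>y t. y0 + integral {0..t} (\<lambda>s. G s (y s))) ^^ n) (\<lambda>_. y0)" for n
  have X0: "X 0 = (\<lambda>_. y0)" and XS: "X (Suc n) = (\<lambda>t. y0 + integral {0..t} (\<lambda>s. G s (X n s)))" for n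
    by (simp_all add: X_def)
  have int: "(\<lambda>s. G s (y s)) integrable_on {0..t}" if "t \<in> {0..1}" "continuous_on {0..1} y" for y t
    by (intro integrable_continuous_real continuous_on_subset[OF cont[OF that(2)]]) (use that in auto)
  have cX: "continuous_on {0..1} (X n)" for n
    by (induction n) (auto simp: X0 XS intro!: continuous_intros indefinite_integral_continuous_1 int)
  have "bounded ((\<lambda>t. G t y0) ` {0..1})"
    by (intro compact_imp_bounded compact_continuous_image cont continuous_intros) auto
  then obtain M where M: "\<And>t. t \<in> {0..1} \<Longrightarrow> norm (G t y0) \<le> M"
    unfolding bounded_iff by blast
  have M0: "0 \<le> M" by (rule order_trans[OF norm_ge_zero M[of 0]]) simp
  have step: "norm (X (Suc n) t - X n t) \<le> M * ((L * t) ^ n / fact n)" if "t \<in> {0..1}" for n t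
    using that
  proof (induction n arbitrary: t)
    case 0
    have "norm (integral {0..t} (\<lambda>s. G s y0)) \<le> M * (t - 0)"
      by (rule integral_bound) (use 0 M in \<open>auto intro!: continuous_on_subset[OF cont]\<close>)
    also have "\<dots> \<le> M" using M0 0 by (simp add: mult_left_le)
    finally show ?case by (simp add: X0 XS)
  next
    case (Suc n)
    have i: "((\<lambda>s. L * (M * ((L * s) ^ n / fact n))) has_integral M * ((L * t) ^ Suc n / fact (Suc n)) - M * ((L * 0) ^ Suc n / fact (Suc n))) {0..t}"
    proof (rule fundamental_theorem_of_calculus)
      fix s
      have "((\<lambda>s. L * s) has_real_derivative L) (at s within {0..t})" by (auto intro!: derivative_eq_intros)
      from DERIV_cmult[OF DERIV_power_div_fact[OF this], of M n]
      show "((\<lambda>s. M * ((L * s) ^ Suc n / fact (Suc n))) has_vector_derivative L * (M * ((L * s) ^ n / fact n))) (at s within {0..t})"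
        unfolding has_real_derivative_iff_has_vector_derivative[symmetric] by (simp add: mult.left_commute)
    qed (use Suc in auto)
    have "X (Suc (Suc n)) t - X (Suc n) t = integral {0..t} (\<lambda>s. G s (X (Suc n) s) - G s (X n s))"
      unfolding XS[of "Suc n"] XS[of n, THEN fun_cong, of t] using Suc.prems by (simp add: integral_diff int cX del: X_def)
    also have "norm \<dots> \<le> integral {0..t} (\<lambda>s. L * (M * ((L * s) ^ n / fact n)))"
    proof (rule integral_norm_bound_integral)
      fix s assume "s \<in> {0..t}"
      then have s: "s \<in> {0..1}" using Suc.prems by auto
      show "norm (G s (X (Suc n) s) - G s (X n s)) \<le> L * (M * ((L * s) ^ n / fact n))"
        using lip[OF s, of "X (Suc n) s" "X n s"] mult_left_mono[OF Suc.IH[OF s] L] by linarith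
    qed (use i Suc.prems in \<open>auto intro!: integrable_diff int cX\<close>)
    also have "\<dots> = M * ((L * t) ^ Suc n / fact (Suc n))" using integral_unique[OF i] by simp
    finally show ?case .
  qed
  have "uniform_limit {0..1} (\<lambda>n t. \<Sum>i<n. X (Suc i) t - X i t) (\<lambda>t. \<Sum>i. X (Suc i) t - X i t) sequentially"
  proof (rule Weierstrass_m_test)
    show "norm (X (Suc n) t - X n t) \<le> M * (L ^ n / fact n)" if t: "t \<in> {0..1}" for n t
    proof -
      have "M * ((L * t) ^ n / fact n) \<le> M * (L ^ n / fact n)"
        using t M0 L by (intro mult_left_mono divide_right_mono power_mono) (auto simp: mult_left_le)
      then show ?thesis using step[OF t, of n] by linarith
    qed
    show "summable (\<lambda>n. M * (L ^ n / fact n))"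
      using summable_exp[of L] by (intro summable_mult) (simp add: divide_inverse mult.commute)
  qed
  moreover have "(\<Sum>i<n. X (Suc i) t - X i t) = X n t - y0" for n t
    using sum_lessThan_telescope[of "\<lambda>i. X i t" n] by (simp add: X0)
  ultimately obtain Y where "uniform_limit {0..1} (\<lambda>n t. X n t - y0) Y sequentially"
    by auto
  then have ul: "uniform_limit {0..1} (\<lambda>n t. (X n t - y0) + y0) (\<lambda>t. Y t + y0) sequentially"
    by (rule uniform_limit_add[OF _ uniform_limit_const])
  define y where "y t = Y t + y0" for t
  have ul: "uniform_limit {0..1} X y sequentially" using ul by (simp add: y_def[abs_def])
  have cy: "continuous_on {0..1} y" using uniform_limit_theorem[OF _ ul] cX by auto
  have y_eq: "y t = y0 + integral {0..t} (\<lambda>s. G s (y s))" if t: "t \<in> {0..1}" for t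
  proof (rule LIMSEQ_unique)
    show "(\<lambda>n. X (Suc n) t) \<longlonglongrightarrow> y t"
      using tendsto_uniform_limitI[OF ul t] by (rule LIMSEQ_Suc)
    have "(\<lambda>n. integral {0..t} (\<lambda>s. G s (X n s))) \<longlonglongrightarrow> integral {0..t} (\<lambda>s. G s (y s))"
    proof (rule LIMSEQ_I)
      fix r :: real assume r: "0 < r"
      define d where "d = r / (2 * (L + 1))"
      have d: "0 < d" using r L by (simp add: d_def)
      obtain n0 where n0: "\<And>n s. n \<ge> n0 \<Longrightarrow> s \<in> {0..1} \<Longrightarrow> dist (X n s) (y s) < d"
        using uniform_limitD[OF ul d] unfolding eventually_sequentially by blast
      have "norm (integral {0..t} (\<lambda>s. G s (X n s)) - integral {0..t} (\<lambda>s. G s (y s))) < r" if n: "n \<ge> n0" for n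
      proof -
        have "integral {0..t} (\<lambda>s. G s (X n s)) - integral {0..t} (\<lambda>s. G s (y s)) = integral {0..t} (\<lambda>s. G s (X n s) - G s (y s))"
          using t by (simp add: integral_diff int cX cy)
        also have "norm \<dots> \<le> (L * d) * (t - 0)"
        proof (rule integral_bound)
          fix s assume "s \<in> {0..t}"
          then have s: "s \<in> {0..1}" using t by auto
          show "norm (G s (X n s) - G s (y s)) \<le> L * d"
            using lip[OF s, of "X n s" "y s"] mult_left_mono[OF less_imp_le[OF n0[OF n s]] L] by (simp add: dist_norm)
        qed (use t cX cy in \<open>auto intro!: continuous_intros continuous_on_subset[OF cont]\<close>)
        also have "\<dots> \<le> L * d" using t L d by (simp add: mult_left_le)
        also have "\<dots> \<le> (L + 1) * d" using d by simp
        also have "\<dots> = r / 2" using L by (simp add: d_def field_simps add_nonneg_eq_0_iff)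
        finally show ?thesis using r by simp
      qed
      then show "\<exists>no. \<forall>n\<ge>no. norm (integral {0..t} (\<lambda>s. G s (X n s)) - integral {0..t} (\<lambda>s. G s (y s))) < r" by blast
    qed
    then show "(\<lambda>n. X (Suc n) t) \<longlonglongrightarrow> y0 + integral {0..t} (\<lambda>s. G s (y s))"
      unfolding XS by (intro tendsto_intros)
  qed
  show thesis
  proof
    show "y 0 = y0" using y_eq[of 0] by simp
    fix t :: real assume t: "t \<in> {0..1}"
    have "((\<lambda>t. y0 + integral {0..t} (\<lambda>s. G s (y s))) has_vector_derivative 0 + G t (y t)) (at t within {0..1})"
      by (intro has_vector_derivative_add has_vector_derivative_const integral_has_vector_derivative cont cy t)
    then have d: "((\<lambda>t. y0 + integral {0..t} (\<lambda>s. G s (y s))) has_vector_derivative G t (y t)) (at t within {0..1})"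
      by simp
    show "(y has_vector_derivative G t (y t)) (at t within {0..1})"
      by (rule has_vector_derivative_transform[OF t y_eq d])
  qed
qed

section \<open>Trajectories\<close>

abbreviation control_affine ::
  "('a::euclidean_space \<Rightarrow> 'a) \<Rightarrow> ('a \<Rightarrow> 'a) \<Rightarrow> 'a \<Rightarrow> real \<Rightarrow> 'a" where
  "control_affine f g \<equiv> \<lambda>x u. f x + u *\<^sub>R g x"

lemma trajectory_onI:
  assumes "(\<lambda>s. F (x s) (u s)) absolutely_integrable_on {a..b}"
    and "\<And>t. t \<in> {a..b} \<Longrightarrow> x t = x a + integral {a..t} (\<lambda>s. F (x s) (u s))"
  shows "trajectory_on F u a b x"
  using assms unfolding trajectory_on_def by blast

lemma trajectory_onD:
  assumes "trajectory_on F u a b x"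
  shows "(\<lambda>s. F (x s) (u s)) absolutely_integrable_on {a..b}" "(\<lambda>s. F (x s) (u s)) integrable_on {a..b}"
    and "\<And>t. t \<in> {a..b} \<Longrightarrow> x t = x a + integral {a..t} (\<lambda>s. F (x s) (u s))"
  using assms unfolding trajectory_on_def absolutely_integrable_on_def by blast+

text \<open>The controls may differ at the right endpoint, a null set. A sampled or glued control
  already takes its next value there.\<close>

lemma trajectory_on_cong:
  assumes "trajectory_on F u a b x" "a \<le> b"
    and x: "\<And>s. s \<in> {a..b} \<Longrightarrow> x' s = x s" and u: "\<And>s. s \<in> {a..<b} \<Longrightarrow> u' s = u s"
  shows "trajectory_on F u' a b x'"
proof -
  have eq: "F (x' s) (u' s) = F (x s) (u s)" if "s \<in> {a..b} - {b}" for s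
    using that x u by auto
  have "(\<lambda>s. F (x' s) (u' s)) absolutely_integrable_on {a..b}"
    by (rule absolutely_integrable_spike[OF trajectory_onD(1)[OF assms(1)] negligible_sing[of b] eq])
  moreover have "x' t = x' a + integral {a..t} (\<lambda>s. F (x' s) (u' s))" if t: "t \<in> {a..b}" for t
  proof -
    have "integral {a..t} (\<lambda>s. F (x' s) (u' s)) = integral {a..t} (\<lambda>s. F (x s) (u s))"
      by (rule integral_spike[OF negligible_sing[of b]]) (use t eq in auto)
    then show ?thesis using trajectory_onD(3)[OF assms(1) t] x[OF t] x[of a] \<open>a \<le> b\<close> by simp
  qed
  ultimately show ?thesis by (rule trajectory_onI)
qed

lemma trajectory_on_subinterval:
  assumes "trajectory_on F u a b x" "a \<le> a'" "a' \<le> b'" "b' \<le> b"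
  shows "trajectory_on F u a' b' x"
proof -
  have ai: "(\<lambda>s. F (x s) (u s)) absolutely_integrable_on {a..b}"
    and eq: "\<And>t. t \<in> {a..b} \<Longrightarrow> x t = x a + integral {a..t} (\<lambda>s. F (x s) (u s))"
    using trajectory_onD[OF assms(1)] by blast+
  have sub: "(\<lambda>s. F (x s) (u s)) absolutely_integrable_on {c..d}" if "a \<le> c" "d \<le> b" for c d
    by (rule absolutely_integrable_on_subinterval[OF ai]) (use that in auto)
  have eq': "x t = x a' + integral {a'..t} (\<lambda>s. F (x s) (u s))" if "t \<in> {a'..b'}" for t
  proof -
    have C: "integral {a..a'} (\<lambda>s. F (x s) (u s)) + integral {a'..t} (\<lambda>s. F (x s) (u s)) = integral {a..t} (\<lambda>s. F (x s) (u s))"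
      using that assms sub[of a t] by (intro Henstock_Kurzweil_Integration.integral_combine) (auto simp: absolutely_integrable_on_def)
    have A: "x t = x a + integral {a..t} (\<lambda>s. F (x s) (u s))"
      by (rule eq) (use that assms in auto)
    have B: "x a' = x a + integral {a..a'} (\<lambda>s. F (x s) (u s))"
      by (rule eq) (use that assms in auto)
    show ?thesis unfolding A B C[symmetric] by (rule add.assoc[symmetric])
  qed
  show ?thesis by (rule trajectory_onI[where F = F and u = u and x = x, OF sub[OF assms(2,4)] eq'])
qed

lemma trajectory_on_combine:
  assumes 1: "trajectory_on F u a b x" and 2: "trajectory_on F u b c x" and "a \<le> b" "b \<le> c"
  shows "trajectory_on F u a c x"
proof (rule trajectory_onI)
  show ai: "(\<lambda>s. F (x s) (u s)) absolutely_integrable_on {a..c}"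
    by (rule absolutely_integrable_on_combine[OF trajectory_onD(1)[OF 1] trajectory_onD(1)[OF 2] assms(3,4)])
  fix t assume t: "t \<in> {a..c}"
  show "x t = x a + integral {a..t} (\<lambda>s. F (x s) (u s))"
  proof (cases "t \<le> b")
    case True
    then show ?thesis using t by (intro trajectory_onD(3)[OF 1]) auto
  next
    case False
    have "(\<lambda>s. F (x s) (u s)) absolutely_integrable_on {a..t}"
      by (rule absolutely_integrable_on_subinterval[OF ai]) (use t in auto)
    then have C: "integral {a..b} (\<lambda>s. F (x s) (u s)) + integral {b..t} (\<lambda>s. F (x s) (u s)) = integral {a..t} (\<lambda>s. F (x s) (u s))"
      using t assms False by (intro Henstock_Kurzweil_Integration.integral_combine) (auto simp: absolutely_integrable_on_def)
    have A: "x t = x b + integral {b..t} (\<lambda>s. F (x s) (u s))"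
      by (rule trajectory_onD(3)[OF 2]) (use t False in auto)
    have B: "x b = x a + integral {a..b} (\<lambda>s. F (x s) (u s))"
      by (rule trajectory_onD(3)[OF 1]) (use assms in auto)
    show ?thesis unfolding A B C[symmetric] by (rule add.assoc)
  qed
qed

lemma trajectory_on_singleton: "trajectory_on F u a a x"
  by (rule trajectory_onI) (auto simp: absolutely_integrable_on_def integrable_on_refl[of _ a, simplified])

lemma trajectory_on_continuous:
  assumes "trajectory_on F u a b x"
  shows "continuous_on {a..b} x"
proof -
  have "(\<lambda>s. F (x s) (u s)) integrable_on {a..b}"
    using trajectory_onD(2)[OF assms] .
  then have "continuous_on {a..b} (\<lambda>t. x a + integral {a..t} (\<lambda>s. F (x s) (u s)))"
    by (intro continuous_intros indefinite_integral_continuous_1)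
  then show ?thesis
    by (rule continuous_on_eq) (rule trajectory_onD(3)[OF assms, symmetric])
qed

text \<open>Both curves stay in a common ball, where the fields are Lipschitz; since the control is
  bounded, Gronwall's inequality applies with initial difference zero. Uniqueness later transfers
  what is known of one constructed trajectory to every trajectory of the closed loop.\<close>

lemma trajectory_on_unique:
  assumes f: "smooth f" and g: "smooth g" and u: "\<And>s. s \<in> {a..b} \<Longrightarrow> \<bar>u s\<bar> \<le> \<Lambda>"
    and X: "trajectory_on (control_affine f g) u a b X" and Y: "trajectory_on (control_affine f g) u a b Y"
    and eq: "X a = Y a" and t: "t \<in> {a..b}"
  shows "X t = Y t"
proof -
  let ?F = "control_affine f g"
  have c: "continuous_on {a..b} X" "continuous_on {a..b} Y"
    using X Y by (auto intro: trajectory_on_continuous)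
  then have "bounded (X ` {a..b} \<union> Y ` {a..b})"
    by (auto intro!: compact_imp_bounded compact_continuous_image)
  then obtain R where R: "X ` {a..b} \<union> Y ` {a..b} \<subseteq> cball 0 R"
    unfolding bounded_iff subset_iff mem_cball_0 by blast
  obtain Lf where Lf: "0 \<le> Lf" "\<And>y z. y \<in> cball 0 R \<Longrightarrow> z \<in> cball 0 R \<Longrightarrow> norm (f y - f z) \<le> Lf * norm (y - z)"
    using smooth_lipschitz_on_convex_compact[OF f, of "cball 0 R"] by auto
  obtain Lg where Lg: "0 \<le> Lg" "\<And>y z. y \<in> cball 0 R \<Longrightarrow> z \<in> cball 0 R \<Longrightarrow> norm (g y - g z) \<le> Lg * norm (y - z)"
    using smooth_lipschitz_on_convex_compact[OF g, of "cball 0 R"] by auto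
  define L where "L = Lf + \<Lambda> * Lg"
  have \<Lambda>: "0 \<le> \<Lambda>" using u[OF t] by linarith
  have cn: "continuous_on {a..b} (\<lambda>s. norm (X s - Y s))" using c by (intro continuous_intros)
  have "norm (X t - Y t) \<le> 0 * exp (L * (t - a))"
  proof (rule gronwall[OF cn _ _ t])
    show "0 \<le> L" using Lf Lg \<Lambda> by (simp add: L_def)
    fix t assume t: "t \<in> {a..b}"
    have i: "(\<lambda>s. ?F (X s) (u s)) integrable_on {a..t}" "(\<lambda>s. ?F (Y s) (u s)) integrable_on {a..t}"
      by (rule trajectory_onD(2)[OF trajectory_on_subinterval[OF X]], use t in auto)
        (rule trajectory_onD(2)[OF trajectory_on_subinterval[OF Y]], use t in auto)
    have "X t - Y t = integral {a..t} (\<lambda>s. ?F (X s) (u s) - ?F (Y s) (u s))"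
      unfolding integral_diff[OF i] trajectory_onD(3)[OF X t] trajectory_onD(3)[OF Y t] eq by (rule add_diff_cancel_left)
    also have "norm \<dots> \<le> integral {a..t} (\<lambda>s. L * norm (X s - Y s))"
    proof (rule integral_norm_bound_integral)
      show "(\<lambda>s. L * norm (X s - Y s)) integrable_on {a..t}"
        by (intro integrable_continuous_real continuous_intros continuous_on_subset[OF cn]) (use t in auto)
      fix s assume "s \<in> {a..t}"
      then have s: "s \<in> {a..b}" using t by auto
      then have K: "X s \<in> cball 0 R" "Y s \<in> cball 0 R" using R by blast+
      have "?F (X s) (u s) - ?F (Y s) (u s) = (f (X s) - f (Y s)) + u s *\<^sub>R (g (X s) - g (Y s))"
        by (simp add: algebra_simps)
      also have "norm \<dots> \<le> norm (f (X s) - f (Y s)) + \<bar>u s\<bar> * norm (g (X s) - g (Y s))"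
        by (metis norm_scaleR norm_triangle_ineq)
      also have "\<dots> \<le> Lf * norm (X s - Y s) + \<Lambda> * (Lg * norm (X s - Y s))"
        using Lf(2)[OF K] Lg(2)[OF K] u[OF s] \<Lambda> by (intro add_mono mult_mono) auto
      finally show "norm (?F (X s) (u s) - ?F (Y s) (u s)) \<le> L * norm (X s - Y s)"
        by (simp add: L_def algebra_simps)
    qed (use i in \<open>auto intro: integrable_diff\<close>)
    finally show "norm (X t - Y t) \<le> 0 + L * integral {a..t} (\<lambda>s. norm (X s - Y s))" by simp
  qed
  then show ?thesis by simp
qed

text \<open>The parameter \<open>t\<close> in the unit interval stands for the real time
  \<open>\<epsilon> * t\<close>. Confinement to \<open>K\<close> is built in because all Lipschitz
  and Taylor bounds are taken on \<open>K\<close>.\<close>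

definition scaled_solution ::
  "('a::euclidean_space \<Rightarrow> 'a) \<Rightarrow> ('a \<Rightarrow> 'a) \<Rightarrow> (real \<Rightarrow> real) \<Rightarrow> 'a set \<Rightarrow> real \<Rightarrow> (real \<Rightarrow> 'a) \<Rightarrow> bool" where
  "scaled_solution f g v K \<epsilon> y \<longleftrightarrow> (\<forall>t\<in>{0..1}. y t \<in> K \<and>
    (y has_vector_derivative \<epsilon> *\<^sub>R (f (y t) + v t *\<^sub>R g (y t))) (at t within {0..1}))"

text \<open>Composing the fields with the nearest-point projection onto the larger ball makes them
  globally Lipschitz. For small \<open>\<epsilon>\<close> the solution cannot leave that ball in
  unit time, so the projection is the identity along it.\<close>

lemma scaled_solution_exists:
  fixes f g :: "'a::euclidean_space \<Rightarrow> 'a"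
  assumes f: "smooth f" and g: "smooth g" and v: "continuous_on {0..1} v" and \<rho>: "0 < \<rho>"
  obtains \<epsilon>0 where "0 < \<epsilon>0"
    "\<And>\<epsilon> y0. 0 < \<epsilon> \<Longrightarrow> \<epsilon> \<le> \<epsilon>0 \<Longrightarrow> y0 \<in> cball p \<rho> \<Longrightarrow> \<exists>y. y 0 = y0 \<and> scaled_solution f g v (cball p (2 * \<rho>)) \<epsilon> y"
proof -
  define K where "K = cball p (2 * \<rho>)"
  have K: "compact K" "convex K" "closed K" "K \<noteq> {}" using \<rho> by (auto simp: K_def)
  obtain \<Lambda> where \<Lambda>: "\<Lambda> \<ge> 0" "\<And>s. s \<in> {0..1} \<Longrightarrow> \<bar>v s\<bar> \<le> \<Lambda>" using continuous_on_interval_bdd[OF v] by blast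
  obtain Lf where Lf: "0 \<le> Lf" "\<And>y z. y \<in> K \<Longrightarrow> z \<in> K \<Longrightarrow> norm (f y - f z) \<le> Lf * norm (y - z)"
    using smooth_lipschitz_on_convex_compact[OF f K(1,2)] by auto
  obtain Lg where Lg: "0 \<le> Lg" "\<And>y z. y \<in> K \<Longrightarrow> z \<in> K \<Longrightarrow> norm (g y - g z) \<le> Lg * norm (y - z)"
    using smooth_lipschitz_on_convex_compact[OF g K(1,2)] by auto
  have "\<exists>B\<ge>0. \<forall>z\<in>K. norm (h z) \<le> B" if h: "smooth h" for h :: "'a \<Rightarrow> 'a"
  proof -
    obtain B where "\<forall>z\<in>K. norm (h z) \<le> B"
      using compact_imp_bounded[OF compact_continuous_image[OF smooth_continuous[OF h] K(1)]] unfolding bounded_iff by blast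
    then show ?thesis by (intro exI[of _ "max 0 B"]) (auto simp: le_max_iff_disj)
  qed
  from this[OF f] this[OF g]
  obtain Bf Bg where B: "0 \<le> Bf" "\<And>z. z \<in> K \<Longrightarrow> norm (f z) \<le> Bf" "0 \<le> Bg" "\<And>z. z \<in> K \<Longrightarrow> norm (g z) \<le> Bg"
    by blast
  define M where "M = Bf + \<Lambda> * Bg"
  have M: "0 \<le> M" using B \<Lambda> by (simp add: M_def)
  \<comment> \<open>The speed is at most \<open>\<epsilon> * M\<close>, so within unit time the
    solution moves by at most \<open>\<rho>\<close>; the added 1 keeps the denominator
    positive.\<close>
  define \<epsilon>0 where "\<epsilon>0 = \<rho> / (M + 1)"
  have "\<exists>y. y 0 = y0 \<and> scaled_solution f g v K \<epsilon> y" if \<epsilon>: "0 < \<epsilon>" "\<epsilon> \<le> \<epsilon>0" and y0: "y0 \<in> cball p \<rho>" for \<epsilon> y0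
  proof -
    let ?\<pi> = "closest_point K"
    define G where "G t z = \<epsilon> *\<^sub>R (f (?\<pi> z) + v t *\<^sub>R g (?\<pi> z))" for t z
    have \<pi>: "?\<pi> z \<in> K" for z using K by (intro closest_point_in_set)
    have lip: "norm (G t y - G t z) \<le> \<epsilon> * (Lf + \<Lambda> * Lg) * norm (y - z)" if t: "t \<in> {0..1}" for t y z
    proof -
      have n: "norm (?\<pi> y - ?\<pi> z) \<le> norm (y - z)"
        using closest_point_lipschitz[OF K(2,3,4), of y z] by (simp add: dist_norm)
      have "G t y - G t z = \<epsilon> *\<^sub>R ((f (?\<pi> y) - f (?\<pi> z)) + v t *\<^sub>R (g (?\<pi> y) - g (?\<pi> z)))"
        by (simp add: G_def algebra_simps)
      also have "norm \<dots> = \<epsilon> * norm ((f (?\<pi> y) - f (?\<pi> z)) + v t *\<^sub>R (g (?\<pi> y) - g (?\<pi> z)))"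
        using \<epsilon> by simp
      also have "\<dots> \<le> \<epsilon> * (norm (f (?\<pi> y) - f (?\<pi> z)) + \<bar>v t\<bar> * norm (g (?\<pi> y) - g (?\<pi> z)))"
        using \<epsilon> by (intro mult_left_mono norm_triangle_le) auto
      also have "\<dots> \<le> \<epsilon> * (Lf * norm (y - z) + \<Lambda> * (Lg * norm (y - z)))"
        using Lf(2)[OF \<pi>[of y] \<pi>[of z]] Lg(2)[OF \<pi>[of y] \<pi>[of z]] \<Lambda>(1) \<Lambda>(2)[OF t] \<epsilon>
          mult_left_mono[OF n Lf(1)] mult_left_mono[OF n Lg(1)]
        by (intro mult_left_mono add_mono mult_mono) auto
      finally show ?thesis by (simp add: algebra_simps)
    qed
    have c\<pi>: "continuous_on UNIV ?\<pi>" using K by (intro continuous_on_closest_point)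
    have cont: "continuous_on {0..1} (\<lambda>t. G t (y t))" if "continuous_on {0..1} y" for y
      unfolding G_def
      by (intro continuous_intros v continuous_on_compose2[OF smooth_continuous[OF f, of UNIV]]
          continuous_on_compose2[OF smooth_continuous[OF g, of UNIV]] continuous_on_compose2[OF c\<pi>] that) auto
    have L0: "0 \<le> \<epsilon> * (Lf + \<Lambda> * Lg)" using \<epsilon> Lf Lg \<Lambda> by simp
    obtain y where y: "y 0 = y0" "\<And>t. t \<in> {0..1} \<Longrightarrow> (y has_vector_derivative G t (y t)) (at t within {0..1})"
      using picard_global[of G, OF lip L0 cont] by blast
    have "y t \<in> K" if t: "t \<in> {0..1}" for t
    proof -
      have "((\<lambda>t. G t (y t)) has_integral y t - y 0) {0..t}"
        using t by (intro fundamental_theorem_of_calculus has_vector_derivative_within_subset[OF y(2)]) auto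
      then have "norm (y t - y 0) \<le> \<epsilon> * M * measure lborel {0..t}"
      proof (rule has_integral_bound_real[where S="{}", rotated 2])
        show "0 \<le> \<epsilon> * M" using \<epsilon> M by simp
        fix s assume "s \<in> {0..t} - {}"
        then have s: "s \<in> {0..1}" using t by auto
        have "norm (G s (y s)) = \<epsilon> * norm (f (?\<pi> (y s)) + v s *\<^sub>R g (?\<pi> (y s)))" using \<epsilon> by (simp add: G_def)
        also have "\<dots> \<le> \<epsilon> * (norm (f (?\<pi> (y s))) + \<bar>v s\<bar> * norm (g (?\<pi> (y s))))"
          using \<epsilon> by (intro mult_left_mono norm_triangle_le) auto
        also have "\<dots> \<le> \<epsilon> * M"
          unfolding M_def using B \<pi>[of "y s"] \<Lambda>(1) \<Lambda>(2)[OF s] \<epsilon> by (intro mult_left_mono add_mono mult_mono) auto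
        finally show "norm (G s (y s)) \<le> \<epsilon> * M" .
      qed auto
      also have "\<dots> \<le> \<epsilon> * M * 1" using t \<epsilon> M by (intro mult_left_mono) auto
      also have "\<dots> \<le> \<epsilon>0 * (M + 1)" using \<epsilon> M by (auto intro!: mult_mono)
      also have "\<dots> = \<rho>" using M by (simp add: \<epsilon>0_def add_nonneg_eq_0_iff)
      finally have "dist (y t) y0 \<le> \<rho>" by (simp add: y(1) dist_norm)
      then show ?thesis using y0 dist_triangle[of p "y t" y0] by (simp add: K_def dist_commute)
    qed
    then show ?thesis using y by (auto simp: scaled_solution_def G_def closest_point_self)
  qed
  moreover have "0 < \<epsilon>0" using \<rho> M by (simp add: \<epsilon>0_def)
  ultimately show thesis using that unfolding K_def by blast
qed

lemma scaled_solution_dependence: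
  fixes f g :: "'a::euclidean_space \<Rightarrow> 'a"
  assumes f: "smooth f" and g: "smooth g" and v: "continuous_on {0..1} v" and K: "compact K" "convex K" and \<epsilon>: "0 \<le> \<epsilon>"
  obtains L where "0 < L" "\<And>y z t. scaled_solution f g v K \<epsilon> y \<Longrightarrow> scaled_solution f g v K \<epsilon> z \<Longrightarrow> t \<in> {0..1} \<Longrightarrow>
    norm (y t - z t) \<le> L * norm (y 0 - z 0)"
proof -
  obtain \<Lambda> where \<Lambda>: "\<Lambda> \<ge> 0" "\<And>s. s \<in> {0..1} \<Longrightarrow> \<bar>v s\<bar> \<le> \<Lambda>" using continuous_on_interval_bdd[OF v] by blast
  obtain Lf where Lf: "0 \<le> Lf" "\<And>y z. y \<in> K \<Longrightarrow> z \<in> K \<Longrightarrow> norm (f y - f z) \<le> Lf * norm (y - z)"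
    using smooth_lipschitz_on_convex_compact[OF f K(1,2)] by auto
  obtain Lg where Lg: "0 \<le> Lg" "\<And>y z. y \<in> K \<Longrightarrow> z \<in> K \<Longrightarrow> norm (g y - g z) \<le> Lg * norm (y - z)"
    using smooth_lipschitz_on_convex_compact[OF g K(1,2)] by auto
  define L where "L = \<epsilon> * (Lf + \<Lambda> * Lg)"
  have L: "0 \<le> L" using \<epsilon> Lf Lg \<Lambda> by (simp add: L_def)
  have "norm (y t - z t) \<le> exp L * norm (y 0 - z 0)"
    if y: "scaled_solution f g v K \<epsilon> y" and z: "scaled_solution f g v K \<epsilon> z" and t: "t \<in> {0..1}" for y z t
  proof -
    let ?D = "\<lambda>y t. \<epsilon> *\<^sub>R (f (y t) + v t *\<^sub>R g (y t))"
    have d: "(y has_vector_derivative ?D y s) (at s within {0..1})" "(z has_vector_derivative ?D z s) (at s within {0..1})"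
      if "s \<in> {0..1}" for s using y z that by (auto simp: scaled_solution_def)
    have cn: "continuous_on {0..1} (\<lambda>s. norm (y s - z s))"
      by (intro continuous_intros continuous_on_vector_derivative[OF d(1)] continuous_on_vector_derivative[OF d(2)])
    have "norm (y t - z t) \<le> norm (y 0 - z 0) * exp (L * (t - 0))"
    proof (rule gronwall[OF cn L _ t])
      fix t :: real assume t: "t \<in> {0..1}"
      have "((\<lambda>s. ?D y s - ?D z s) has_integral (y t - y 0) - (z t - z 0)) {0..t}"
        using t by (intro has_integral_diff fundamental_theorem_of_calculus
            has_vector_derivative_within_subset[OF d(1)] has_vector_derivative_within_subset[OF d(2)]) auto
      then have i: "(\<lambda>s. ?D y s - ?D z s) integrable_on {0..t}"
        and e: "(y t - z t) - (y 0 - z 0) = integral {0..t} (\<lambda>s. ?D y s - ?D z s)"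
        by (auto simp: integral_unique)
      note e
      also have "norm \<dots> \<le> integral {0..t} (\<lambda>s. L * norm (y s - z s))"
      proof (rule integral_norm_bound_integral[OF i])
        show "(\<lambda>s. L * norm (y s - z s)) integrable_on {0..t}"
          by (intro integrable_continuous_real continuous_intros continuous_on_subset[OF cn]) (use t in auto)
        fix s assume "s \<in> {0..t}"
        then have s: "s \<in> {0..1}" using t by auto
        have k: "y s \<in> K" "z s \<in> K" using y z s by (auto simp: scaled_solution_def)
        have "?D y s - ?D z s = \<epsilon> *\<^sub>R ((f (y s) - f (z s)) + v s *\<^sub>R (g (y s) - g (z s)))"
          by (simp add: algebra_simps)
        also have "norm \<dots> = \<epsilon> * norm ((f (y s) - f (z s)) + v s *\<^sub>R (g (y s) - g (z s)))"
          using \<epsilon> by simp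
        also have "\<dots> \<le> \<epsilon> * (norm (f (y s) - f (z s)) + \<bar>v s\<bar> * norm (g (y s) - g (z s)))"
          using \<epsilon> by (intro mult_left_mono norm_triangle_le) auto
        also have "\<dots> \<le> \<epsilon> * (Lf * norm (y s - z s) + \<Lambda> * (Lg * norm (y s - z s)))"
          using Lf(2)[OF k] Lg(2)[OF k] \<Lambda>(1) \<Lambda>(2)[OF s] \<epsilon> by (intro mult_left_mono add_mono mult_mono) auto
        finally show "norm (?D y s - ?D z s) \<le> L * norm (y s - z s)" by (simp add: L_def algebra_simps)
      qed
      finally show "norm (y t - z t) \<le> norm (y 0 - z 0) + L * integral {0..t} (\<lambda>s. norm (y s - z s))"
        using norm_triangle_sub[of "y t - z t" "y 0 - z 0"] by simp
    qed
    also have "\<dots> \<le> norm (y 0 - z 0) * exp L"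
      using t L by (intro mult_left_mono) (auto simp: mult_left_le)
    finally show ?thesis by (simp add: mult.commute)
  qed
  then show thesis by (intro that[of "exp L"]) auto
qed

text \<open>Clamping the argument extends the control continuously to the whole line, which yields
  measurability and boundedness on every interval at once.\<close>

definition unscaled_control :: "(real \<Rightarrow> real) \<Rightarrow> real \<Rightarrow> real \<Rightarrow> real \<Rightarrow> real" where
  "unscaled_control v a e s = v (max 0 (min 1 ((s - a) / e)))"

lemma continuous_on_unscaled_control:
  assumes "continuous_on {0..1} v" "0 < e"
  shows "continuous_on UNIV (unscaled_control v a e)"
  unfolding unscaled_control_def[abs_def]
  by (rule continuous_on_compose2[OF assms(1)]) (use assms(2) in \<open>auto intro!: continuous_intros\<close>)

lemma scaled_solution_trajectory:
  fixes f g :: "'a::euclidean_space \<Rightarrow> 'a"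
  assumes f: "smooth f" and g: "smooth g" and v: "continuous_on {0..1} v" and e: "0 < e"
    and y: "scaled_solution f g v K e y"
  shows "trajectory_on (control_affine f g) (unscaled_control v a e) a (a + e) (\<lambda>s. y ((s - a) / e))"
proof -
  let ?X = "\<lambda>s. y ((s - a) / e)" and ?u = "unscaled_control v a e"
  have d: "(?X has_vector_derivative control_affine f g (?X s) (?u s)) (at s within {a..a+e})" if s: "s \<in> {a..a+e}" for s
  proof -
    have r: "(s - a) / e \<in> {0..1}" if "s \<in> {a..a+e}" for s using e that by (auto simp: field_simps)
    have "((\<lambda>s. (s - a) / e) has_vector_derivative 1 / e) (at s within {a..a+e})"
      unfolding has_real_derivative_iff_has_vector_derivative[symmetric] using e by (auto intro!: derivative_eq_intros)
    moreover have "(y has_vector_derivative e *\<^sub>R control_affine f g (?X s) (v ((s - a) / e)))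
        (at ((s - a) / e) within (\<lambda>s. (s - a) / e) ` {a..a+e})"
      by (rule has_vector_derivative_within_subset[of _ _ _ "{0..1}"])
        (use y r s in \<open>auto simp: scaled_solution_def simp del: atLeastAtMost_iff\<close>)
    ultimately have "(y \<circ> (\<lambda>s. (s - a) / e) has_vector_derivative (1 / e) *\<^sub>R (e *\<^sub>R control_affine f g (?X s) (v ((s - a) / e))))
        (at s within {a..a+e})"
      by (rule vector_diff_chain_within)
    moreover have "?u s = v ((s - a) / e)" using r[OF s] by (simp add: unscaled_control_def)
    ultimately show ?thesis using e by (simp add: o_def)
  qed
  have cX: "continuous_on {a..a+e} ?X" using d by (rule continuous_on_vector_derivative)
  have cu: "continuous_on {a..a+e} ?u"
    by (rule continuous_on_subset[OF continuous_on_unscaled_control[OF v e]]) auto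
  have "continuous_on {a..a+e} (\<lambda>s. control_affine f g (?X s) (?u s))"
    by (intro continuous_intros cu continuous_on_compose2[OF smooth_continuous[OF f, of UNIV] cX]
        continuous_on_compose2[OF smooth_continuous[OF g, of UNIV] cX]) auto
  then have "(\<lambda>s. control_affine f g (?X s) (?u s)) absolutely_integrable_on {a..a+e}"
    by (rule absolutely_integrable_continuous_real)
  moreover have "?X t = ?X a + integral {a..t} (\<lambda>s. control_affine f g (?X s) (?u s))" if t: "t \<in> {a..a+e}" for t
  proof -
    have "((\<lambda>s. control_affine f g (?X s) (?u s)) has_integral ?X t - ?X a) {a..t}"
      using t by (intro fundamental_theorem_of_calculus has_vector_derivative_within_subset[OF d]) auto
    then show ?thesis by (simp add: integral_unique)
  qed
  ultimately show ?thesis by (rule trajectory_onI)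
qed

section \<open>Local descent\<close>

text \<open>Stronger than admissibility: Borel instead of Lebesgue measurable, and bounded at every
  point of a compact interval instead of almost everywhere. The class is closed under pasting and
  supplies the pointwise bound used for uniqueness.\<close>

definition locally_bounded_control :: "(real \<Rightarrow> real) \<Rightarrow> bool" where
  "locally_bounded_control u \<longleftrightarrow> u \<in> borel_measurable borel \<and> (\<forall>a b. bounded (u ` {a..b}))"

lemma locally_bounded_control_admissible:
  assumes u: "locally_bounded_control u" and I: "I \<in> sets borel"
  shows "admissible_control I u"
proof -
  have "u \<in> borel_measurable (lebesgue_on I)"
    using u unfolding locally_bounded_control_def
    by (intro measurable_restrict_space1 measurable_completion) simp
  moreover have "\<exists>M. AE t in lebesgue_on K. norm (u t) \<le> M" if K: "compact K" for K
  proof -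
    obtain b where "K \<subseteq> {-b..b}"
      using bounded_subset_cbox_symmetric[OF compact_imp_bounded[OF K]] by (metis box_real(2))
    moreover obtain M where "\<forall>t\<in>{-b..b}. norm (u t) \<le> M"
      using u unfolding locally_bounded_control_def bounded_iff by blast
    ultimately have "\<forall>t\<in>space (lebesgue_on K). norm (u t) \<le> M" by auto
    then show ?thesis by (metis AE_I2)
  qed
  ultimately show ?thesis by (simp add: admissible_control_def)
qed

lemma locally_bounded_control_continuous:
  "continuous_on UNIV u \<Longrightarrow> locally_bounded_control u"
  unfolding locally_bounded_control_def
  by (auto intro: borel_measurable_continuous_onI compact_imp_bounded[OF compact_continuous_image] continuous_on_subset)

lemma locally_bounded_control_zero: "locally_bounded_control (\<lambda>_. 0)"
  by (simp add: locally_bounded_control_continuous)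

lemma locally_bounded_control_if:
  assumes "locally_bounded_control u" "locally_bounded_control w"
  shows "locally_bounded_control (\<lambda>s. if s < b then u s else w s)"
proof -
  have "bounded ((\<lambda>s. if s < b then u s else w s) ` {c..d})" for c d
    by (rule bounded_subset[of "u ` {c..d} \<union> w ` {c..d}"])
      (use assms in \<open>auto simp: locally_bounded_control_def\<close>)
  then show ?thesis using assms by (auto simp: locally_bounded_control_def)
qed

lemma trajectory_on_unique_control:
  assumes "smooth f" "smooth g" "locally_bounded_control u"
    and "trajectory_on (control_affine f g) u a b X" "trajectory_on (control_affine f g) u a b Y"
    and "X a = Y a" "t \<in> {a..b}"
  shows "X t = Y t"
proof -
  obtain \<Lambda> where "\<forall>s\<in>{a..b}. norm (u s) \<le> \<Lambda>"
    using assms(3) unfolding locally_bounded_control_def bounded_iff by blast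
  then show ?thesis
    using trajectory_on_unique[OF assms(1,2) _ assms(4-7), of \<Lambda>] by auto
qed

section \<open>Gluing countably many pieces along a time partition\<close>

definition segment_index :: "(nat \<Rightarrow> real) \<Rightarrow> real \<Rightarrow> nat" where
  "segment_index S t = (LEAST k. t < S (Suc k))"

lemma segment_index_eq:
  assumes "strict_mono S" "S k \<le> t" "t < S (Suc k)"
  shows "segment_index S t = k"
  unfolding segment_index_def
proof (rule Least_equality)
  show "k \<le> j" if "t < S (Suc j)" for j
    using that assms strict_mono_less[OF assms(1), of k "Suc j"] by linarith
qed fact

lemma segment_index_ge:
  assumes "strict_mono S" "filterlim S at_top sequentially" "S k \<le> t"
  shows "k \<le> segment_index S t"
proof -
  obtain j where "t < S (Suc j)"
    using assms(2) by (metis eventually_sequentially filterlim_at_top_dense le_SucI order_refl)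
  then have "t < S (Suc (segment_index S t))" unfolding segment_index_def by (rule LeastI)
  then have "S k < S (Suc (segment_index S t))" using assms(3) by linarith
  then show ?thesis using strict_mono_less[OF assms(1)] by simp
qed

lemma segment_index_le: "t < S (Suc k) \<Longrightarrow> segment_index S t \<le> k"
  unfolding segment_index_def by (rule Least_le)

lemma time_partition_segment:
  assumes "time_partition S" "0 \<le> t"
  obtains k where "S k \<le> t" "t < S (Suc k)"
proof -
  obtain j where "t < S (Suc j)"
    using assms by (metis time_partition_def eventually_sequentially filterlim_at_top_dense le_SucI order_refl)
  then have less: "t < S (Suc (segment_index S t))" unfolding segment_index_def by (rule LeastI)
  moreover have "S (segment_index S t) \<le> t"
  proof (cases "segment_index S t")
    case 0
    then show ?thesis using assms by (simp add: time_partition_def)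
  next
    case (Suc m)
    then have "\<not> t < S (Suc m)" unfolding segment_index_def using not_less_Least[of m] by (metis lessI)
    then show ?thesis using Suc by simp
  qed
  ultimately show thesis using that by blast
qed

text \<open>Only finitely many segments meet a bounded interval, which gives boundedness;
  measurability holds because the segment index is a Borel function with countably many
  values.\<close>

lemma locally_bounded_control_glue:
  assumes u: "\<And>k. locally_bounded_control (u k)" and S: "filterlim S at_top sequentially"
  shows "locally_bounded_control (\<lambda>t. u (segment_index S t) t)"
proof -
  have "(\<lambda>t. u (segment_index S t) t) \<in> borel_measurable borel"
  proof (rule measurable_compose_countable)
    show "segment_index S \<in> measurable borel (count_space UNIV)"
      unfolding segment_index_def[abs_def] by measurable
  qed (use u in \<open>simp add: locally_bounded_control_def\<close>)
  moreover have "bounded ((\<lambda>t. u (segment_index S t) t) ` {a..b})" for a b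
  proof -
    obtain K where "b < S (Suc K)"
      using S by (metis eventually_sequentially filterlim_at_top_dense le_SucI order_refl)
    then have "segment_index S t \<le> K" if "t \<in> {a..b}" for t
      using that segment_index_le[of t S K] by auto
    then have "(\<lambda>t. u (segment_index S t) t) ` {a..b} \<subseteq> (\<Union>k\<le>K. u k ` {a..b})" by blast
    moreover have "bounded (\<Union>k\<le>K. u k ` {a..b})"
      using u by (auto simp: locally_bounded_control_def)
    ultimately show ?thesis using bounded_subset by blast
  qed
  ultimately show ?thesis by (simp add: locally_bounded_control_def)
qed

text \<open>At the right endpoint the index already points to the next segment: the states agree
  there by \<open>match\<close>, while the controls may differ at this single time.\<close>

lemma trajectory_on_glue:
  assumes S: "strict_mono S" and X: "trajectory_on F (u k) (S k) (S (Suc k)) (X k)"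
    and match: "X k (S (Suc k)) = X (Suc k) (S (Suc k))"
  shows "trajectory_on F (\<lambda>t. u (segment_index S t) t) (S k) (S (Suc k)) (\<lambda>t. X (segment_index S t) t)"
proof (rule trajectory_on_cong[OF X])
  have less: "S k < S (Suc k)" "S (Suc k) < S (Suc (Suc k))" using S by (auto simp: strict_mono_def)
  then show "S k \<le> S (Suc k)" by simp
  show "u (segment_index S s) s = u k s" if "s \<in> {S k..<S (Suc k)}" for s
    using segment_index_eq[OF S, of k s] that by simp
  show "X (segment_index S s) s = X k s" if "s \<in> {S k..S (Suc k)}" for s
  proof (cases "s = S (Suc k)")
    case True
    then show ?thesis using segment_index_eq[OF S, of "Suc k" s] less match by simp
  next
    case False
    then show ?thesis using segment_index_eq[OF S, of k s] that by simp
  qed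
qed

lemma trajectory_on_from_segments:
  assumes S: "time_partition S" and X: "\<And>k. trajectory_on F u (S k) (S (Suc k)) X" and "0 \<le> b"
  shows "trajectory_on F u 0 b X"
proof -
  have mono: "S k \<le> S (Suc k)" for k using S by (auto simp: time_partition_def strict_mono_def less_imp_le)
  have ge: "0 \<le> S n" for n
    using S by (metis time_partition_def strict_mono_less_eq le0)
  have "trajectory_on F u 0 (S n) X" for n
  proof (induction n)
    case 0
    then show ?case using S trajectory_on_singleton by (simp add: time_partition_def)
  next
    case (Suc n)
    then show ?case using trajectory_on_combine[OF _ X] mono ge by blast
  qed
  moreover obtain k where "b < S (Suc k)" using time_partition_segment[OF S \<open>0 \<le> b\<close>] by blast
  ultimately show ?thesis
    using trajectory_on_subinterval[of F u 0 "S (Suc k)" X 0 b] \<open>0 \<le> b\<close> by auto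
qed

text \<open>The Taylor expansion is valid only from \<open>x\<close> itself, since at nearby points
  the shorter words need not vanish. It is used for one small \<open>e\<close> to get a strict
  decrease from \<open>x\<close>; with \<open>e\<close> and the control frozen, continuous
  dependence carries that decrease over to a ball of initial states.\<close>

lemma local_descent:
  fixes f g :: "'a::euclidean_space \<Rightarrow> 'a" and V :: "'a \<Rightarrow> real"
  assumes f: "smooth f" and g: "smooth g" and V: "smooth V"
    and v: "steering_control f g x m (\<lambda>y. V y - V x) v" and wv: "words_vanish f g x m (\<lambda>y. V y - V x)"
    and U: "open U" "x \<in> U" and \<xi>: "0 < \<xi>"
  obtains e r d where "0 < e" "e \<le> \<xi>" "0 < r" "0 < d"
    "\<forall>a. \<exists>u. locally_bounded_control u \<and> (\<forall>y\<in>ball x r. \<exists>X. trajectory_on (control_affine f g) u a (a + e) X \<and>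
      X a = y \<and> (\<forall>s\<in>{a..a+e}. X s \<in> U) \<and> V (X (a + e)) \<le> V y - d)"
proof -
  have cv: "continuous_on {0..1} v" and neg: "leading_term f g (\<lambda>_. 1) v x m (\<lambda>y. V y - V x) 1 < 0"
    using v by (auto simp: steering_control_def)
  obtain R where R: "0 < R" "cball x R \<subseteq> U" using U open_contains_cball by blast
  define \<rho> where "\<rho> = R / 2"
  have \<rho>: "0 < \<rho>" "cball x (2 * \<rho>) \<subseteq> U" using R by (auto simp: \<rho>_def)
  let ?K = "cball x (2 * \<rho>)"
  obtain \<epsilon>0 where \<epsilon>0: "0 < \<epsilon>0" and ex: "\<And>\<epsilon> y0. 0 < \<epsilon> \<Longrightarrow> \<epsilon> \<le> \<epsilon>0 \<Longrightarrow> y0 \<in> cball x \<rho> \<Longrightarrow>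
      \<exists>y. y 0 = y0 \<and> scaled_solution f g v ?K \<epsilon> y"
    using scaled_solution_exists[OF f g cv \<rho>(1)] by blast
  obtain C where C: "0 \<le> C" "\<And>\<epsilon> y. 0 < \<epsilon> \<Longrightarrow> y 0 = x \<Longrightarrow> scaled_solution f g v ?K \<epsilon> y \<Longrightarrow>
      \<bar>(V (y 1) - V x) - \<epsilon> ^ m * leading_term f g (\<lambda>_. 1) v x m (\<lambda>y. V y - V x) 1\<bar> \<le> C * \<epsilon> ^ Suc m"
    using leading_term_approx[OF f g cv compact_cball smooth_diff[OF V smooth_const] wv]
    unfolding scaled_solution_def by (metis atLeastAtMost_iff order_refl zero_le_one)
  define l where "l = leading_term f g (\<lambda>_. 1) v x m (\<lambda>y. V y - V x) 1"
  \<comment> \<open>Makes \<open>C * e\<close> smaller than \<open>- l\<close>, so that the leading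
    term outweighs the remainder.\<close>
  define e where "e = min (min \<epsilon>0 \<xi>) (- l / (C + 1))"
  have l: "l < 0" using neg by (simp add: l_def)
  have e: "0 < e" "e \<le> \<xi>" "e \<le> \<epsilon>0" using \<epsilon>0 \<xi> l C(1) by (auto simp: e_def intro!: divide_neg_pos)
  have "C * e < (C + 1) * e" using e by simp
  also have "\<dots> \<le> (C + 1) * (- l / (C + 1))" using C(1) by (intro mult_left_mono) (auto simp: e_def)
  also have "\<dots> = - l" using C(1) by (simp add: add_nonneg_eq_0_iff)
  finally have Ce: "l + C * e < 0" by simp
  obtain Y where Y: "Y 0 = x" "scaled_solution f g v ?K e Y" using ex[of e x] e \<rho> by auto
  have "V (Y 1) - V x \<le> e ^ m * l + C * e ^ Suc m"
    using C(2)[OF e(1) Y] by (simp add: l_def)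
  also have "\<dots> = e ^ m * (l + C * e)" by (simp add: algebra_simps)
  also have "\<dots> < 0" using e(1) Ce by (simp add: mult_pos_neg)
  finally have drop: "V (Y 1) < V x" by simp
  \<comment> \<open>A quarter of the drop: the variation of \<open>V\<close> costs one quarter at
    the start and one at the end, and \<open>2 * \<eta>\<close> remains as the guaranteed
    decrease.\<close>
  define \<eta> where "\<eta> = (V x - V (Y 1)) / 4"
  have \<eta>: "0 < \<eta>" using drop by (simp add: \<eta>_def)
  have cV: "isCont V z" for z using smooth_continuous[OF V, of UNIV] by (auto simp: continuous_on_eq_continuous_at)
  obtain r1 where r1: "0 < r1" "\<And>y. dist y x < r1 \<Longrightarrow> dist (V y) (V x) < \<eta>"
    using cV[of x] \<eta> unfolding continuous_at_eps_delta dist_norm by blast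
  obtain r2 where r2: "0 < r2" "\<And>y. dist y (Y 1) < r2 \<Longrightarrow> dist (V y) (V (Y 1)) < \<eta>"
    using cV[of "Y 1"] \<eta> unfolding continuous_at_eps_delta dist_norm by blast
  obtain L where L: "0 < L" "\<And>y z t. scaled_solution f g v ?K e y \<Longrightarrow> scaled_solution f g v ?K e z \<Longrightarrow> t \<in> {0..1} \<Longrightarrow>
      norm (y t - z t) \<le> L * norm (y 0 - z 0)"
    using scaled_solution_dependence[OF f g cv compact_cball convex_cball less_imp_le[OF e(1)]] by metis
  define r where "r = min \<rho> (min r1 (r2 / L))"
  have r: "0 < r" using \<rho> r1 r2 L by (simp add: r_def)
  show thesis
  proof (rule that[OF e(1,2) r, of "2 * \<eta>"], goal_cases)
    case 2
    show ?case
    proof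
      fix a
      let ?u = "unscaled_control v a e"
      have "\<exists>X. trajectory_on (control_affine f g) ?u a (a + e) X \<and> X a = y \<and> (\<forall>s\<in>{a..a+e}. X s \<in> U) \<and> V (X (a + e)) \<le> V y - 2 * \<eta>"
        if y: "y \<in> ball x r" for y
      proof -
        have yr: "dist y x < \<rho>" "dist y x < r1" "dist y x < r2 / L" using y by (auto simp: r_def dist_commute)
        obtain z where z: "z 0 = y" "scaled_solution f g v ?K e z" using ex[of e y] e yr by (auto simp: dist_commute)
        have "norm (z 1 - Y 1) \<le> L * norm (y - x)" using L(2)[OF z(2) Y(2), of 1] z Y by simp
        also have "\<dots> < r2" using yr(3) L by (simp add: dist_norm field_simps)
        finally have "dist (V (z 1)) (V (Y 1)) < \<eta>" using r2 by (simp add: dist_norm)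
        moreover have "dist (V y) (V x) < \<eta>" using r1 yr by simp
        ultimately have "V (z 1) \<le> V y - 2 * \<eta>" unfolding dist_real_def \<eta>_def by argo
        moreover have "z ((s - a) / e) \<in> U" if "s \<in> {a..a+e}" for s
        proof -
          have "(s - a) / e \<in> {0..1}" using e that by (auto simp: field_simps)
          then show ?thesis using z \<rho> unfolding scaled_solution_def by blast
        qed
        ultimately show ?thesis
          using e z scaled_solution_trajectory[OF f g cv e(1) z(2), of a]
          by (intro exI[of _ "\<lambda>s. z ((s - a) / e)"]) simp
      qed
      then show "\<exists>u. locally_bounded_control u \<and> (\<forall>y\<in>ball x r. \<exists>X. trajectory_on (control_affine f g) u a (a + e) X \<and>
          X a = y \<and> (\<forall>s\<in>{a..a+e}. X s \<in> U) \<and> V (X (a + e)) \<le> V y - 2 * \<eta>)"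
        using locally_bounded_control_continuous[OF continuous_on_unscaled_control[OF cv e(1)]] by blast
    qed
  qed (use \<eta> in simp)
qed

text \<open>An equilibrium is not reached in finite time: if \<open>y t0 = 0\<close>, the curve run
  backwards from \<open>t0\<close> solves the system with drift \<open>- f\<close> from zero, hence
  agrees with the zero solution, against \<open>y 0 \<noteq> 0\<close>.\<close>

lemma drift_solution_nonzero:
  fixes f g :: "'a::euclidean_space \<Rightarrow> 'a"
  assumes f: "smooth f" and g: "smooth g" and f0: "f 0 = 0" and K: "compact K" "convex K" "0 \<in> K" and "0 < \<epsilon>"
    and y: "scaled_solution f g (\<lambda>_. 0) K \<epsilon> y" and "y 0 \<noteq> 0" and t0: "t0 \<in> {0..1}"
  shows "y t0 \<noteq> 0"
proof
  assume "y t0 = 0"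
  \<comment> \<open>Runs from \<open>y t0\<close> back to \<open>y 0\<close> over the unit interval,
    so that the time scale becomes \<open>\<epsilon> * t0\<close>.\<close>
  define z where "z t = y (t0 - t * t0)" for t
  have m: "t0 - t * t0 \<in> {0..1}" if "t \<in> {0..1}" for t
  proof -
    have "t0 - t * t0 = (1 - t) * t0" by (simp add: algebra_simps)
    then show ?thesis using that t0 by (simp add: mult_le_one)
  qed
  have z: "scaled_solution (\<lambda>x. - f x) g (\<lambda>_. 0) K (\<epsilon> * t0) z"
    unfolding scaled_solution_def
  proof (intro ballI conjI)
    fix t :: real assume t: "t \<in> {0..1}"
    show "z t \<in> K" using y m[OF t] by (auto simp: scaled_solution_def z_def)
    have "((\<lambda>t. t0 - t * t0) has_vector_derivative - t0) (at t within {0..1})"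
      unfolding has_real_derivative_iff_has_vector_derivative[symmetric] by (auto intro!: derivative_eq_intros)
    moreover have "(y has_vector_derivative \<epsilon> *\<^sub>R f (z t)) (at (t0 - t * t0) within (\<lambda>t. t0 - t * t0) ` {0..1})"
      by (rule has_vector_derivative_within_subset[of _ _ _ "{0..1}"])
        (use y m m[OF t] in \<open>auto simp: scaled_solution_def z_def simp del: atLeastAtMost_iff\<close>)
    ultimately have "(y \<circ> (\<lambda>t. t0 - t * t0) has_vector_derivative (- t0) *\<^sub>R (\<epsilon> *\<^sub>R f (z t))) (at t within {0..1})"
      by (rule vector_diff_chain_within)
    then show "(z has_vector_derivative (\<epsilon> * t0) *\<^sub>R (- f (z t) + 0 *\<^sub>R g (z t))) (at t within {0..1})"
      by (simp add: z_def[abs_def] o_def mult.commute)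
  qed
  have "smooth (\<lambda>x. - f x)" using smooth_diff[OF smooth_const f, of 0] by simp
  from scaled_solution_dependence[OF this g continuous_on_const K(1,2), of "\<epsilon> * t0" 0]
  obtain L where L: "\<And>y z t. scaled_solution (\<lambda>x. - f x) g (\<lambda>_. 0) K (\<epsilon> * t0) y \<Longrightarrow>
      scaled_solution (\<lambda>x. - f x) g (\<lambda>_. 0) K (\<epsilon> * t0) z \<Longrightarrow> t \<in> {0..1} \<Longrightarrow> norm (y t - z t) \<le> L * norm (y 0 - z 0)"
    using t0 \<open>0 < \<epsilon>\<close> by (metis atLeastAtMost_iff less_imp_le mult_nonneg_nonneg)
  have "scaled_solution (\<lambda>x. - f x) g (\<lambda>_. 0) K (\<epsilon> * t0) (\<lambda>_. 0)"
    using f0 K by (simp add: scaled_solution_def)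
  from L[OF z this, of 1] show False using \<open>y t0 = 0\<close> \<open>y 0 \<noteq> 0\<close> by (simp add: z_def)
qed

text \<open>Unlike descent, this is available around the origin too, with one duration for a whole
  neighbourhood. Keeping away from zero is what leaves room for later descent steps.\<close>

lemma local_drift:
  fixes f g :: "'a::euclidean_space \<Rightarrow> 'a"
  assumes f: "smooth f" and g: "smooth g" and f0: "f 0 = 0" and U: "open U" "x \<in> U"
  obtains e r where "0 < e" "0 < r"
    "\<forall>a. \<forall>y\<in>ball x r. y \<noteq> 0 \<longrightarrow> (\<exists>X. trajectory_on (control_affine f g) (\<lambda>_. 0) a (a + e) X \<and>
      X a = y \<and> (\<forall>s\<in>{a..a+e}. X s \<in> U \<and> X s \<noteq> 0))"
proof -
  obtain R where R: "0 < R" "cball x R \<subseteq> U" using U open_contains_cball by blast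
  define \<rho> where "\<rho> = R / 2"
  have \<rho>: "0 < \<rho>" "cball x (2 * \<rho>) \<subseteq> U" using R by (auto simp: \<rho>_def)
  let ?K = "cball x (2 * \<rho>)"
  obtain e where e: "0 < e" and ex: "\<And>y0. y0 \<in> cball x \<rho> \<Longrightarrow> \<exists>y. y 0 = y0 \<and> scaled_solution f g (\<lambda>_. 0) ?K e y"
    using scaled_solution_exists[OF f g continuous_on_const \<rho>(1), of x 0] by (metis order_refl)
  show thesis
  proof (rule that[OF e \<rho>(1)], intro allI ballI impI)
    fix a y assume y: "y \<in> ball x \<rho>" "y \<noteq> 0"
    obtain z where z: "z 0 = y" "scaled_solution f g (\<lambda>_. 0) ?K e z" using ex[of y] y by auto
    \<comment> \<open>The comparison with the zero solution takes place in a convex compact set that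
      contains the origin, hence the larger ball.\<close>
    have "cball x (2 * \<rho>) \<subseteq> cball 0 (norm x + 2 * \<rho>)" by (simp add: cball_subset_cball_iff)
    then have z': "scaled_solution f g (\<lambda>_. 0) (cball 0 (norm x + 2 * \<rho>)) e z"
      using z(2) unfolding scaled_solution_def by blast
    have 0: "0 \<in> cball 0 (norm x + 2 * \<rho>)" using \<rho> by (simp add: less_imp_le)
    have "z ((s - a) / e) \<in> U \<and> z ((s - a) / e) \<noteq> 0" if "s \<in> {a..a+e}" for s
    proof -
      have s: "(s - a) / e \<in> {0..1}" using e that by (auto simp: field_simps)
      then show ?thesis
        using z \<rho> y drift_solution_nonzero[OF f g f0 compact_cball convex_cball 0 e z' _ s]
        unfolding scaled_solution_def by auto
    qed
    moreover have "unscaled_control (\<lambda>_. 0) a e = (\<lambda>_. 0)" by (simp add: unscaled_control_def fun_eq_iff)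
    ultimately show "\<exists>X. trajectory_on (control_affine f g) (\<lambda>_. 0) a (a + e) X \<and>
        X a = y \<and> (\<forall>s\<in>{a..a+e}. X s \<in> U \<and> X s \<noteq> 0)"
      using e z scaled_solution_trajectory[OF f g continuous_on_const e z(2), of a]
      by (intro exI[of _ "\<lambda>s. z ((s - a) / e)"]) simp
  qed
qed

section \<open>Plans\<close>

text \<open>The interface between the algebraic conditions and the stabilization argument: what
  remains of the former is one steering control at each nonzero point, with \<open>m\<close> varying
  arbitrarily from point to point.\<close>

locale locally_steerable_system =
  fixes f g :: "'a::euclidean_space \<Rightarrow> 'a" and V :: "'a \<Rightarrow> real"
  assumes smooth_f: "smooth f" and smooth_g: "smooth g" and f_0: "f 0 = 0"
    and smooth_V: "smooth V" and pos_def: "positive_definite V" and proper: "proper_fun V"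
    and local_steering: "\<And>x. x \<noteq> 0 \<Longrightarrow> \<exists>m v. steering_control f g x m (\<lambda>y. V y - V x) v \<and>
      words_vanish f g x m (\<lambda>y. V y - V x)"
begin

abbreviation F :: "'a \<Rightarrow> real \<Rightarrow> 'a" where "F \<equiv> control_affine f g"

lemma V_0 [simp]: "V 0 = 0" and V_pos_iff: "0 < V x \<longleftrightarrow> x \<noteq> 0"
  using pos_def by (auto simp: positive_definite_def)

lemma V_nonneg: "0 \<le> V x"
  using V_pos_iff[of x] by (cases "x = 0") auto

lemma continuous_V: "continuous_on S V"
  by (rule smooth_continuous[OF smooth_V])

lemma open_punctured_sublevel: "open {y. 0 < V y \<and> V y < B}"
  by (intro open_Collect_conj open_Collect_less continuous_intros continuous_V)

lemma open_sublevel: "open {y. V y < B}"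
  by (intro open_Collect_less continuous_intros continuous_V)

lemma compact_annulus: "compact {y. c \<le> V y \<and> V y \<le> C}"
proof -
  have "compact ({y. V y \<le> C} \<inter> {y. c \<le> V y})"
    using proper by (intro compact_Int_closed closed_Collect_le continuous_intros continuous_V)
      (auto simp: proper_fun_def)
  moreover have "{y. V y \<le> C} \<inter> {y. c \<le> V y} = {y. c \<le> V y \<and> V y \<le> C}" by auto
  ultimately show ?thesis by simp
qed

text \<open>Positivity of \<open>V\<close> along the way keeps the origin away, so that steering can
  be continued from the endpoint.\<close>

definition steer :: "real \<Rightarrow> real \<Rightarrow> real \<Rightarrow> 'a \<Rightarrow> 'a \<Rightarrow> bool" where
  "steer a b B y z \<longleftrightarrow> (\<exists>u X. locally_bounded_control u \<and> trajectory_on F u a b X \<and> X a = y \<and> X b = z \<and>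
    (\<forall>s\<in>{a..b}. 0 < V (X s) \<and> V (X s) \<le> B))"

lemma steer_refl: "0 < V y \<Longrightarrow> V y \<le> B \<Longrightarrow> steer a a B y y"
  unfolding steer_def
  by (intro exI[of _ "\<lambda>_. 0"] exI[of _ "\<lambda>_. y"]) (auto simp: locally_bounded_control_zero trajectory_on_singleton)

lemma steer_mono: "steer a b B y z \<Longrightarrow> B \<le> B' \<Longrightarrow> steer a b B' y z"
  unfolding steer_def by (elim exE, rule exI, rule exI) (auto intro: order_trans)

lemma steer_endpoint: "steer a b B y z \<Longrightarrow> a \<le> b \<Longrightarrow> 0 < V z \<and> V z \<le> B"
  unfolding steer_def by auto

lemma steer_trans:
  assumes "steer a b B y z" "steer b c B z w" "a \<le> b" "b \<le> c"
  shows "steer a c B y w"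
proof -
  obtain u1 X1 where 1: "locally_bounded_control u1" "trajectory_on F u1 a b X1" "X1 a = y" "X1 b = z"
    "\<And>s. s \<in> {a..b} \<Longrightarrow> 0 < V (X1 s) \<and> V (X1 s) \<le> B" using assms(1) by (auto simp: steer_def)
  obtain u2 X2 where 2: "locally_bounded_control u2" "trajectory_on F u2 b c X2" "X2 b = z" "X2 c = w"
    "\<And>s. s \<in> {b..c} \<Longrightarrow> 0 < V (X2 s) \<and> V (X2 s) \<le> B" using assms(2) by (auto simp: steer_def)
  define u where "u s = (if s < b then u1 s else u2 s)" for s
  define X where "X s = (if s < b then X1 s else X2 s)" for s
  have X1: "X s = X1 s" if "s \<le> b" for s using that 1(4) 2(3) by (cases "s = b") (auto simp: X_def)
  have "trajectory_on F u a b X"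
    by (rule trajectory_on_cong[OF 1(2) assms(3)]) (auto simp: X1 u_def)
  moreover have "trajectory_on F u b c X"
    by (rule trajectory_on_cong[OF 2(2) assms(4)]) (auto simp: X_def u_def)
  ultimately have "trajectory_on F u a c X" using trajectory_on_combine assms by blast
  moreover have "locally_bounded_control u" unfolding u_def[abs_def] using locally_bounded_control_if 1 2 by blast
  moreover have "0 < V (X s) \<and> V (X s) \<le> B" if "s \<in> {a..c}" for s
    using 1(5)[of s] 2(5)[of s] that by (auto simp: X_def)
  ultimately show ?thesis
    unfolding steer_def using X1[of a] 1(3) 2(4) assms(3,4) by (intro exI[of _ u] exI[of _ X]) (auto simp: X_def)
qed

lemma steer_truncate:
  assumes "steer a b B y z" "a \<le> b'" "b' \<le> b"
  obtains z' where "steer a b' B y z'"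
proof -
  obtain u X where "locally_bounded_control u" "trajectory_on F u a b X" "X a = y"
    "\<And>s. s \<in> {a..b} \<Longrightarrow> 0 < V (X s) \<and> V (X s) \<le> B" using assms(1) by (auto simp: steer_def)
  then have "steer a b' B y (X b')"
    unfolding steer_def using assms trajectory_on_subinterval[of F u a b X a b']
    by (intro exI[of _ u] exI[of _ X]) auto
  then show thesis by (rule that)
qed

text \<open>A finite subcover of the compact annulus by balls of local descent. Durations differ
  from ball to ball, so there is a common lower bound \<open>e0\<close> instead of one duration; the
  upper bound 1 serves to count time.\<close>

lemma annulus_step:
  assumes "0 < c" "C < B"
  obtains e0 d where "0 < e0" "0 < d"
    "\<forall>a y. c \<le> V y \<and> V y \<le> C \<longrightarrow> (\<exists>e z. e0 \<le> e \<and> e \<le> 1 \<and> steer a (a + e) B y z \<and> V z \<le> V y - d)"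
proof -
  let ?A = "{y. c \<le> V y \<and> V y \<le> C}"
  have "\<exists>e r d. 0 < e \<and> e \<le> 1 \<and> 0 < r \<and> 0 < d \<and>
      (\<forall>a. \<forall>y\<in>ball x r. \<exists>z. steer a (a + e) B y z \<and> V z \<le> V y - d)" if x: "x \<in> ?A" for x
  proof -
    have "x \<noteq> 0" using x assms V_pos_iff[of x] by auto
    then obtain m v where mv: "steering_control f g x m (\<lambda>y. V y - V x) v" "words_vanish f g x m (\<lambda>y. V y - V x)"
      using local_steering by blast
    have U: "x \<in> {y. 0 < V y \<and> V y < B}" using x assms by auto
    from local_descent[OF smooth_f smooth_g smooth_V mv open_punctured_sublevel U zero_less_one]
    obtain e r d where e: "0 < e" "e \<le> 1" "0 < r" "0 < d" and
      *: "\<forall>a. \<exists>u. locally_bounded_control u \<and> (\<forall>y\<in>ball x r. \<exists>X. trajectory_on F u a (a + e) X \<and>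
        X a = y \<and> (\<forall>s\<in>{a..a+e}. X s \<in> {y. 0 < V y \<and> V y < B}) \<and> V (X (a + e)) \<le> V y - d)" .
    have "\<exists>z. steer a (a + e) B y z \<and> V z \<le> V y - d" if y: "y \<in> ball x r" for a y
    proof -
      obtain u X where "locally_bounded_control u" "trajectory_on F u a (a + e) X"
        "X a = y" "\<forall>s\<in>{a..a+e}. X s \<in> {y. 0 < V y \<and> V y < B}" "V (X (a + e)) \<le> V y - d"
        using * y by blast
      then show ?thesis
        unfolding steer_def by (intro exI[of _ "X (a + e)"] conjI exI[of _ u] exI[of _ X]) (auto intro: less_imp_le)
    qed
    then show ?thesis using e by blast
  qed
  then have "\<forall>x\<in>?A. \<exists>e r d. 0 < e \<and> e \<le> 1 \<and> 0 < r \<and> 0 < d \<and>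
      (\<forall>a. \<forall>y\<in>ball x r. \<exists>z. steer a (a + e) B y z \<and> V z \<le> V y - d)" by blast
  then obtain e r d where erd: "\<And>x. x \<in> ?A \<Longrightarrow> 0 < e x \<and> e x \<le> 1 \<and> 0 < r x \<and> 0 < d x \<and>
      (\<forall>a. \<forall>y\<in>ball x (r x). \<exists>z. steer a (a + e x) B y z \<and> V z \<le> V y - d x)"
    unfolding bchoice_iff by blast
  have "?A \<subseteq> (\<Union>x\<in>?A. ball x (r x))" using erd by force
  from compactE_image[where f = "\<lambda>x. ball x (r x)", OF compact_annulus open_ball this]
  obtain D where D: "D \<subseteq> ?A" "finite D" "?A \<subseteq> (\<Union>x\<in>D. ball x (r x))" .
  \<comment> \<open>The inserted 1 keeps the minimum meaningful when the annulus, and with it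
    \<open>D\<close>, is empty.\<close>
  define e0 where "e0 = Min (insert 1 (e ` D))"
  define d0 where "d0 = Min (insert 1 (d ` D))"
  show thesis
  proof (rule that[of e0 d0]; (intro allI impI)?)
    show "0 < e0" "0 < d0" unfolding e0_def d0_def using D erd by (auto simp: Min_gr_iff)
    fix a y assume "c \<le> V y \<and> V y \<le> C"
    then obtain x where x: "x \<in> D" "y \<in> ball x (r x)" using D by blast
    have "e0 \<le> e x" "d0 \<le> d x" unfolding e0_def d0_def using D x by auto
    moreover obtain z where "steer a (a + e x) B y z" "V z \<le> V y - d x" using erd x D by blast
    ultimately show "\<exists>e z. e0 \<le> e \<and> e \<le> 1 \<and> steer a (a + e) B y z \<and> V z \<le> V y - d0"
      using erd x D by (intro exI[of _ "e x"] exI[of _ z]) auto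
  qed
qed

text \<open>The punctured sublevel set is not compact, so the cover is taken of the full one, where
  the drift is available at the origin as well. Truncation then brings all pieces to a common
  duration.\<close>

lemma idle_step:
  assumes "0 < c"
  obtains e0 where "0 < e0" "\<forall>a y. 0 < V y \<and> V y \<le> c / 2 \<longrightarrow> (\<exists>z. steer a (a + e0) c y z)"
proof -
  let ?A = "{y. 0 \<le> V y \<and> V y \<le> c / 2}"
  have "\<exists>e r. 0 < e \<and> 0 < r \<and> (\<forall>a. \<forall>y\<in>ball x r. y \<noteq> 0 \<longrightarrow> (\<exists>z. steer a (a + e) c y z))" if x: "x \<in> ?A" for x
  proof -
    have U: "x \<in> {y. V y < c}" using x assms by auto
    from local_drift[OF smooth_f smooth_g f_0 open_sublevel U]
    obtain e r where e: "0 < e" "0 < r" and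
      *: "\<forall>a. \<forall>y\<in>ball x r. y \<noteq> 0 \<longrightarrow> (\<exists>X. trajectory_on F (\<lambda>_. 0) a (a + e) X \<and>
        X a = y \<and> (\<forall>s\<in>{a..a+e}. X s \<in> {y. V y < c} \<and> X s \<noteq> 0))" .
    have "\<exists>z. steer a (a + e) c y z" if y: "y \<in> ball x r" "y \<noteq> 0" for a y
    proof -
      obtain X where "trajectory_on F (\<lambda>_. 0) a (a + e) X" "X a = y"
        "\<forall>s\<in>{a..a+e}. X s \<in> {y. V y < c} \<and> X s \<noteq> 0" using * y by blast
      then show ?thesis
        unfolding steer_def
        by (intro exI[of _ "X (a + e)"] exI[of _ "\<lambda>_. 0"] exI[of _ X])
          (auto simp: V_pos_iff locally_bounded_control_zero intro: less_imp_le)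
    qed
    then show ?thesis using e by blast
  qed
  then have "\<forall>x\<in>?A. \<exists>e r. 0 < e \<and> 0 < r \<and> (\<forall>a. \<forall>y\<in>ball x r. y \<noteq> 0 \<longrightarrow> (\<exists>z. steer a (a + e) c y z))" by blast
  then obtain e r where er: "\<And>x. x \<in> ?A \<Longrightarrow> 0 < e x \<and> 0 < r x \<and>
      (\<forall>a. \<forall>y\<in>ball x (r x). y \<noteq> 0 \<longrightarrow> (\<exists>z. steer a (a + e x) c y z))"
    unfolding bchoice_iff by blast
  have "?A \<subseteq> (\<Union>x\<in>?A. ball x (r x))" using er by force
  from compactE_image[where f = "\<lambda>x. ball x (r x)", OF compact_annulus open_ball this]
  obtain D where D: "D \<subseteq> ?A" "finite D" "?A \<subseteq> (\<Union>x\<in>D. ball x (r x))" .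
  define e0 where "e0 = Min (insert 1 (e ` D))"
  show thesis
  proof (rule that[of e0]; (intro allI impI)?)
    show "0 < e0" unfolding e0_def using D er by (auto simp: Min_gr_iff)
    fix a y assume y: "0 < V y \<and> V y \<le> c / 2"
    then have "y \<in> ?A" by simp
    then obtain x where x: "x \<in> D" "y \<in> ball x (r x)" using D by blast
    have "e0 \<le> e x" unfolding e0_def using D x by auto
    moreover obtain z where "steer a (a + e x) c y z" using er x D y V_pos_iff by blast
    ultimately show "\<exists>z. steer a (a + e0) c y z"
      using steer_truncate[of a "a + e x" c y z "a + e0"] \<open>0 < e0\<close> by (metis add_left_mono le_add_same_cancel1 less_imp_le)
  qed
qed

text \<open>Each step lowers \<open>V\<close> by at least \<open>d\<close> and takes at most unit
  time, so the number of steps that exhausts \<open>C - c\<close> also bounds the total time,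
  whatever the initial state.\<close>

lemma descend:
  assumes "0 < c" "c \<le> C"
  obtains n :: nat where
    "\<And>a y. 0 < V y \<Longrightarrow> V y \<le> C \<Longrightarrow> \<exists>h z. 0 \<le> h \<and> h \<le> real n \<and> steer a (a + h) (2 * C) y z \<and> V z \<le> c"
proof -
  have "C < 2 * C" using assms by simp
  from annulus_step[OF assms(1) this] obtain e0 d where ed: "0 < e0" "0 < d"
    "\<forall>a y. c \<le> V y \<and> V y \<le> C \<longrightarrow> (\<exists>e z. e0 \<le> e \<and> e \<le> 1 \<and> steer a (a + e) (2 * C) y z \<and> V z \<le> V y - d)" .
  have main: "\<exists>h z. 0 \<le> h \<and> h \<le> real k \<and> steer a (a + h) (2 * C) y z \<and> V z \<le> c"
    if "0 < V y" "V y \<le> C" "V y \<le> c + real k * d" for k a y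
    using that
  proof (induction k arbitrary: a y)
    case 0
    then have "steer a (a + 0) (2 * C) y y" using assms by (simp add: steer_refl)
    then show ?case using 0 by (intro exI[of _ 0] exI[of _ y]) auto
  next
    case (Suc k)
    show ?case
    proof (cases "V y \<le> c")
      case True
      have "steer a (a + 0) (2 * C) y y" using Suc.prems by (simp add: steer_refl)
      then show ?thesis using True by (intro exI[of _ 0] exI[of _ y]) auto
    next
      case False
      then obtain e z where e: "e0 \<le> e" "e \<le> 1" "steer a (a + e) (2 * C) y z" "V z \<le> V y - d"
        using ed(3) Suc.prems by (meson linear)
      have "0 < V z" using steer_endpoint[OF e(3)] e(1) ed(1) by simp
      moreover have "V z \<le> C" "V z \<le> c + real k * d" using e(4) Suc.prems ed(2) by (auto simp: algebra_simps)
      ultimately obtain h w where h: "0 \<le> h" "h \<le> real k" "steer (a + e) (a + e + h) (2 * C) z w" "V w \<le> c"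
        using Suc.IH[of z "a + e"] by blast
      have "steer a (a + (e + h)) (2 * C) y w"
        using steer_trans[OF e(3) h(3)] e(1) ed(1) h(1) by (simp add: add.assoc)
      then show ?thesis using h e ed by (intro exI[of _ "e + h"] exI[of _ w]) auto
    qed
  qed
  obtain n :: nat where "(C - c) / d \<le> real n" using real_arch_simple by blast
  then have "C \<le> c + real n * d" using ed(2) by (simp add: field_simps)
  then show thesis using main that by (meson order_trans)
qed

text \<open>Idling below half of the level bounds the step lengths from below, which excludes an
  accumulation of ever shorter descent steps.\<close>

lemma hold:
  assumes "0 < V y" "V y \<le> c" "0 \<le> H"
  obtains z where "steer a (a + H) (2 * c) y z"
proof -
  have c: "0 < c" "0 < c / 2" "c < 2 * c" using assms by auto
  from annulus_step[OF c(2,3)] obtain e1 d where e1: "0 < e1" "0 < d"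
    "\<forall>a y. c / 2 \<le> V y \<and> V y \<le> c \<longrightarrow> (\<exists>e z. e1 \<le> e \<and> e \<le> 1 \<and> steer a (a + e) (2 * c) y z \<and> V z \<le> V y - d)" .
  from idle_step[OF c(1)]
  obtain e2 where e2: "0 < e2" "\<forall>a y. 0 < V y \<and> V y \<le> c / 2 \<longrightarrow> (\<exists>z. steer a (a + e2) c y z)" .
  define e0 where "e0 = min e1 e2"
  have e0: "0 < e0" "e0 \<le> e1" "e0 \<le> e2" using e1 e2 by (auto simp: e0_def)
  have step: "\<exists>h z. e0 \<le> h \<and> steer a (a + h) (2 * c) y z \<and> V z \<le> c" if y: "0 < V y" "V y \<le> c" for a y
  proof (cases "V y \<le> c / 2")
    case True
    then obtain z where z: "steer a (a + e2) c y z" using e2 y by blast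
    moreover have "steer a (a + e2) (2 * c) y z" using steer_mono[OF z] c by simp
    ultimately show ?thesis using steer_endpoint[OF z] e0 e2 by (intro exI[of _ e2] exI[of _ z]) auto
  next
    case False
    then obtain e z where "e1 \<le> e" "steer a (a + e) (2 * c) y z" "V z \<le> V y - d" using e1(3) y by (meson linear)
    then show ?thesis using y e0 e1 by (intro exI[of _ e] exI[of _ z]) auto
  qed
  have long: "\<exists>h z. real k * e0 \<le> h \<and> steer a (a + h) (2 * c) y z \<and> V z \<le> c" for k
  proof (induction k)
    case 0
    have "steer a (a + 0) (2 * c) y y" using assms c by (simp add: steer_refl)
    then show ?case using assms by (intro exI[of _ 0] exI[of _ y]) auto
  next
    case (Suc k)
    then obtain h z where h: "real k * e0 \<le> h" "steer a (a + h) (2 * c) y z" "V z \<le> c" by blast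
    have h0: "0 \<le> h" using h(1) e0 by (meson less_imp_le mult_nonneg_nonneg of_nat_0_le_iff order_trans)
    then have "0 < V z" using steer_endpoint[OF h(2)] by simp
    then obtain h' w where h': "e0 \<le> h'" "steer (a + h) (a + h + h') (2 * c) z w" "V w \<le> c" using step h(3) by blast
    have "steer a (a + (h + h')) (2 * c) y w"
      using steer_trans[OF h(2) h'(2)] h0 h'(1) e0 by (simp add: add.assoc)
    then show ?case using h h' by (intro exI[of _ "h + h'"] exI[of _ w]) (auto simp: algebra_simps)
  qed
  obtain k :: nat where "H / e0 \<le> real k" using real_arch_simple by blast
  then have "H \<le> real k * e0" using e0 by (simp add: field_simps)
  moreover obtain h z where "real k * e0 \<le> h" "steer a (a + h) (2 * c) y z" using long by blast
  ultimately show thesis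
    using steer_truncate[of a "a + h" "2 * c" y z "a + H"] assms(3) that by auto
qed

text \<open>Descent to \<open>C / 4\<close> takes a time that depends on the state. The rest of the
  stage is spent holding, which may double the level and so stays below \<open>C / 2\<close>; all
  states of level at most \<open>C\<close> thus share one duration.\<close>

lemma stage:
  assumes "0 < C"
  shows "\<exists>n::nat. 0 < n \<and> (\<forall>a y. 0 < V y \<and> V y \<le> C \<longrightarrow> (\<exists>z. steer a (a + real n) (2 * C) y z \<and> V z \<le> C / 2))"
proof -
  obtain n :: nat where n: "\<And>a y. 0 < V y \<Longrightarrow> V y \<le> C \<Longrightarrow>
      \<exists>h z. 0 \<le> h \<and> h \<le> real n \<and> steer a (a + h) (2 * C) y z \<and> V z \<le> C / 4"
    using descend[of "C / 4" C] assms by auto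
  have "\<exists>z. steer a (a + real (Suc n)) (2 * C) y z \<and> V z \<le> C / 2" if y: "0 < V y" "V y \<le> C" for a y
  proof -
    obtain h z where h: "0 \<le> h" "h \<le> real n" "steer a (a + h) (2 * C) y z" "V z \<le> C / 4" using n y by blast
    have "0 < V z" using steer_endpoint[OF h(3)] h(1) by simp
    moreover have "0 \<le> real (Suc n) - h" using h by simp
    ultimately obtain w where w: "steer (a + h) (a + h + (real (Suc n) - h)) (2 * (C / 4)) z w"
      using hold[OF _ h(4)] by blast
    then have "steer (a + h) (a + real (Suc n)) (2 * C) z w"
      using steer_mono[OF w, of "2 * C"] assms by (simp add: algebra_simps)
    then have "steer a (a + real (Suc n)) (2 * C) y w"
      using steer_trans[OF h(3)] h by simp
    moreover have "V w \<le> C / 2" using steer_endpoint[OF w] h by simp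
    ultimately show ?thesis by blast
  qed
  then show ?thesis by blast
qed

text \<open>One duration per dyadic level, chosen once and for all and independent of the state and
  of the start time; the clock of a plan is then fixed by its index.\<close>

definition stage_time :: "int \<Rightarrow> nat" where
  "stage_time p = (SOME n. 0 < n \<and> (\<forall>a y. 0 < V y \<and> V y \<le> 2 powi p \<longrightarrow>
    (\<exists>z. steer a (a + real n) (2 * 2 powi p) y z \<and> V z \<le> 2 powi p / 2)))"

lemma stage_time:
  shows "0 < stage_time p"
    and "0 < V y \<Longrightarrow> V y \<le> 2 powi p \<Longrightarrow> \<exists>z. steer a (a + real (stage_time p)) (2 * 2 powi p) y z \<and> V z \<le> 2 powi p / 2"
  using someI_ex[OF stage[of "2 powi p"]] unfolding stage_time_def[symmetric] by auto

definition schedule :: "int \<Rightarrow> nat \<Rightarrow> real" where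
  "schedule p k = (\<Sum>j<k. real (stage_time (p - int j)))"

lemma schedule_Suc: "schedule p (Suc k) = schedule p k + real (stage_time (p - int k))"
  by (simp add: schedule_def)

lemma time_partition_schedule: "time_partition (schedule p)"
proof -
  have "real k \<le> schedule p k" for k
  proof (induction k)
    case (Suc k)
    then show ?case using stage_time(1)[of "p - int k"] by (simp add: schedule_Suc)
  qed (simp add: schedule_def)
  then have "filterlim (schedule p) at_top sequentially"
    by (intro filterlim_at_top_mono[OF filterlim_real_sequentially]) (auto intro: always_eventually)
  moreover have "strict_mono (schedule p)"
    using stage_time(1) by (intro strict_monoI_Suc) (simp add: schedule_Suc)
  ultimately show ?thesis by (simp add: time_partition_def schedule_def)
qed

text \<open>During stage \<open>k\<close> the level is \<open>2 powi (p - int k)\<close>, and the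
  factor 2 is the overshoot permitted within a stage.\<close>

definition envelope :: "int \<Rightarrow> real \<Rightarrow> real" where
  "envelope p t = 2 * 2 powi (p - int (segment_index (schedule p) t))"

lemma envelope_le: "envelope p t \<le> 2 * 2 powi p"
  unfolding envelope_def by (simp add: power_int_increasing)

lemma envelope_tendsto: "(envelope p \<longlongrightarrow> 0) at_top"
proof (rule tendstoI)
  fix e :: real assume e: "0 < e"
  obtain k where k: "2 * 2 powi p / e < (2::real) ^ k" using real_arch_pow[of 2] by auto
  have "envelope p t < e" if t: "schedule p k \<le> t" for t
  proof -
    have "k \<le> segment_index (schedule p) t"
      using segment_index_ge[where S = "schedule p"] t time_partition_schedule[of p] by (simp add: time_partition_def)
    then have "envelope p t \<le> 2 * 2 powi (p - int k)"
      unfolding envelope_def by (simp add: power_int_increasing)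
    also have "\<dots> = 2 * 2 powi p / 2 ^ k" by (simp add: power_int_diff)
    also have "\<dots> < e" using k e by (simp add: field_simps)
    finally show ?thesis .
  qed
  moreover have "0 \<le> envelope p t" for t by (simp add: envelope_def)
  ultimately show "\<forall>\<^sub>F t in at_top. dist (envelope p t) 0 < e"
    unfolding eventually_at_top_linorder by auto
qed

text \<open>The envelope is read at absolute times, not at times elapsed since \<open>a\<close>.
  Cutting off an initial piece therefore leaves a plan with the same \<open>p\<close>.\<close>

definition plan :: "real \<Rightarrow> int \<Rightarrow> (real \<Rightarrow> real) \<Rightarrow> (real \<Rightarrow> 'a) \<Rightarrow> bool" where
  "plan a p u X \<longleftrightarrow> locally_bounded_control u \<and> (\<forall>b\<ge>a. trajectory_on F u a b X) \<and>
    (\<forall>s\<ge>a. 0 < V (X s) \<and> V (X s) \<le> envelope p s)"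

lemma plan_restrict: "plan a p u X \<Longrightarrow> a \<le> b \<Longrightarrow> plan b p u X"
  unfolding plan_def by (meson order_refl order_trans trajectory_on_subinterval)

text \<open>The endpoints of the stages are found by dependent choice, with the level
  \<open>2 powi (p - int k)\<close> at the start of stage \<open>k\<close> as invariant; controls
  and curves are then glued along the schedule.\<close>

lemma plan_exists:
  assumes "0 < V y" "V y \<le> 2 powi p"
  obtains u X where "plan 0 p u X" "X 0 = y"
proof -
  let ?S = "schedule p"
  \<comment> \<open>The clause for \<open>k = 0\<close> pins the initial state, which dependent
    choice would otherwise leave open.\<close>
  let ?P = "\<lambda>k z. 0 < V z \<and> V z \<le> 2 powi (p - int k) \<and> (k = 0 \<longrightarrow> z = y)"
  let ?Q = "\<lambda>k z w. steer (?S k) (?S (Suc k)) (2 * 2 powi (p - int k)) z w"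
  have "\<exists>z. \<forall>k. ?P k (z k) \<and> ?Q k (z k) (z (Suc k))"
  proof (rule dependent_nat_choice)
    show "\<exists>z. ?P 0 z" using assms by auto
    fix z k assume z: "?P k z"
    then obtain w where w: "?Q k z w" "V w \<le> 2 powi (p - int k) / 2"
      using stage_time(2)[of z "p - int k" "?S k"] by (auto simp: schedule_Suc)
    moreover have "2 powi (p - int k) / 2 = (2::real) powi (p - int (Suc k))"
      using power_int_diff[of "2::real" "p - int k" 1] by (simp add: algebra_simps)
    moreover have "0 < V w" using steer_endpoint[OF w(1)] by (simp add: schedule_Suc)
    ultimately show "\<exists>w. ?P (Suc k) w \<and> ?Q k z w" by auto
  qed
  then obtain z where z: "\<And>k. ?P k (z k)" "\<And>k. ?Q k (z k) (z (Suc k))" by blast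
  define R where "R k u X \<longleftrightarrow> locally_bounded_control u \<and> trajectory_on F u (?S k) (?S (Suc k)) X \<and>
    X (?S k) = z k \<and> X (?S (Suc k)) = z (Suc k) \<and>
    (\<forall>s\<in>{?S k..?S (Suc k)}. 0 < V (X s) \<and> V (X s) \<le> 2 * 2 powi (p - int k))" for k u X
  have "\<forall>k. \<exists>u X. R k u X" using z(2) unfolding steer_def R_def by blast
  from choice[OF this] obtain u where "\<forall>k. \<exists>X. R k (u k) X" ..
  from choice[OF this] obtain X where R: "\<forall>k. R k (u k) (X k)" ..
  have uX: "\<And>k. locally_bounded_control (u k)" "\<And>k. trajectory_on F (u k) (?S k) (?S (Suc k)) (X k)"
    "\<And>k. X k (?S k) = z k" "\<And>k. X k (?S (Suc k)) = z (Suc k)"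
    "\<And>k s. s \<in> {?S k..?S (Suc k)} \<Longrightarrow> 0 < V (X k s) \<and> V (X k s) \<le> 2 * 2 powi (p - int k)"
    using R unfolding R_def by blast+
  define U where "U t = u (segment_index ?S t) t" for t
  define Y where "Y t = X (segment_index ?S t) t" for t
  have S: "strict_mono ?S" "filterlim ?S at_top sequentially" "?S 0 = 0"
    using time_partition_schedule[of p] by (auto simp: time_partition_def)
  have "locally_bounded_control U"
    unfolding U_def[abs_def] by (rule locally_bounded_control_glue[OF uX(1) S(2)])
  moreover have "trajectory_on F U (?S k) (?S (Suc k)) Y" for k
    unfolding U_def[abs_def] Y_def[abs_def] by (rule trajectory_on_glue[OF S(1) uX(2)]) (simp add: uX(3,4))
  then have "trajectory_on F U 0 b Y" if "b \<ge> 0" for b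
    using trajectory_on_from_segments[OF time_partition_schedule] that by blast
  moreover have "0 < V (Y s) \<and> V (Y s) \<le> envelope p s" if s: "s \<ge> 0" for s
  proof -
    obtain k where k: "?S k \<le> s" "s < ?S (Suc k)" using time_partition_segment[OF time_partition_schedule s] by blast
    then have "segment_index ?S s = k" using segment_index_eq[OF S(1)] by blast
    then show ?thesis using uX(5)[of s k] k by (simp add: Y_def envelope_def)
  qed
  moreover have "Y 0 = y"
  proof -
    have "?S 0 < ?S (Suc 0)" using S(1) by (simp add: strict_mono_def)
    then have "segment_index ?S 0 = 0" using segment_index_eq[OF S(1), of 0 0] S(3) by simp
    then show ?thesis using uX(3)[of 0] z(1)[of 0] S(3) by (simp add: Y_def)
  qed
  ultimately show thesis using that[of U Y] by (simp add: plan_def)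
qed

section \<open>Passing between levels of V and the norm\<close>

lemma norm_le_if_V_le:
  assumes "0 < \<epsilon>"
  obtains \<eta> where "0 < \<eta>" "\<And>y. V y \<le> \<eta> \<Longrightarrow> norm y < \<epsilon>"
proof -
  have "compact ({y. 0 \<le> V y \<and> V y \<le> 1} \<inter> {y. \<epsilon> \<le> norm y})"
    by (intro compact_Int_closed compact_annulus closed_Collect_le continuous_intros)
  then have K: "compact {y. V y \<le> 1 \<and> \<epsilon> \<le> norm y}" (is "compact ?K")
    by (simp add: V_nonneg Int_def)
  show thesis
  proof (cases "?K = {}")
    case True
    then show thesis by (intro that[of 1]) (auto simp: set_eq_iff not_le dest: leD)
  next
    case False
    then obtain x where x: "x \<in> ?K" "\<And>y. y \<in> ?K \<Longrightarrow> V x \<le> V y"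
      using continuous_attains_inf[OF K _ continuous_V] by metis
    have "0 < V x" using x(1) assms V_pos_iff[of x] by auto
    show thesis
    proof (rule that[of "min 1 (V x / 2)"])
      show "0 < min 1 (V x / 2)" using \<open>0 < V x\<close> by simp
      fix y assume y: "V y \<le> min 1 (V x / 2)"
      show "norm y < \<epsilon>"
      proof (rule ccontr)
        assume "\<not> norm y < \<epsilon>"
        then have "V x \<le> V y" using y by (intro x(2)) auto
        then show False using y \<open>0 < V x\<close> by simp
      qed
    qed
  qed
qed

lemma V_le_near_0:
  assumes "0 < \<eta>"
  obtains \<delta> where "0 < \<delta>" "\<And>y. norm y \<le> \<delta> \<Longrightarrow> V y < \<eta>"
proof -
  have "isCont V 0" using continuous_V[of UNIV] by (auto simp: continuous_on_eq_continuous_at)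
  then obtain \<delta> where "0 < \<delta>" "\<And>y. norm y < \<delta> \<Longrightarrow> \<bar>V y\<bar> < \<eta>"
    using assms unfolding continuous_at_eps_delta by (auto simp: dist_norm)
  then show thesis by (intro that[of "\<delta> / 2"]) (auto simp: abs_less_iff)
qed

lemma tendsto_0_if_V_tendsto:
  assumes "((\<lambda>t. V (x t)) \<longlongrightarrow> 0) at_top"
  shows "(x \<longlongrightarrow> 0) at_top"
proof (rule tendstoI)
  fix \<epsilon> :: real assume "0 < \<epsilon>"
  then obtain \<eta> where \<eta>: "0 < \<eta>" "\<And>y. V y \<le> \<eta> \<Longrightarrow> norm y < \<epsilon>" using norm_le_if_V_le by blast
  have "\<forall>\<^sub>F t in at_top. V (x t) < \<eta>" using order_tendstoD(2)[OF assms \<eta>(1)] .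
  then show "\<forall>\<^sub>F t in at_top. dist (x t) 0 < \<epsilon>"
    by (rule eventually_mono) (simp add: \<eta>(2) less_imp_le)
qed

lemma dyadic_level:
  fixes v :: real
  assumes "0 < v"
  obtains p :: int where "v \<le> 2 powi p" "2 powi p < 2 * v"
proof -
  define p where "p = \<lceil>log 2 v\<rceil>"
  have "log 2 v \<le> real_of_int p" "real_of_int p < log 2 v + 1" unfolding p_def by linarith+
  then have "2 powr log 2 v \<le> 2 powr real_of_int p" "2 powr real_of_int p < 2 powr (log 2 v + 1)" by auto
  then have "v \<le> 2 powi p" "2 powi p < 2 * v" using assms by (auto simp: powr_real_of_int' powr_add)
  then show thesis by (rule that)
qed

end

section \<open>Stabilization\<close>

lemma int_bounded_below_least:
  fixes A :: "int set"
  assumes "A \<noteq> {}" "\<And>p. p \<in> A \<Longrightarrow> q \<le> p"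
  obtains p where "p \<in> A" "\<And>r. r \<in> A \<Longrightarrow> p \<le> r"
proof -
  obtain p0 where "p0 \<in> A" using assms(1) by blast
  then obtain p where p: "p \<in> A" "\<And>r. r \<in> A \<Longrightarrow> nat (p - q) \<le> nat (r - q)"
    using ex_has_least_nat[of "\<lambda>p. p \<in> A" p0 "\<lambda>p. nat (p - q)"] by blast
  have "p \<le> r" if "r \<in> A" for r
    using p(2)[OF that] assms(2)[OF that] assms(2)[OF p(1)] by simp
  then show thesis using that p(1) by blast
qed

context locally_steerable_system
begin

text \<open>One local descent from \<open>x0\<close>, confined to the open sublevel set of
  \<open>2 * V x0\<close>, gives the comparison function \<open>2 * v\<close>.\<close>

lemma assumption1: "assumption1 F"
  unfolding assumption1_def
proof (intro exI[of _ V] exI[of _ "\<lambda>v. 2 * v"] conjI allI impI)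
  show "class_K (\<lambda>v. 2 * v)"
    by (auto simp: class_K_def strict_mono_on_def intro!: continuous_intros)
  fix \<xi> :: real and x0 :: 'a assume \<xi>: "0 < \<xi>" and "x0 \<noteq> 0"
  then have "0 < V x0" by (simp add: V_pos_iff)
  then have U: "x0 \<in> {y. V y < 2 * V x0}" by simp
  obtain m v where mv: "steering_control f g x0 m (\<lambda>y. V y - V x0) v" "words_vanish f g x0 m (\<lambda>y. V y - V x0)"
    using local_steering[OF \<open>x0 \<noteq> 0\<close>] by blast
  from local_descent[OF smooth_f smooth_g smooth_V mv open_sublevel U \<xi>]
  obtain e r d where e: "0 < e" "e \<le> \<xi>" "0 < r" "0 < d" and
    *: "\<forall>a. \<exists>u. locally_bounded_control u \<and> (\<forall>y\<in>ball x0 r. \<exists>X. trajectory_on F u a (a + e) X \<and>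
      X a = y \<and> (\<forall>s\<in>{a..a+e}. X s \<in> {y. V y < 2 * V x0}) \<and> V (X (a + e)) \<le> V y - d)" .
  from * obtain u where u: "locally_bounded_control u" and uX: "\<forall>y\<in>ball x0 r. \<exists>X. trajectory_on F u 0 (0 + e) X \<and>
      X 0 = y \<and> (\<forall>s\<in>{0..0+e}. X s \<in> {y. V y < 2 * V x0}) \<and> V (X (0 + e)) \<le> V y - d" by blast
  have "x0 \<in> ball x0 r" using e(3) by simp
  from bspec[OF uX this] obtain X where X: "trajectory_on F u 0 e X" "X 0 = x0"
    "\<forall>s\<in>{0..e}. V (X s) < 2 * V x0" "V (X e) \<le> V x0 - d" by auto
  have "V (x e) < V x0 \<and> (\<forall>s\<in>{0..e}. V (x s) \<le> 2 * V x0)" if x: "trajectory_on F u 0 e x" "x 0 = x0" for x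
  proof -
    have "x s = X s" if "s \<in> {0..e}" for s
      using trajectory_on_unique_control[OF smooth_f smooth_g u x(1) X(1) _ that] x(2) X(2) by simp
    then show ?thesis using X e by (auto intro: less_imp_le)
  qed
  then show "\<exists>\<epsilon> u. 0 < \<epsilon> \<and> \<epsilon> \<le> \<xi> \<and> admissible_control {0..\<epsilon>} u \<and>
      (\<exists>x. trajectory_on F u 0 \<epsilon> x \<and> x 0 = x0) \<and>
      (\<forall>x. trajectory_on F u 0 \<epsilon> x \<and> x 0 = x0 \<longrightarrow> V (x \<epsilon>) < V x0 \<and> (\<forall>s\<in>{0..\<epsilon>}. V (x s) \<le> 2 * V x0))"
    using e u X(1,2) locally_bounded_control_admissible[OF u] by (intro exI[of _ e] exI[of _ u]) auto
qed (simp_all add: continuous_V pos_def proper)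

lemma plan_unique:
  assumes "plan a p u X" "trajectory_on F u a b x" "x a = X a" "s \<in> {a..b}"
  shows "x s = X s"
proof -
  have "locally_bounded_control u" "trajectory_on F u a b X"
    using assms(1,4) unfolding plan_def by auto
  then show ?thesis
    using trajectory_on_unique_control[OF smooth_f smooth_g _ assms(2)] assms(3,4) by blast
qed

lemma plan_exists_dyadic:
  assumes "y \<noteq> 0"
  shows "\<exists>p u X. plan 0 p u X \<and> X 0 = y \<and> 2 powi p < 2 * V y"
proof -
  have "0 < V y" using assms by (simp add: V_pos_iff)
  then obtain p where p: "V y \<le> 2 powi p" "2 powi p < 2 * V y" using dyadic_level by blast
  from plan_exists[OF \<open>0 < V y\<close> p(1)] show ?thesis using p(2) by blast
qed

lemma plan_tendsto:
  assumes "\<And>s. s \<ge> a \<Longrightarrow> V (x s) \<le> envelope p s"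
  shows "(x \<longlongrightarrow> 0) at_top"
proof (rule tendsto_0_if_V_tendsto, rule tendsto_sandwich)
  show "\<forall>\<^sub>F s in at_top. V (x s) \<le> envelope p s"
    using assms eventually_at_top_linorder by blast
  show "((\<lambda>_. 0) \<longlongrightarrow> (0::real)) at_top" by (rule tendsto_const)
qed (auto simp: V_nonneg envelope_tendsto)

text \<open>The sampling interval is constantly \<open>\<tau>\<close>, and the feedback plays the
  plan of \<open>x0\<close> as a function of time. Sampled states are nonzero because
  \<open>V\<close> is positive along plans.\<close>

lemma SDF_WGAS: "SDF_WGAS F"
  unfolding SDF_WGAS_def
proof (intro allI impI)
  fix \<tau> :: real assume \<tau>: "0 < \<tau>"
  have "\<forall>y. \<exists>p u X. y \<noteq> 0 \<longrightarrow> plan 0 p u X \<and> X 0 = y \<and> 2 powi p < 2 * V y"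
    using plan_exists_dyadic by blast
  from choice[OF this] obtain p where "\<forall>y. \<exists>u X. y \<noteq> 0 \<longrightarrow> plan 0 (p y) u X \<and> X 0 = y \<and> 2 powi p y < 2 * V y" ..
  from choice[OF this] obtain u where "\<forall>y. \<exists>X. y \<noteq> 0 \<longrightarrow> plan 0 (p y) (u y) X \<and> X 0 = y \<and> 2 powi p y < 2 * V y" ..
  from choice[OF this] obtain X where "\<forall>y. y \<noteq> 0 \<longrightarrow> plan 0 (p y) (u y) (X y) \<and> X y 0 = y \<and> 2 powi p y < 2 * V y" ..
  then have pl: "plan 0 (p y) (u y) (X y)" and X0: "X y 0 = y" and p: "2 powi p y < 2 * V y" if "y \<noteq> 0" for y
    using that by blast+
  define t where "t x0 i = real i * \<tau>" for x0 :: 'a and i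
  define k where "k s y x0 = (if x0 = 0 then 0 else u x0 s)" for s :: real and y x0 :: 'a
  have tp: "time_partition (t x0)" for x0
  proof -
    have "filterlim (\<lambda>i. real i * \<tau>) at_top sequentially"
      using \<tau> by (intro filterlim_at_top_mult_tendsto_pos[OF tendsto_const] filterlim_real_sequentially) 
    then show ?thesis
      unfolding time_partition_def t_def[abs_def] using \<tau> by (auto simp: strict_mono_def)
  qed
  have unique: "x s = X x0 s"
    if x0: "x0 \<noteq> 0" and x: "sampled_trajectory F (\<lambda>s y. k s y x0) UNIV (t x0) x" "x 0 = x0" and s: "0 \<le> s" for x x0 s
  proof -
    have "trajectory_on F (u x0) (t x0 i) (t x0 (Suc i)) x" for i
      using x x0 by (simp add: sampled_trajectory_def k_def)
    then have "trajectory_on F (u x0) 0 s x"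
      using trajectory_on_from_segments[OF tp] s by blast
    then show ?thesis using plan_unique[OF pl[OF x0], of s x s] x X0[OF x0] s by auto
  qed
  have bound: "0 < V (x s) \<and> V (x s) \<le> envelope (p x0) s"
    if "x0 \<noteq> 0" "sampled_trajectory F (\<lambda>s y. k s y x0) UNIV (t x0) x" "x 0 = x0" "0 \<le> s" for x x0 s
    using unique[OF that] pl[OF that(1)] that(4) by (simp add: plan_def)
  show "\<exists>T k. (\<forall>x. x \<noteq> 0 \<longrightarrow> 0 < T x \<and> T x \<le> \<tau>) \<and>
      (\<forall>x x0. admissible_control {0..} (\<lambda>t. k t x x0)) \<and>
      (\<exists>t :: 'a \<Rightarrow> nat \<Rightarrow> real.
        (\<forall>x0. x0 \<noteq> 0 \<longrightarrow>
          time_partition (t x0) \<and>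
          (\<exists>x. sampled_trajectory F (\<lambda>s y. k s y x0) UNIV (t x0) x \<and> x 0 = x0) \<and>
          (\<forall>x. sampled_trajectory F (\<lambda>s y. k s y x0) UNIV (t x0) x \<and> x 0 = x0 \<longrightarrow>
            (\<forall>i. x (t x0 i) \<noteq> 0 \<and> t x0 (Suc i) - t x0 i = T (x (t x0 i))) \<and>
            (x \<longlongrightarrow> 0) at_top)) \<and>
        (\<forall>\<epsilon>>0. \<exists>\<delta>>0. \<forall>x0 x. x0 \<noteq> 0 \<and> norm x0 \<le> \<delta> \<and>
          sampled_trajectory F (\<lambda>s y. k s y x0) UNIV (t x0) x \<and> x 0 = x0 \<longrightarrow>
          (\<forall>s\<ge>0. norm (x s) \<le> \<epsilon>)))"
  proof (intro exI[of _ "\<lambda>_. \<tau>"] exI[of _ k] exI[of _ t] conjI allI impI)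
    show "admissible_control {0..} (\<lambda>t. k t x x0)" for x x0
    proof (cases "x0 = 0")
      case True
      then show ?thesis using locally_bounded_control_admissible[OF locally_bounded_control_zero] by (simp add: k_def)
    next
      case False
      then show ?thesis using locally_bounded_control_admissible pl[OF False] by (simp add: k_def plan_def)
    qed
    fix x0 :: 'a assume x0: "x0 \<noteq> 0"
    show "time_partition (t x0)" by (rule tp)
    have "0 \<le> t x0 i" "t x0 i \<le> t x0 (Suc i)" for i using \<tau> by (auto simp: t_def)
    then have "trajectory_on F (u x0) (t x0 i) (t x0 (Suc i)) (X x0)" for i
      using pl[OF x0] trajectory_on_subinterval[of F "u x0" 0 "t x0 (Suc i)" "X x0" "t x0 i"] unfolding plan_def by auto
    then show "\<exists>x. sampled_trajectory F (\<lambda>s y. k s y x0) UNIV (t x0) x \<and> x 0 = x0"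
      using x0 X0[OF x0] by (intro exI[of _ "X x0"]) (simp add: sampled_trajectory_def k_def)
    fix x assume x: "sampled_trajectory F (\<lambda>s y. k s y x0) UNIV (t x0) x \<and> x 0 = x0"
    show "x (t x0 i) \<noteq> 0" for i
      using bound[OF x0, of x "t x0 i"] x \<tau> V_pos_iff[of "x (t x0 i)"] by (simp add: t_def)
    show "t x0 (Suc i) - t x0 i = \<tau>" for i by (simp add: t_def algebra_simps)
    show "(x \<longlongrightarrow> 0) at_top"
      by (rule plan_tendsto[of 0 x "p x0"]) (use bound[OF x0] x in blast)
  next
    fix \<epsilon> :: real assume "0 < \<epsilon>"
    then obtain \<eta> where \<eta>: "0 < \<eta>" "\<And>y. V y \<le> \<eta> \<Longrightarrow> norm y < \<epsilon>" using norm_le_if_V_le by blast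
    \<comment> \<open>The envelope of the chosen plan is at most \<open>2 * 2 powi p x0\<close>,
      which is less than \<open>4 * V x0\<close>; this is the origin of the 4.\<close>
    obtain \<delta> where \<delta>: "0 < \<delta>" "\<And>y. norm y \<le> \<delta> \<Longrightarrow> V y < \<eta> / 4" using V_le_near_0[of "\<eta> / 4"] \<eta>(1) by auto
    have "norm (x s) \<le> \<epsilon>"
      if h: "x0 \<noteq> 0 \<and> norm x0 \<le> \<delta> \<and> sampled_trajectory F (\<lambda>s y. k s y x0) UNIV (t x0) x \<and> x 0 = x0" "0 \<le> s" for x0 x s
    proof -
      have "V (x s) \<le> envelope (p x0) s" using bound h by blast
      also have "\<dots> \<le> 2 * 2 powi p x0" by (rule envelope_le)
      also have "\<dots> \<le> \<eta>" using p[of x0] \<delta>(2)[of x0] h by auto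
      finally show ?thesis using \<eta>(2) by (simp add: less_imp_le)
    qed
    then show "\<exists>\<delta>>0. \<forall>x0 x. x0 \<noteq> 0 \<and> norm x0 \<le> \<delta> \<and> sampled_trajectory F (\<lambda>s y. k s y x0) UNIV (t x0) x \<and> x 0 = x0 \<longrightarrow>
        (\<forall>s\<ge>0. norm (x s) \<le> \<epsilon>)" using \<delta>(1) by blast
  qed (use \<tau> in auto)
qed

text \<open>The set can be empty when no plan starts from \<open>x\<close> at time \<open>a\<close>.
  Along the closed loop from a nonzero initial state this never happens at a sampling time.\<close>

definition ranks :: "real \<Rightarrow> 'a \<Rightarrow> int set" where
  "ranks a x = {p. \<exists>u X. plan a p u X \<and> X a = x}"

text \<open>A plan of index \<open>p\<close> forces \<open>V x\<close> below
  \<open>2 * 2 powi p\<close>; since \<open>V x\<close> is positive, the indices are bounded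
  below.\<close>

lemma ranks_least:
  assumes "ranks a x \<noteq> {}"
  obtains p where "p \<in> ranks a x" "\<And>q. q \<in> ranks a x \<Longrightarrow> p \<le> q"
proof -
  have pos: "0 < V x \<and> V x \<le> 2 * 2 powi p" if p: "p \<in> ranks a x" for p
  proof -
    obtain u X where "plan a p u X" "X a = x" using p by (auto simp: ranks_def)
    then have "0 < V x" "V x \<le> envelope p a" unfolding plan_def by auto
    then show ?thesis using envelope_le[of p a] by simp
  qed
  then have "0 < V x" using assms by blast
  then obtain q where q: "V x / 4 \<le> 2 powi q" "2 powi q < 2 * (V x / 4)" using dyadic_level[of "V x / 4"] by auto
  have "q \<le> p" if "p \<in> ranks a x" for p
  proof (rule ccontr)
    assume "\<not> q \<le> p"
    then have "2 powi p < (2::real) powi q" by (intro power_int_strict_increasing) auto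
    then show False using pos[OF that] q(2) by simp
  qed
  with int_bounded_below_least[OF assms] that show thesis by metis
qed

lemma ranks_0: "ranks a 0 = {}"
  by (auto simp: ranks_def plan_def)

text \<open>The feedback restarts, at every sampling time, a plan of least rank. Ranks are integers and the
  rest of the current plan is still available at the next sampling time, so the rank never increases
  although the feedback has no memory.\<close>

lemma SDF_SGAS: "SDF_SGAS F"
  unfolding SDF_SGAS_def
proof (intro allI impI)
  fix R :: real and T assume "0 < R" and T: "time_partition T"
  have T': "strict_mono T" "filterlim T at_top sequentially" "T 0 = 0" using T by (auto simp: time_partition_def)
  have Tle: "T i \<le> T (Suc i)" "0 \<le> T i" for i
    using T' strict_mono_less_eq[OF T'(1)] by (simp, metis le0 strict_mono_less_eq)
  \<comment> \<open>A pair \<open>q\<close> is a sampling index with a sampled state. Where no plan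
    exists the control defaults to zero, which in particular keeps the origin at rest.\<close>
  have "\<forall>q. \<exists>u. locally_bounded_control u \<and>
      (ranks (T (fst q)) (snd q) \<noteq> {} \<longrightarrow> (\<exists>p X. plan (T (fst q)) p u X \<and> X (T (fst q)) = snd q \<and> (\<forall>r\<in>ranks (T (fst q)) (snd q). p \<le> r))) \<and>
      (ranks (T (fst q)) (snd q) = {} \<longrightarrow> u = (\<lambda>_. 0))"
  proof
    fix q :: "nat \<times> 'a"
    let ?a = "T (fst q)" and ?x = "snd q"
    show "\<exists>u. locally_bounded_control u \<and>
      (ranks ?a ?x \<noteq> {} \<longrightarrow> (\<exists>p X. plan ?a p u X \<and> X ?a = ?x \<and> (\<forall>r\<in>ranks ?a ?x. p \<le> r))) \<and>
      (ranks ?a ?x = {} \<longrightarrow> u = (\<lambda>_. 0))"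
    proof (cases "ranks ?a ?x = {}")
      case True
      then show ?thesis using locally_bounded_control_zero by blast
    next
      case False
      then obtain p where p: "p \<in> ranks ?a ?x" "\<And>r. r \<in> ranks ?a ?x \<Longrightarrow> p \<le> r" using ranks_least by blast
      then obtain u X where uX: "plan ?a p u X" "X ?a = ?x" by (auto simp: ranks_def)
      then have "locally_bounded_control u" by (simp add: plan_def)
      then show ?thesis using False p uX by blast
    qed
  qed
  from choice[OF this] obtain c' where c': "\<forall>q. locally_bounded_control (c' q) \<and>
      (ranks (T (fst q)) (snd q) \<noteq> {} \<longrightarrow> (\<exists>p X. plan (T (fst q)) p (c' q) X \<and> X (T (fst q)) = snd q \<and> (\<forall>r\<in>ranks (T (fst q)) (snd q). p \<le> r))) \<and>
      (ranks (T (fst q)) (snd q) = {} \<longrightarrow> c' q = (\<lambda>_. 0))" ..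
  define c where "c i x = c' (i, x)" for i x
  have c: "locally_bounded_control (c i x)"
    "ranks (T i) x \<noteq> {} \<Longrightarrow> \<exists>p X. plan (T i) p (c i x) X \<and> X (T i) = x \<and> (\<forall>r\<in>ranks (T i) x. p \<le> r)"
    "ranks (T i) x = {} \<Longrightarrow> c i x = (\<lambda>_. 0)" for i x
    using c'[rule_format, of "(i, x)"] by (auto simp: c_def)
  define k where "k t x = c (segment_index T t) x t" for t x
  have k_eq: "k t x = c i x t" if "t \<in> {T i..<T (Suc i)}" for t x i
    using segment_index_eq[OF T'(1), of i t] that by (simp add: k_def)
  have traj: "trajectory_on F (c i (x (T i))) (T i) (T (Suc i)) x" if "sampled_trajectory F k UNIV T x" for x i
    by (rule trajectory_on_cong[of F "\<lambda>t. k t (x (T i))"])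
      (use that Tle k_eq in \<open>auto simp: sampled_trajectory_def\<close>)
  have zero: "x s = 0" if x: "sampled_trajectory F k UNIV T x" "x 0 = 0" and s: "0 \<le> s" for x s
  proof -
    have seg: "x s = 0" if "x (T i) = 0" "s \<in> {T i..T (Suc i)}" for i s
    proof -
      have "trajectory_on F (\<lambda>_. 0) (T i) (T (Suc i)) x"
        using traj[OF x(1), of i] that(1) c(3)[of i 0] ranks_0 by simp
      moreover have "trajectory_on F (\<lambda>_. 0) (T i) (T (Suc i)) (\<lambda>_. 0)"
        by (rule trajectory_onI) (simp_all add: f_0 set_integrable_def)
      ultimately show ?thesis
        using trajectory_on_unique_control[OF smooth_f smooth_g locally_bounded_control_zero, of "T i" "T (Suc i)" x "\<lambda>_. 0" s] that
        by simp
    qed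
    have "x (T i) = 0" for i
    proof (induction i)
      case 0
      then show ?case using x T' by simp
    next
      case (Suc i)
      then show ?case using seg[of i "T (Suc i)"] Tle by simp
    qed
    moreover obtain i where "T i \<le> s" "s < T (Suc i)" using time_partition_segment[OF T s] by blast
    ultimately show ?thesis using seg[of i s] by simp
  qed
  have rank_seq: "\<exists>p. \<forall>i. p i \<in> ranks (T i) (x (T i)) \<and> (\<forall>r\<in>ranks (T i) (x (T i)). p i \<le> r) \<and> p (Suc i) \<le> p i \<and>
      (\<forall>s\<in>{T i..T (Suc i)}. V (x s) \<le> envelope (p i) s)"
    if x: "sampled_trajectory F k UNIV T x" and x0: "x 0 \<noteq> 0" for x
  proof -
    have seg: "\<exists>p. p \<in> ranks (T i) (x (T i)) \<and> (\<forall>r\<in>ranks (T i) (x (T i)). p \<le> r) \<and> p \<in> ranks (T (Suc i)) (x (T (Suc i))) \<and>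
      (\<forall>s\<in>{T i..T (Suc i)}. V (x s) \<le> envelope p s)" if ne: "ranks (T i) (x (T i)) \<noteq> {}" for i
    proof -
      obtain p X where p: "plan (T i) p (c i (x (T i))) X" "X (T i) = x (T i)" "\<forall>r\<in>ranks (T i) (x (T i)). p \<le> r"
        using c(2)[OF ne] by blast
      have eq: "x s = X s" if "s \<in> {T i..T (Suc i)}" for s
        using plan_unique[OF p(1) traj[OF x] _ that] p(2) by simp
      have "plan (T (Suc i)) p (c i (x (T i))) X" using plan_restrict[OF p(1)] Tle by blast
      then have "p \<in> ranks (T (Suc i)) (x (T (Suc i)))"
        using eq[of "T (Suc i)"] Tle[of i] unfolding ranks_def by auto
      moreover have "p \<in> ranks (T i) (x (T i))" using p unfolding ranks_def by blast
      moreover have "V (x s) \<le> envelope p s" if "s \<in> {T i..T (Suc i)}" for s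
        using eq[OF that] p(1) that unfolding plan_def by auto
      ultimately show ?thesis using p(3) by blast
    qed
    \<comment> \<open>A plan is known to exist for every nonzero state at time 0 only; at later
      sampling times it is inherited from the plan being followed.\<close>
    have ne: "ranks (T i) (x (T i)) \<noteq> {}" for i
    proof (induction i)
      case 0
      show ?case using plan_exists_dyadic[OF x0] T' unfolding ranks_def by auto
    next
      case (Suc i)
      then show ?case using seg[OF Suc] by blast
    qed
    have "\<forall>i. \<exists>p. p \<in> ranks (T i) (x (T i)) \<and> (\<forall>r\<in>ranks (T i) (x (T i)). p \<le> r) \<and> p \<in> ranks (T (Suc i)) (x (T (Suc i))) \<and>
      (\<forall>s\<in>{T i..T (Suc i)}. V (x s) \<le> envelope p s)" using seg ne by blast
    from choice[OF this] obtain p where p: "\<forall>i. p i \<in> ranks (T i) (x (T i)) \<and> (\<forall>r\<in>ranks (T i) (x (T i)). p i \<le> r) \<and>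
      p i \<in> ranks (T (Suc i)) (x (T (Suc i))) \<and> (\<forall>s\<in>{T i..T (Suc i)}. V (x s) \<le> envelope (p i) s)" ..
    then show ?thesis by (intro exI[of _ p]) blast
  qed
  have exist: "\<exists>x. sampled_trajectory F k UNIV T x \<and> x 0 = x0" for x0
  proof -
    \<comment> \<open>The clause on the endpoint is the invariant that lets the construction go on:
      at a nonzero state without a plan, the default control comes with no trajectory up to the next
      sampling time.\<close>
    have step: "\<exists>X. trajectory_on F (c i z) (T i) (T (Suc i)) X \<and> X (T i) = z \<and>
        (ranks (T (Suc i)) (X (T (Suc i))) \<noteq> {} \<or> X (T (Suc i)) = 0)" if z: "ranks (T i) z \<noteq> {} \<or> z = 0" for i z
    proof (cases "z = 0")
      case True
      have "trajectory_on F (\<lambda>_. 0) (T i) (T (Suc i)) (\<lambda>_. 0)"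
        by (rule trajectory_onI) (simp_all add: f_0 set_integrable_def)
      then show ?thesis using True c(3)[of i 0] ranks_0 by (intro exI[of _ "\<lambda>_. 0"]) auto
    next
      case False
      then obtain p X where p: "plan (T i) p (c i z) X" "X (T i) = z" using z c(2)[of i z] by blast
      have "plan (T (Suc i)) p (c i z) X" using plan_restrict[OF p(1)] Tle by blast
      then have "p \<in> ranks (T (Suc i)) (X (T (Suc i)))" unfolding ranks_def by blast
      moreover have "trajectory_on F (c i z) (T i) (T (Suc i)) X"
        using p(1) Tle[of i] unfolding plan_def by blast
      ultimately show ?thesis using p(2) by blast
    qed
    let ?P = "\<lambda>i z. (ranks (T i) z \<noteq> {} \<or> z = 0) \<and> (i = 0 \<longrightarrow> z = x0)"
    let ?Q = "\<lambda>i z w. \<exists>X. trajectory_on F (c i z) (T i) (T (Suc i)) X \<and> X (T i) = z \<and> X (T (Suc i)) = w"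
    have "\<exists>z. \<forall>i. ?P i (z i) \<and> ?Q i (z i) (z (Suc i))"
    proof (rule dependent_nat_choice)
      have "ranks (T 0) x0 \<noteq> {} \<or> x0 = 0"
        using plan_exists_dyadic[of x0] T' unfolding ranks_def by auto
      then show "\<exists>z. ?P 0 z" by blast
      show "\<exists>w. ?P (Suc i) w \<and> ?Q i z w" if "?P i z" for z i
        using step[of i z] that by auto
    qed
    then obtain z where z: "\<forall>i. ?P i (z i)" "\<forall>i. ?Q i (z i) (z (Suc i))" by blast
    from choice[OF z(2)] obtain X where X: "\<forall>i. trajectory_on F (c i (z i)) (T i) (T (Suc i)) (X i) \<and>
        X i (T i) = z i \<and> X i (T (Suc i)) = z (Suc i)" ..
    define Y where "Y t = X (segment_index T t) t" for t
    have Yi: "Y (T i) = z i" for i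
    proof -
      have "T i < T (Suc i)" using T'(1) by (simp add: strict_mono_def)
      then have "segment_index T (T i) = i" using segment_index_eq[OF T'(1), of i "T i"] by simp
      then show ?thesis using X by (simp add: Y_def)
    qed
    have "trajectory_on F (\<lambda>t. c (segment_index T t) (z (segment_index T t)) t) (T i) (T (Suc i)) Y" for i
      unfolding Y_def[abs_def] using trajectory_on_glue[OF T'(1), of F "\<lambda>i. c i (z i)" i X] X by simp
    then have "trajectory_on F (\<lambda>t. k t (Y (T i))) (T i) (T (Suc i)) Y" for i
    proof (rule trajectory_on_cong)
      show "k s (Y (T i)) = c (segment_index T s) (z (segment_index T s)) s" if "s \<in> {T i..<T (Suc i)}" for s
        using segment_index_eq[OF T'(1), of i s] that by (simp add: k_def Yi)
    qed (use Tle in auto)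
    moreover have "Y 0 = x0" using Yi[of 0] z(1) T' by simp
    ultimately show ?thesis by (auto simp: sampled_trajectory_def)
  qed
  show "\<exists>P k. 0 \<in> interior P \<and> cball 0 R \<subseteq> P \<and>
      (\<forall>x\<in>P. admissible_control {0..} (\<lambda>t. k t x)) \<and>
      (\<forall>x0\<in>P. \<exists>x. sampled_trajectory F k P T x \<and> x 0 = x0) \<and>
      (\<forall>\<epsilon>>0. \<exists>\<delta>>0. \<forall>x. sampled_trajectory F k P T x \<and> norm (x 0) \<le> \<delta> \<longrightarrow> (\<forall>t\<ge>0. norm (x t) \<le> \<epsilon>)) \<and>
      (\<forall>x. sampled_trajectory F k P T x \<longrightarrow> (x \<longlongrightarrow> 0) at_top)"
  \<comment> \<open>The neighbourhood is the whole space, since every nonzero initial state has a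
    plan at time 0.\<close>
  proof (intro exI[of _ UNIV] exI[of _ k] conjI allI impI ballI)
    show "admissible_control {0..} (\<lambda>t. k t x)" for x
      unfolding k_def
      by (rule locally_bounded_control_admissible[OF locally_bounded_control_glue[OF c(1) T'(2)]]) auto
    show "\<exists>x. sampled_trajectory F k UNIV T x \<and> x 0 = x0" for x0 by (rule exist)
  next
    fix \<epsilon> :: real assume "0 < \<epsilon>"
    then obtain \<eta> where \<eta>: "0 < \<eta>" "\<And>y. V y \<le> \<eta> \<Longrightarrow> norm y < \<epsilon>" using norm_le_if_V_le by blast
    obtain \<delta> where \<delta>: "0 < \<delta>" "\<And>y. norm y \<le> \<delta> \<Longrightarrow> V y < \<eta> / 4" using V_le_near_0[of "\<eta> / 4"] \<eta>(1) by auto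
    have "norm (x t) \<le> \<epsilon>" if h: "sampled_trajectory F k UNIV T x \<and> norm (x 0) \<le> \<delta>" and t: "0 \<le> t" for x t
    proof (cases "x 0 = 0")
      case True
      then have "x t = 0" using zero[of x t] h t by blast
      then show ?thesis using \<open>0 < \<epsilon>\<close> by simp
    next
      case False
      obtain p where p: "\<forall>i. p i \<in> ranks (T i) (x (T i)) \<and> (\<forall>r\<in>ranks (T i) (x (T i)). p i \<le> r) \<and> p (Suc i) \<le> p i \<and>
        (\<forall>s\<in>{T i..T (Suc i)}. V (x s) \<le> envelope (p i) s)" using rank_seq h False by blast
      \<comment> \<open>Any plan at time 0 bounds the first least index and hence all later ones;
        this one keeps the envelopes below \<open>4 * V (x 0)\<close>.\<close>
      obtain q where q: "q \<in> ranks 0 (x 0)" "2 powi q < 2 * V (x 0)"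
        using plan_exists_dyadic[OF False] unfolding ranks_def by blast
      have "p i \<le> p 0" for i using p by (induction i) (auto intro: order_trans)
      moreover have "p 0 \<le> q" using p q(1) T' by (metis)
      ultimately have pq: "p i \<le> q" for i using order_trans by blast
      obtain i where i: "T i \<le> t" "t < T (Suc i)" using time_partition_segment[OF T t] by blast
      have "V (x t) \<le> envelope (p i) t" using p i by auto
      also have "\<dots> \<le> 2 * 2 powi p i" by (rule envelope_le)
      also have "\<dots> \<le> 2 * 2 powi q" using pq[of i] by (simp add: power_int_increasing)
      also have "\<dots> \<le> \<eta>" using q(2) \<delta>(2)[of "x 0"] h by auto
      finally show ?thesis using \<eta>(2) by (simp add: less_imp_le)
    qed
    then show "\<exists>\<delta>>0. \<forall>x. sampled_trajectory F k UNIV T x \<and> norm (x 0) \<le> \<delta> \<longrightarrow> (\<forall>t\<ge>0. norm (x t) \<le> \<epsilon>)"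
      using \<delta>(1) by blast
  next
    fix x assume x: "sampled_trajectory F k UNIV T x"
    show "(x \<longlongrightarrow> 0) at_top"
    proof (cases "x 0 = 0")
      case True
      have "\<forall>\<^sub>F s in at_top. x s = 0"
        unfolding eventually_at_top_linorder using zero[OF x True] by blast
      then show ?thesis by (rule tendsto_eventually)
    next
      case False
      obtain p where p: "\<forall>i. p i \<in> ranks (T i) (x (T i)) \<and> (\<forall>r\<in>ranks (T i) (x (T i)). p i \<le> r) \<and> p (Suc i) \<le> p i \<and>
        (\<forall>s\<in>{T i..T (Suc i)}. V (x s) \<le> envelope (p i) s)" using rank_seq[OF x False] by blast
      have dec: "p j \<le> p i" if "i \<le> j" for i j
        using that by (induction rule: dec_induct) (use p in \<open>auto intro: order_trans\<close>)
      have later: "\<exists>j\<ge>i. V (x s) \<le> envelope (p j) s" if s: "T i \<le> s" for i s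
      proof -
        have "0 \<le> s" using s Tle(2)[of i] by linarith
        then obtain j where j: "T j \<le> s" "s < T (Suc j)" using time_partition_segment[OF T] by blast
        then have "T i < T (Suc j)" using s by linarith
        then have "i \<le> j" using strict_mono_less[OF T'(1)] by simp
        then show ?thesis using p j by (intro exI[of _ j]) auto
      qed
      show ?thesis
      \<comment> \<open>If the nonincreasing integers \<open>p i\<close> are bounded below, they are
        eventually constant and a single decaying envelope governs the tail. Otherwise already the
        heights \<open>2 * 2 powi p i\<close> of the envelopes tend to zero.\<close>
      proof (cases "\<exists>q. \<forall>i. q \<le> p i")
        case True
        then obtain q where "\<And>i. q \<le> p i" by blast
        then obtain r where "r \<in> range p" "\<And>r'. r' \<in> range p \<Longrightarrow> r \<le> r'"
          using int_bounded_below_least[of "range p" q] by blast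
        then obtain i where i: "\<And>j. p i \<le> p j" by blast
        have "V (x s) \<le> envelope (p i) s" if "T i \<le> s" for s
          using later[OF that] dec i by (metis order_antisym)
        then show ?thesis by (rule plan_tendsto)
      next
        case False
        show ?thesis
        proof (rule tendsto_0_if_V_tendsto, rule tendstoI)
          fix e :: real assume "0 < e"
          then obtain q where q: "2 powi q < 2 * (e / 8)" using dyadic_level[of "e / 8"] by auto
          obtain i where i: "p i \<le> q" using False by (meson linear)
          have "V (x s) < e" if s: "T i \<le> s" for s
          proof -
            obtain j where j: "i \<le> j" "V (x s) \<le> envelope (p j) s" using later[OF s] by blast
            have "p j \<le> q" using dec[OF j(1)] i by simp
            then have "2 powi p j \<le> (2::real) powi q" by (simp add: power_int_increasing)
            then show ?thesis using j(2) envelope_le[of "p j" s] q \<open>0 < e\<close> by simp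
          qed
          then show "\<forall>\<^sub>F s in at_top. dist (V (x s)) 0 < e"
            using V_nonneg unfolding eventually_at_top_linorder by auto
        qed
      qed
    qed
  qed auto
qed

end

section \<open>From the vanishing condition on the Lie algebra to words in f and g\<close>

lemma words_vanishI:
  assumes "\<And>ws. set ws \<subseteq> {f, g} \<Longrightarrow> length ws < m \<Longrightarrow> foldr lie_deriv ws \<phi> x = 0"
  shows "words_vanish f g x m \<phi>"
  using assms
proof (induction m arbitrary: \<phi>)
  case (Suc m)
  have "words_vanish f g x m (lie_deriv X \<phi>)" if "X \<in> {f, g}" for X
  proof (rule Suc.IH)
    fix ws assume "set ws \<subseteq> {f, g}" "length ws < m"
    then show "foldr lie_deriv ws (lie_deriv X \<phi>) x = 0"
      using Suc.prems[of "ws @ [X]"] that by auto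
  qed
  then show ?case using Suc.prems[of "[]"] by simp
qed simp

lemma foldr_lie_deriv_diff_const:
  assumes "smooth \<phi>" "ws \<noteq> []"
  shows "foldr lie_deriv ws (\<lambda>y. \<phi> y - c) = foldr lie_deriv ws \<phi>"
  using assms(2) by (cases ws rule: rev_cases) (simp_all add: lie_deriv_diff_const[OF assms(1)])

lemma funpow_lie_deriv_diff_const:
  assumes "smooth \<phi>"
  shows "(lie_deriv X ^^ Suc k) (\<lambda>y. \<phi> y - c) = (lie_deriv X ^^ Suc k) \<phi>"
  by (simp add: funpow_Suc_right lie_deriv_diff_const[OF assms] del: funpow.simps)

lemma smooth_foldr_lie_deriv:
  "(\<And>D. D \<in> set ws \<Longrightarrow> smooth D) \<Longrightarrow> smooth \<phi> \<Longrightarrow> smooth (foldr lie_deriv ws \<phi>)"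
  by (induction ws) (auto intro: smooth_lie_deriv)

lemma lie_deriv_cmult:
  fixes \<phi> :: "'a::euclidean_space \<Rightarrow> real"
  assumes "smooth \<phi>"
  shows "lie_deriv (\<lambda>y. a *\<^sub>R X y) (\<lambda>y. c * \<phi> y) x = a * c * lie_deriv X \<phi> x"
proof -
  have "((\<lambda>y. c * \<phi> y) has_derivative (\<lambda>w. c * frechet_derivative \<phi> (at x) w)) (at x)"
    by (intro has_derivative_mult_right smooth_has_derivative assms)
  then have "frechet_derivative (\<lambda>y. c * \<phi> y) (at x) = (\<lambda>w. c * frechet_derivative \<phi> (at x) w)"
    by (rule frechet_derivative_at[symmetric])
  then show ?thesis
    using linear_cmul[OF linear_frechet_derivative[OF smooth_differentiable[OF assms]]] by (simp add: lie_deriv_def)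
qed

lemma field_span_scaled_member: "X \<in> S \<Longrightarrow> (\<lambda>y. a *\<^sub>R X y) \<in> field_span S"
  unfolding field_span_def by (rule CollectI, rule exI[of _ "{X}"], rule exI[of _ "\<lambda>_. a"]) auto

lemma lie_order_le_1:
  assumes "D \<in> field_span {f, g}" "D \<noteq> (\<lambda>_. 0)"
  shows "lie_order f g D \<le> 1"
  unfolding lie_order_def by (rule Least_le) (use assms in \<open>simp add: has_lie_order_def\<close>)

text \<open>Excluding \<open>g\<close> itself does not exclude \<open>2 g\<close>, so the vanishing condition covers all words in
  \<open>f\<close> and \<open>g\<close>.\<close>

lemma words_vanish_of_lie_words:
  fixes f g :: "'a::euclidean_space \<Rightarrow> 'a" and V :: "'a \<Rightarrow> real"
  assumes smooth: "smooth f" "smooth g" "smooth V"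
    and vanish: "\<And>Ds. Ds \<noteq> [] \<Longrightarrow> set Ds \<subseteq> lie_algebra f g - {g} \<Longrightarrow> (\<lambda>_. 0) \<notin> set Ds \<Longrightarrow>
      (\<Sum>D\<leftarrow>Ds. lie_order f g D) \<le> N \<Longrightarrow> foldr lie_deriv Ds V x = 0"
  shows "words_vanish f g x (Suc N) (\<lambda>y. V y - V x)"
proof (rule words_vanishI)
  fix ws assume ws: "set ws \<subseteq> {f, g}" "length ws < Suc N"
  show "foldr lie_deriv ws (\<lambda>y. V y - V x) x = 0"
  proof (cases "ws = []")
    case False
    \<comment> \<open>Replaces the excluded letter \<open>g\<close> by its double, which changes the
      iterated derivative by a nonzero factor and keeps the order at most 1.\<close>
    define h :: "('a \<Rightarrow> 'a) \<Rightarrow> 'a \<Rightarrow> 'a" where "h D = (if D = g then \<lambda>y. 2 *\<^sub>R g y else D)" for D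
    have sm: "smooth D" if "D \<in> set ws" for D using ws(1) smooth that by blast
    have "foldr lie_deriv ws V x = 0"
    \<comment> \<open>A zero letter has no meaningful order and is outside the scope of
      \<open>vanish\<close>; such words vanish because differentiation along the zero field gives
      zero. Nonzero letters also ensure that \<open>2 *\<^sub>R g y\<close> is a field different
      from \<open>g\<close>.\<close>
    proof (cases "(\<lambda>_. 0) \<in> set ws")
      case True
      then obtain us vs where "ws = us @ (\<lambda>_. 0) # vs" by (meson split_list)
      moreover have "lie_deriv (\<lambda>_. 0) \<psi> = (\<lambda>_. 0)" if "smooth \<psi>" for \<psi> :: "'a \<Rightarrow> real"
        using linear_0[OF linear_frechet_derivative[OF smooth_differentiable[OF that]]] by (simp add: lie_deriv_def)
      moreover have "foldr lie_deriv us (\<lambda>_. 0::real) = (\<lambda>_. 0)" for us :: "('a \<Rightarrow> 'a) list"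
        by (induction us) (simp_all add: lie_deriv_def)
      moreover have "smooth (foldr lie_deriv vs V)"
        using sm smooth(3) \<open>ws = _\<close> by (intro smooth_foldr_lie_deriv) auto
      ultimately show ?thesis by simp
    next
      case nz: False
      have scaled: "\<exists>c\<noteq>0. foldr lie_deriv (map h us) V = (\<lambda>y. c * foldr lie_deriv us V y)" if "set us \<subseteq> set ws" for us
        using that
      proof (induction us)
        case Nil
        then show ?case by (intro exI[of _ 1]) simp
      next
        case (Cons D us)
        then obtain c where c: "c \<noteq> 0" "foldr lie_deriv (map h us) V = (\<lambda>y. c * foldr lie_deriv us V y)" by auto
        define a where "a = (if D = g then 2 else 1 :: real)"
        have "h D = (\<lambda>y. a *\<^sub>R D y)" by (auto simp: h_def a_def)
        moreover have "smooth (foldr lie_deriv us V)"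
          using Cons.prems sm smooth(3) by (intro smooth_foldr_lie_deriv) auto
        ultimately have "foldr lie_deriv (map h (D # us)) V = (\<lambda>y. a * c * foldr lie_deriv (D # us) V y)"
          by (intro ext) (simp add: c(2) lie_deriv_cmult)
        then show ?case using c(1) by (intro exI[of _ "a * c"]) (auto simp: a_def)
      qed
      have hD: "h D \<in> lie_algebra f g - {g}" "h D \<noteq> (\<lambda>_. 0)" "lie_order f g (h D) \<le> 1" if D: "D \<in> set ws" for D
      proof -
        have D0: "D \<noteq> (\<lambda>_. 0)" using nz D by blast
        show h0: "h D \<noteq> (\<lambda>_. 0)" using D0 by (auto simp: h_def fun_eq_iff)
        have "(\<lambda>y. 2 *\<^sub>R g y) \<in> lie_algebra f g"
          using lie_algebra.lincomb[where a = 1 and b = 1, OF lie_algebra.right[of g f] lie_algebra.right[of g f]] by (simp add: scaleR_2)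
        moreover have "(\<lambda>y. 2 *\<^sub>R g y) \<noteq> g" if "D = g"
          using D0 that by (auto simp: fun_eq_iff scaleR_2)
        ultimately show "h D \<in> lie_algebra f g - {g}"
          using ws(1) D by (auto simp: h_def intro: lie_algebra.left)
        have "h D \<in> field_span {f, g}"
          using field_span_scaled_member[of g "{f, g}" 2] field_span_scaled_member[of D "{f, g}" 1] ws(1) D
          by (auto simp: h_def)
        then show "lie_order f g (h D) \<le> 1" using lie_order_le_1 h0 by blast
      qed
      have "(\<Sum>D\<leftarrow>map h us. lie_order f g D) \<le> length us" if "set us \<subseteq> set ws" for us
        using that by (induction us) (use hD(3) in \<open>auto simp: add_le_mono\<close>, fastforce)
      then have "(\<Sum>D\<leftarrow>map h ws. lie_order f g D) \<le> N" using ws(2) by (meson le_trans less_Suc_eq_le order_refl)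
      then have "foldr lie_deriv (map h ws) V x = 0"
        using False hD(1) hD(2) by (intro vanish) (auto simp del: map_map dest: sym)
      then show ?thesis using scaled[of ws] by auto
    qed
    then show ?thesis using foldr_lie_deriv_diff_const[OF smooth(3) False] by simp
  qed simp
qed

theorem proposition3:
  fixes f g :: "real ^ 'n \<Rightarrow> real ^ 'n" and V :: "real ^ 'n \<Rightarrow> real"
  assumes "smooth f" and "smooth g" and "f 0 = 0"
    and "smooth V" and "positive_definite V" and "proper_fun V"
    and "\<forall>x. x \<noteq> 0 \<longrightarrow>
      lie_deriv g V x \<noteq> 0 \<or>
      (lie_deriv g V x = 0 \<longrightarrow> lie_deriv f V x < 0) \<or>
      (\<exists>N\<ge>1.
        lie_deriv g V x = 0 \<and>
        (\<forall>i\<in>{1..N}. (lie_deriv f ^^ i) V x = 0) \<and>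
        (\<forall>Ds. Ds \<noteq> [] \<and> set Ds \<subseteq> lie_algebra f g - {g} \<and> (\<lambda>_. 0) \<notin> set Ds \<and>
            (\<Sum>D\<leftarrow>Ds. lie_order f g D) \<le> N \<longrightarrow>
          foldr lie_deriv Ds V x = 0) \<and>
        ((lie_deriv f ^^ (N + 1)) V x < 0 \<or>
         (odd N \<and> lie_deriv (((\<lambda>X. lie_bracket X g) ^^ N) f) V x \<noteq> 0) \<or>
         (even N \<and> lie_deriv (((\<lambda>X. lie_bracket X g) ^^ N) f) V x < 0) \<or>
         ((lie_deriv f ^^ (N + 1)) V x = 0 \<and>
           lie_deriv (((\<lambda>X. lie_bracket X f) ^^ N) g) V x \<noteq> 0)))"
  shows "assumption1 (\<lambda>x u. f x + u *\<^sub>R g x) \<and>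
    SDF_SGAS (\<lambda>x (u::real). f x + u *\<^sub>R g x) \<and>
    SDF_WGAS (\<lambda>x (u::real). f x + u *\<^sub>R g x)"
proof -
  have "\<exists>m v. steering_control f g x m (\<lambda>y. V y - V x) v \<and> words_vanish f g x m (\<lambda>y. V y - V x)" if x: "x \<noteq> 0" for x
  proof -
    \<comment> \<open>The shift by \<open>V x\<close> makes the empty word vanish at
      \<open>x\<close> and leaves every derivative unchanged.\<close>
    let ?\<phi> = "\<lambda>y. V y - V x"
    have \<phi>: "smooth ?\<phi>" by (intro smooth_diff smooth_const assms)
    have D: "lie_deriv X ?\<phi> = lie_deriv X V" for X by (rule lie_deriv_diff_const[OF assms(4)])
    note Dn = funpow_lie_deriv_diff_const[OF assms(4)]
    \<comment> \<open>Condition (A) constrains \<open>f\<close> only where the derivative along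
      \<open>g\<close> vanishes, so it contributes the case \<open>drift\<close>. The first two
      cases are steered by words of length one.\<close>
    consider (input) "lie_deriv g V x \<noteq> 0" | (drift) "lie_deriv f V x < 0"
      | (higher) N where "N \<ge> 1"
        "\<And>Ds. Ds \<noteq> [] \<Longrightarrow> set Ds \<subseteq> lie_algebra f g - {g} \<Longrightarrow> (\<lambda>_. 0) \<notin> set Ds \<Longrightarrow>
          (\<Sum>D\<leftarrow>Ds. lie_order f g D) \<le> N \<Longrightarrow> foldr lie_deriv Ds V x = 0"
        "(lie_deriv f ^^ Suc N) V x < 0 \<or>
         (odd N \<and> lie_deriv (((\<lambda>X. lie_bracket X g) ^^ N) f) V x \<noteq> 0) \<or>
         (even N \<and> lie_deriv (((\<lambda>X. lie_bracket X g) ^^ N) f) V x < 0) \<or>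
         ((lie_deriv f ^^ Suc N) V x = 0 \<and> lie_deriv (((\<lambda>X. lie_bracket X f) ^^ N) g) V x \<noteq> 0)"
      using assms(7)[rule_format, OF x] unfolding Suc_eq_plus1 by blast
    then show ?thesis
    proof cases
      case input
      then have "\<exists>v. steering_control f g x (Suc 0) ?\<phi> v" by (intro steering_control_input) (simp add: D)
      then show ?thesis by (intro exI[of _ "Suc 0"]) simp
    next
      case drift
      then have "\<exists>v. steering_control f g x (Suc 0) ?\<phi> v" by (intro steering_control_drift) (simp add: D)
      then show ?thesis by (intro exI[of _ "Suc 0"]) simp
    next
      case (higher N)
      have "\<exists>v. steering_control f g x (Suc N) ?\<phi> v"
        using higher(3)
      proof (elim disjE)
        assume "(lie_deriv f ^^ Suc N) V x < 0"
        then show ?thesis by (intro steering_control_drift) (simp only: Dn)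
      next
        assume "odd N \<and> lie_deriv (((\<lambda>X. lie_bracket X g) ^^ N) f) V x \<noteq> 0"
        then show ?thesis using higher(1) by (intro steering_control_bracket_fg assms \<phi>) (simp_all add: D)
      next
        assume "even N \<and> lie_deriv (((\<lambda>X. lie_bracket X g) ^^ N) f) V x < 0"
        then show ?thesis using higher(1) by (intro steering_control_bracket_fg assms \<phi>) (simp_all add: D)
      next
        assume "(lie_deriv f ^^ Suc N) V x = 0 \<and> lie_deriv (((\<lambda>X. lie_bracket X f) ^^ N) g) V x \<noteq> 0"
        then show ?thesis by (intro steering_control_bracket_gf assms \<phi>) (simp_all only: Dn D, simp_all)
      qed
      moreover have "words_vanish f g x (Suc N) ?\<phi>"
        by (rule words_vanish_of_lie_words[OF assms(1,2,4) higher(2)])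
      ultimately show ?thesis by blast
    qed
  qed
  then interpret locally_steerable_system f g V
    using assms by unfold_locales
  show ?thesis using assumption1 SDF_SGAS SDF_WGAS by blast
qed

end
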